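(* Let $d\ge1$, let $0\neq v\in\mathbb{R}^d$, let $\Omega$ be a nonempty open subset of $\mathbb{R}^d$ symmetric with respect to the hyperplane $\langle v\rangle^\perp$, i.e. $\sigma_v(\Omega)=\Omega$, and let $\Omega_+=\{\omega\in\Omega:\langle\omega,v\rangle>0\}$. Let $p_t^{N,\Omega_+}$ and $p_t^{D,\Omega_+}$, and $p_t^{N,\Omega}$ and $p_t^{D,\Omega}$, denote the Neumann and the Dirichlet heat kernels on $\Omega_+$ and $\Omega$, respectively. Then $$p_t^{N,\Omega_+}(x,y)=p_t^{N,\Omega}(x,y)+p_t^{N,\Omega}(\sigma_v(x),y),\qquad x,y\in\Omega_+,\quad t>0,$$ and $$p_t^{D,\Omega_+}(x,y)=p_t^{D,\Omega}(x,y)-p_t^{D,\Omega}(\sigma_v(x),y),\qquad x,y\in\Omega_+,\quad t>0.$$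
   Context: For $0\ne v\in\mathbb{R}^d$, $\sigma_v(x)=x-2\frac{\langle v,x\rangle}{\|v\|^2}v$ is the orthogonal reflection with respect to the hyperplane $\langle v\rangle^\perp$ perpendicular to $v$ (for $d=1$, $\sigma_v(x)=-x$). For an open set $U\subset\mathbb{R}^d$, $H^1(U)$ is the Hilbert space of $f\in L^2(U)$ (complex-valued) whose first-order distributional derivatives belong to $L^2(U)$, with inner product $\langle f,g\rangle_{L^2(U)}+\sum_{j=1}^d\langle\partial_jf,\partial_jg\rangle_{L^2(U)}$; $H^1_0(U)$ is the closure of $C_c^\infty(U)$ in $H^1(U)$. Let $\mathfrak{t}_U[f,g]=\int_U\sum_{j=1}^d\partial_jf\,\overline{\partial_jg}\,dx$. The operator associated with a sesquilinear form $\mathfrak{t}$ with domain $\mathrm{Dom}(\mathfrak{t})$ in a Hilbert space $\mathcal{H}$ is $A_{\mathfrak t}h=u_h$ with $\mathrm{Dom}(A_{\mathfrak t})=\{h\in\mathrm{Dom}(\mathfrak t):\exists u_h\in\mathcal H\ \forall h'\in\mathrm{Dom}(\mathfrak t)\ \ \mathfrak t[h,h']=\langle u_h,h'\rangle\}$. The Neumann Laplacian $-\Delta_{N,U}$ is the operator on $L^2(U)$ associated with $\mathfrak{t}_U$ on the domain $H^1(U)$; the Dirichlet Laplacian $-\Delta_{D,U}$ is the operator on $L^2(U)$ associated with the restriction of $\mathfrak{t}_U$ to $H^1_0(U)$. Both are self-adjoint and non-negative. The Neumann (resp. Dirichlet) heat kernel on $U$ is the kernel $p_t^{N,U}(x,y)$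 (resp. $p_t^{D,U}(x,y)$), $C^\infty$ and strictly positive as a function of $(t,x,y)\in(0,\infty)\times U\times U$, of the operator $\exp(-t(-\Delta_{N,U}))$ (resp. $\exp(-t(-\Delta_{D,U}))$) defined by the spectral theorem: for every $t>0$ and $f\in L^2(U)$, $\exp(-t(-\Delta_{N/D,U}))f(x)=\int_U p_t^{N/D,U}(x,y)f(y)\,dy$ for a.e. $x\in U$. The existence of such kernels is known. *)

theory Defs
  imports "HOL-Analysis.Analysis"
begin

definition hyperplane_reflection :: "'a::real_inner \<Rightarrow> 'a \<Rightarrow> 'a" where
  "hyperplane_reflection v x = x - (2 * (v \<bullet> x) / (norm v)\<^sup>2) *\<^sub>R v"


section \<open>The Hilbert space of square-integrable functions\<close>

text \<open>
  Elements of \<open>L\<^sup>2(U)\<close> are represented by functions on the whole space; only their values on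
  \<open>U\<close> up to null sets matter, and identities in \<open>L\<^sup>2(U)\<close> are stated with \<open>ae_eq U\<close>.
  Operators on \<open>L\<^sup>2(U)\<close>, possibly unbounded, are represented by their graphs, which are
  closed under \<open>ae_eq U\<close> in both components.
\<close>

definition L2 :: "'a::euclidean_space set \<Rightarrow> ('a \<Rightarrow> complex) set" where
  "L2 U = {f. f \<in> borel_measurable (lebesgue_on U) \<and>
              integrable (lebesgue_on U) (\<lambda>x. (norm (f x))\<^sup>2)}"

definition ae_eq :: "'a::euclidean_space set \<Rightarrow> ('a \<Rightarrow> complex) \<Rightarrow> ('a \<Rightarrow> complex) \<Rightarrow> bool" where
  "ae_eq U f g \<longleftrightarrow> (AE x in lebesgue_on U. f x = g x)"

definition L2_inner :: "'a::euclidean_space set \<Rightarrow> ('a \<Rightarrow> complex) \<Rightarrow> ('a \<Rightarrow> complex) \<Rightarrow> complex" where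
  "L2_inner U f g = (LINT x|lebesgue_on U. f x * cnj (g x))"

definition L2_norm :: "'a::euclidean_space set \<Rightarrow> ('a \<Rightarrow> complex) \<Rightarrow> real" where
  "L2_norm U f = sqrt (Re (L2_inner U f f))"


section \<open>Sobolev spaces\<close>

primrec Ck_on :: "nat \<Rightarrow> 'a::real_normed_vector set \<Rightarrow> ('a \<Rightarrow> 'b::real_normed_vector) \<Rightarrow> bool" where
  "Ck_on 0 S f \<longleftrightarrow> continuous_on S f"
| "Ck_on (Suc k) S f \<longleftrightarrow>
     (\<forall>x\<in>S. f differentiable (at x)) \<and>
     (\<forall>h. Ck_on k S (\<lambda>x. frechet_derivative f (at x) h))"

text \<open>This is the usual notion of a \<open>C\<^sup>\<infinity>\<close> function only for open \<open>S\<close>.\<close>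

definition smooth_on :: "'a::real_normed_vector set \<Rightarrow> ('a \<Rightarrow> 'b::real_normed_vector) \<Rightarrow> bool" where
  "smooth_on S f \<longleftrightarrow> (\<forall>k. Ck_on k S f)"

definition test_functions :: "'a::euclidean_space set \<Rightarrow> ('a \<Rightarrow> complex) set" where
  "test_functions U = {\<phi>. smooth_on UNIV \<phi> \<and> compact (closure {x. \<phi> x \<noteq> 0}) \<and>
                           closure {x. \<phi> x \<noteq> 0} \<subseteq> U}"

definition is_weak_deriv ::
    "'a::euclidean_space set \<Rightarrow> 'a \<Rightarrow> ('a \<Rightarrow> complex) \<Rightarrow> ('a \<Rightarrow> complex) \<Rightarrow> bool" where
  "is_weak_deriv U b f g \<longleftrightarrow>
     (\<forall>\<phi>\<in>test_functions U.
        (LINT x|lebesgue_on U. f x * frechet_derivative \<phi> (at x) b) =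
        - (LINT x|lebesgue_on U. g x * \<phi> x))"

definition H1 :: "'a::euclidean_space set \<Rightarrow> ('a \<Rightarrow> complex) set" where
  "H1 U = {f \<in> L2 U. \<forall>b\<in>Basis. \<exists>g\<in>L2 U. is_weak_deriv U b f g}"

text \<open>The choice is between functions that agree almost everywhere on \<open>U\<close>.\<close>

definition weak_deriv ::
    "'a::euclidean_space set \<Rightarrow> 'a \<Rightarrow> ('a \<Rightarrow> complex) \<Rightarrow> 'a \<Rightarrow> complex" where
  "weak_deriv U b f = (SOME g. g \<in> L2 U \<and> is_weak_deriv U b f g)"

definition H1_inner :: "'a::euclidean_space set \<Rightarrow> ('a \<Rightarrow> complex) \<Rightarrow> ('a \<Rightarrow> complex) \<Rightarrow> complex" where
  "H1_inner U f g = L2_inner U f g + (\<Sum>b\<in>Basis. L2_inner U (weak_deriv U b f) (weak_deriv U b g))"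

definition H1_norm :: "'a::euclidean_space set \<Rightarrow> ('a \<Rightarrow> complex) \<Rightarrow> real" where
  "H1_norm U f = sqrt (Re (H1_inner U f f))"

definition H10 :: "'a::euclidean_space set \<Rightarrow> ('a \<Rightarrow> complex) set" where
  "H10 U = {f \<in> H1 U. \<forall>\<epsilon>>0. \<exists>\<phi>\<in>test_functions U. H1_norm U (\<lambda>x. f x - \<phi> x) < \<epsilon>}"


section \<open>Neumann and Dirichlet Laplacians\<close>

definition gradient_form :: "'a::euclidean_space set \<Rightarrow> ('a \<Rightarrow> complex) \<Rightarrow> ('a \<Rightarrow> complex) \<Rightarrow> complex" where
  "gradient_form U f g =
     (LINT x|lebesgue_on U. (\<Sum>b\<in>Basis. weak_deriv U b f x * cnj (weak_deriv U b g x)))"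

definition form_operator ::
    "'a::euclidean_space set \<Rightarrow> ('a \<Rightarrow> complex) set \<Rightarrow>
     (('a \<Rightarrow> complex) \<Rightarrow> ('a \<Rightarrow> complex) \<Rightarrow> complex) \<Rightarrow>
     (('a \<Rightarrow> complex) \<times> ('a \<Rightarrow> complex)) set" where
  "form_operator U D Q = {(h, u). h \<in> D \<and> u \<in> L2 U \<and> (\<forall>h'\<in>D. Q h h' = L2_inner U u h')}"

definition neumann_laplacian ::
    "'a::euclidean_space set \<Rightarrow> (('a \<Rightarrow> complex) \<times> ('a \<Rightarrow> complex)) set" where
  "neumann_laplacian U = form_operator U (H1 U) (gradient_form U)"

definition dirichlet_laplacian ::
    "'a::euclidean_space set \<Rightarrow> (('a \<Rightarrow> complex) \<times> ('a \<Rightarrow> complex)) set" where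
  "dirichlet_laplacian U = form_operator U (H10 U) (gradient_form U)"


section \<open>Spectral measures and functional calculus\<close>

text \<open>
  A projection is a linear, symmetric and idempotent map; idempotence is the case \<open>B = C\<close> of
  multiplicativity.
\<close>

definition projection_valued_measure ::
    "'a::euclidean_space set \<Rightarrow> (real set \<Rightarrow> ('a \<Rightarrow> complex) \<Rightarrow> ('a \<Rightarrow> complex)) \<Rightarrow> bool" where
  "projection_valued_measure U E \<longleftrightarrow>
     (\<forall>B\<in>sets borel. \<forall>f\<in>L2 U. E B f \<in> L2 U) \<and>
     (\<forall>B\<in>sets borel. \<forall>f\<in>L2 U. \<forall>g\<in>L2 U. \<forall>\<alpha> \<beta>.
        ae_eq U (E B (\<lambda>x. \<alpha> * f x + \<beta> * g x)) (\<lambda>x. \<alpha> * E B f x + \<beta> * E B g x)) \<and>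
     (\<forall>B\<in>sets borel. \<forall>f\<in>L2 U. \<forall>g\<in>L2 U. L2_inner U (E B f) g = L2_inner U f (E B g)) \<and>
     (\<forall>B\<in>sets borel. \<forall>C\<in>sets borel. \<forall>f\<in>L2 U. ae_eq U (E (B \<inter> C) f) (E B (E C f))) \<and>
     (\<forall>f\<in>L2 U. ae_eq U (E UNIV f) f) \<and>
     (\<forall>B. range B \<subseteq> sets borel \<and> disjoint_family B \<longrightarrow>
        (\<forall>f\<in>L2 U. (\<lambda>n. L2_norm U (\<lambda>x. (\<Sum>i<n. E (B i) f x) - E (\<Union>i. B i) f x))
                     \<longlonglongrightarrow> 0))"

text \<open>The measure \<open>B \<mapsto> \<langle>E(B) f, f\<rangle>\<close>.\<close>

definition scalar_spectral_measure ::
    "'a::euclidean_space set \<Rightarrow> (real set \<Rightarrow> ('a \<Rightarrow> complex) \<Rightarrow> ('a \<Rightarrow> complex)) \<Rightarrow>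
     ('a \<Rightarrow> complex) \<Rightarrow> real measure" where
  "scalar_spectral_measure U E f =
     measure_of UNIV (sets borel) (\<lambda>B. ennreal (Re (L2_inner U (E B f) f)))"

definition spectral_domain ::
    "'a::euclidean_space set \<Rightarrow> (real set \<Rightarrow> ('a \<Rightarrow> complex) \<Rightarrow> ('a \<Rightarrow> complex)) \<Rightarrow>
     (real \<Rightarrow> real) \<Rightarrow> ('a \<Rightarrow> complex) set" where
  "spectral_domain U E \<phi> =
     {f \<in> L2 U. integrable (scalar_spectral_measure U E f) (\<lambda>s. (\<phi> s)\<^sup>2)}"

text \<open>
  The graph of \<open>\<integral> \<phi>(s) dE(s)\<close>. The right-hand side is \<open>\<integral> \<phi>(s) d\<langle>E(s) f, g\<rangle>\<close>,
  written by polarization as a combination of integrals over positive measures; the domain is dense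
  and so determines \<open>u\<close>.
\<close>

definition spectral_integral ::
    "'a::euclidean_space set \<Rightarrow> (real set \<Rightarrow> ('a \<Rightarrow> complex) \<Rightarrow> ('a \<Rightarrow> complex)) \<Rightarrow>
     (real \<Rightarrow> real) \<Rightarrow> (('a \<Rightarrow> complex) \<times> ('a \<Rightarrow> complex)) set" where
  "spectral_integral U E \<phi> =
     {(f, u). f \<in> spectral_domain U E \<phi> \<and> u \<in> L2 U \<and>
        (\<forall>g\<in>spectral_domain U E \<phi>.
           L2_inner U u g =
           (\<Sum>k<4. \<i> ^ k *
              complex_of_real
                (LINT s|scalar_spectral_measure U E (\<lambda>x. f x + \<i> ^ k * g x). \<phi> s)) / 4)}"

definition is_spectral_resolution ::
    "'a::euclidean_space set \<Rightarrow> (('a \<Rightarrow> complex) \<times> ('a \<Rightarrow> complex)) set \<Rightarrow>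
     (real set \<Rightarrow> ('a \<Rightarrow> complex) \<Rightarrow> ('a \<Rightarrow> complex)) \<Rightarrow> bool" where
  "is_spectral_resolution U A E \<longleftrightarrow>
     projection_valued_measure U E \<and> A = spectral_integral U E (\<lambda>s. s)"


section \<open>Heat kernels\<close>

text \<open>
  By the spectral theorem a self-adjoint operator \<open>A\<close> has exactly one spectral resolution
  \<open>E\<close> (up to almost everywhere equality), and \<open>\<integral> exp(-t s) dE(s)\<close> is \<open>exp(-t A)\<close>.
  Integrability is part of the kernel representation because a Bochner integral that does not exist
  is \<open>0\<close> by convention.

  The kernel is required to be nonnegative only: it is strictly positive when \<open>U\<close> is connected, but
  vanishes at pairs of points in different components of \<open>U\<close>.
\<close>

definition is_heat_kernel ::
    "'a::euclidean_space set \<Rightarrow> (('a \<Rightarrow> complex) \<times> ('a \<Rightarrow> complex)) set \<Rightarrow>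
     (real \<Rightarrow> 'a \<Rightarrow> 'a \<Rightarrow> real) \<Rightarrow> bool" where
  "is_heat_kernel U A p \<longleftrightarrow>
     smooth_on ({0<..} \<times> U \<times> U) (\<lambda>(t, x, y). p t x y) \<and>
     (\<forall>t>0. \<forall>x\<in>U. \<forall>y\<in>U. p t x y \<ge> 0) \<and>
     (\<exists>E. is_spectral_resolution U A E \<and>
        (\<forall>t>0. \<forall>f\<in>L2 U. \<exists>u. (f, u) \<in> spectral_integral U E (\<lambda>s. exp (- t * s)) \<and>
           (AE x in lebesgue_on U.
              integrable (lebesgue_on U) (\<lambda>y. complex_of_real (p t x y) * f y) \<and>
              u x = (LINT y|lebesgue_on U. complex_of_real (p t x y) * f y))))"

definition neumann_heat_kernel ::
    "'a::euclidean_space set \<Rightarrow> (real \<Rightarrow> 'a \<Rightarrow> 'a \<Rightarrow> real) \<Rightarrow> bool" where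
  "neumann_heat_kernel U p \<longleftrightarrow> is_heat_kernel U (neumann_laplacian U) p"

definition dirichlet_heat_kernel ::
    "'a::euclidean_space set \<Rightarrow> (real \<Rightarrow> 'a \<Rightarrow> 'a \<Rightarrow> real) \<Rightarrow> bool" where
  "dirichlet_heat_kernel U p \<longleftrightarrow> is_heat_kernel U (dirichlet_laplacian U) p"

end

theory Submission
  imports Defs
begin

text \<open>
  Let \<open>\<sigma>\<close> be the reflection, \<open>\<Omega>\<^sub>+\<close> the part of \<open>\<Omega>\<close> on the positive side of the hyperplane, and let
  \<open>s = 1\<close> in the Neumann case and \<open>s = -1\<close> in the Dirichlet case. The operator
  \<open>R h = h + s (h \<circ> \<sigma>)\<close>, restricted to \<open>\<Omega>\<^sub>+\<close>, maps \<open>L\<^sup>2(\<Omega>)\<close> to \<open>L\<^sup>2(\<Omega>\<^sub>+)\<close>; its adjoint \<open>S\<close> is the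
  even, respectively odd, extension. The claim is the kernel form of the identity
  \<open>R exp(-t A) = exp(-t A\<^sub>+) R\<close>: applied to a function that lives on a small ball in \<open>\<Omega>\<^sub>+\<close>, where \<open>R\<close>
  acts as the identity, it says that \<open>p\<^sub>t(x, y) + s p\<^sub>t(\<sigma> x, y)\<close> and the kernel on \<open>\<Omega>\<^sub>+\<close> have the same
  integrals over all small balls in \<open>y\<close>, and both are continuous
  (\<open>continuous_kernel_zero\<close>, \<open>heat_kernel_folding\<close>).

  The generators are intertwined because the reflection is orthogonal. If \<open>A h = u\<close> and \<open>g\<close> is in the
  form domain on \<open>\<Omega>\<^sub>+\<close>, then
  \<open>t\<^sub>+[R h, g] = t[h, S g] = \<langle>u, S g\<rangle> = \<langle>R u, g\<rangle>\<close> (\<open>fold_form_operator\<close>), provided that \<open>R\<close> and \<open>S\<close>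
  respect the form domains. This is where the boundary conditions enter. The even extension of an
  \<open>H\<^sup>1\<close> function has no singular derivative on the hyperplane, since the tangential derivatives only
  meet even test functions and the normal derivative only odd ones, which vanish there
  (\<open>boundary_integration_by_parts\<close>, \<open>extend_weak_gradient\<close>). For the same reason an odd test
  function on \<open>\<Omega>\<close> can be cut off near the hyperplane at no cost in \<open>H\<^sup>1\<close>, so that \<open>R\<close> maps \<open>H\<^sup>1\<^sub>0(\<Omega>)\<close>
  to \<open>H\<^sup>1\<^sub>0(\<Omega>\<^sub>+)\<close> (\<open>odd_test_function_H10\<close>, \<open>fold_H10\<close>).

  Intertwined self-adjoint operators have intertwined semigroups (\<open>semigroup_intertwining\<close>). On a
  spectral subspace of a bounded interval the exponential is a power series in the operator, and \<open>R\<close>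
  carries \<open>A ^ k f\<close> to \<open>A\<^sub>+ ^ k R f\<close>; these subspaces are dense. The vectors \<open>A ^ k f\<close> are constructed
  from the spectral measure by approximation with simple functions (\<open>represents_exists\<close>), which rests
  on the completeness of \<open>L\<^sup>2\<close> (\<open>L2_complete\<close>).
\<close>

section \<open>The inner product of square-integrable functions\<close>

lemma L2_measurable [measurable_dest]: "f \<in> L2 U \<Longrightarrow> f \<in> borel_measurable (lebesgue_on U)"
  by (simp add: L2_def)

lemma L2_integrable_square: "f \<in> L2 U \<Longrightarrow> integrable (lebesgue_on U) (\<lambda>x. (norm (f x))\<^sup>2)"
  by (simp add: L2_def)

lemma L2_integrable_mult:
  assumes "f \<in> L2 U" "g \<in> L2 U"
  shows "integrable (lebesgue_on U) (\<lambda>x. f x * g x)"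
proof (rule Bochner_Integration.integrable_bound)
  show "integrable (lebesgue_on U) (\<lambda>x. (norm (f x))\<^sup>2 + (norm (g x))\<^sup>2)"
    using assms by (intro Bochner_Integration.integrable_add L2_integrable_square)
  show "(\<lambda>x. f x * g x) \<in> borel_measurable (lebesgue_on U)"
    using assms[THEN L2_measurable] by measurable
  have "a * b \<le> a\<^sup>2 + b\<^sup>2" if "a \<ge> 0" "b \<ge> 0" for a b :: real
  proof -
    have "0 \<le> (a - b)\<^sup>2 + a * b" using that by simp
    then show ?thesis by (simp add: power2_eq_square algebra_simps)
  qed
  then show "AE x in lebesgue_on U. norm (f x * g x) \<le> norm ((norm (f x))\<^sup>2 + (norm (g x))\<^sup>2)"
    by (simp add: norm_mult)
qed

lemma L2_cnj: "f \<in> L2 U \<Longrightarrow> (\<lambda>x. cnj (f x)) \<in> L2 U"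
  using measurable_compose[OF _ borel_measurable_continuous_onI[OF continuous_on_cnj[OF continuous_on_id]]]
  by (auto simp: L2_def)

lemma L2_integrable_inner:
  assumes "f \<in> L2 U" "g \<in> L2 U"
  shows "integrable (lebesgue_on U) (\<lambda>x. f x * cnj (g x))"
  using L2_integrable_mult[OF assms(1) L2_cnj[OF assms(2)]] .

lemma L2_zero: "(\<lambda>x. 0) \<in> L2 U"
  by (simp add: L2_def)

lemma L2_scale: "f \<in> L2 U \<Longrightarrow> (\<lambda>x. c * f x) \<in> L2 U"
  by (auto simp: L2_def norm_mult power_mult_distrib)

lemma L2_bounded_by:
  assumes "f \<in> borel_measurable (lebesgue_on U)" "integrable (lebesgue_on U) h"
    and "\<And>x. (norm (f x))\<^sup>2 \<le> h x"
  shows "f \<in> L2 U"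
proof -
  have "integrable (lebesgue_on U) (\<lambda>x. (norm (f x))\<^sup>2)"
  proof (rule Bochner_Integration.integrable_bound[OF assms(2)])
    show "(\<lambda>x. (norm (f x))\<^sup>2) \<in> borel_measurable (lebesgue_on U)" using assms(1) by measurable
    show "AE x in lebesgue_on U. norm ((norm (f x))\<^sup>2) \<le> norm (h x)"
      using assms(3) by (auto intro!: AE_I2 order_trans[OF _ abs_ge_self])
  qed
  then show ?thesis using assms(1) by (simp add: L2_def)
qed

lemma norm_add_square_le: "(norm (a + b :: 'a::real_normed_vector))\<^sup>2 \<le> 2 * (norm a)\<^sup>2 + 2 * (norm b)\<^sup>2"
proof -
  have "(norm (a + b))\<^sup>2 \<le> (norm a + norm b)\<^sup>2"
    by (intro power_mono norm_triangle_ineq) auto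
  also have "\<dots> \<le> 2 * (norm a)\<^sup>2 + 2 * (norm b)\<^sup>2"
    using sum_squares_bound[of "norm a" "norm b"] by (simp add: power2_sum)
  finally show ?thesis .
qed

lemma L2_add:
  assumes "f \<in> L2 U" "g \<in> L2 U"
  shows "(\<lambda>x. f x + g x) \<in> L2 U"
  using assms[THEN L2_measurable] norm_add_square_le
  by (intro L2_bounded_by[of _ _ "\<lambda>x. 2 * (norm (f x))\<^sup>2 + 2 * (norm (g x))\<^sup>2"])
     (auto intro!: Bochner_Integration.integrable_add integrable_mult_right
       L2_integrable_square assms)

lemma L2_uminus: "f \<in> L2 U \<Longrightarrow> (\<lambda>x. - f x) \<in> L2 U"
  using L2_scale[of f U "-1"] by simp

lemma L2_diff: "f \<in> L2 U \<Longrightarrow> g \<in> L2 U \<Longrightarrow> (\<lambda>x. f x - g x) \<in> L2 U"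
  using L2_add[OF _ L2_uminus, of f U g] by simp

lemma L2_sum: "(\<And>i. i \<in> I \<Longrightarrow> f i \<in> L2 U) \<Longrightarrow> (\<lambda>x. \<Sum>i\<in>I. f i x) \<in> L2 U"
  by (induction I rule: infinite_finite_induct) (auto intro: L2_zero L2_add)

lemma L2_mono:
  assumes VU: "V \<subseteq> U" "U \<in> sets lebesgue" "V \<in> sets lebesgue" and f: "f \<in> L2 U"
  shows "f \<in> L2 V"
proof -
  have Us: "U \<inter> space lebesgue \<in> sets lebesgue" and Vs: "V \<inter> space lebesgue \<in> sets lebesgue"
    using VU by simp_all
  have "integrable lebesgue (\<lambda>x. indicator U x *\<^sub>R (norm (f x))\<^sup>2)"
    using L2_integrable_square[OF f] by (simp only: integrable_restrict_space[OF Us])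
  from integrable_mult_indicator[OF VU(3) this]
  have "integrable lebesgue (\<lambda>x. indicator V x *\<^sub>R (norm (f x))\<^sup>2)"
    by (rule Bochner_Integration.integrable_cong[THEN iffD1, rotated 2])
       (use VU(1) in \<open>auto simp: indicator_def\<close>)
  then have "integrable (lebesgue_on V) (\<lambda>x. (norm (f x))\<^sup>2)"
    by (simp only: integrable_restrict_space[OF Vs])
  moreover have "f \<in> borel_measurable (lebesgue_on V)"
    by (rule measurable_restrict_mono[OF L2_measurable[OF f] VU(1)])
  ultimately show ?thesis by (simp add: L2_def)
qed

lemma L2_inner_add_left:
  "f \<in> L2 U \<Longrightarrow> g \<in> L2 U \<Longrightarrow> h \<in> L2 U \<Longrightarrow>
    L2_inner U (\<lambda>x. f x + g x) h = L2_inner U f h + L2_inner U g h"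
  by (simp add: L2_inner_def distrib_right L2_integrable_inner)

lemma L2_inner_diff_left:
  "f \<in> L2 U \<Longrightarrow> g \<in> L2 U \<Longrightarrow> h \<in> L2 U \<Longrightarrow>
    L2_inner U (\<lambda>x. f x - g x) h = L2_inner U f h - L2_inner U g h"
  by (simp add: L2_inner_def left_diff_distrib L2_integrable_inner)

lemma L2_inner_scale_left: "L2_inner U (\<lambda>x. c * f x) g = c * L2_inner U f g"
  by (simp add: L2_inner_def mult.assoc)

lemma L2_inner_sum_left:
  assumes "\<And>i. i \<in> I \<Longrightarrow> f i \<in> L2 U" "h \<in> L2 U"
  shows "L2_inner U (\<lambda>x. \<Sum>i\<in>I. f i x) h = (\<Sum>i\<in>I. L2_inner U (f i) h)"
proof -
  have "L2_inner U (\<lambda>x. \<Sum>i\<in>I. f i x) h = (LINT x|lebesgue_on U. (\<Sum>i\<in>I. f i x * cnj (h x)))"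
    by (simp add: L2_inner_def sum_distrib_right)
  also have "\<dots> = (\<Sum>i\<in>I. L2_inner U (f i) h)"
    unfolding L2_inner_def
    by (rule Bochner_Integration.integral_sum) (auto intro: L2_integrable_inner assms)
  finally show ?thesis .
qed

lemma L2_inner_cnj: "cnj (L2_inner U f g) = L2_inner U g f"
  unfolding L2_inner_def by (subst Bochner_Integration.integral_cnj[symmetric]) (simp add: mult.commute)

lemma L2_inner_add_right:
  "f \<in> L2 U \<Longrightarrow> g \<in> L2 U \<Longrightarrow> h \<in> L2 U \<Longrightarrow>
    L2_inner U h (\<lambda>x. f x + g x) = L2_inner U h f + L2_inner U h g"
  by (simp add: L2_inner_def distrib_left L2_integrable_inner)

lemma L2_inner_scale_right: "L2_inner U f (\<lambda>x. c * g x) = cnj c * L2_inner U f g"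
  by (simp add: L2_inner_def mult.left_commute)

lemma L2_inner_self: "L2_inner U f f = complex_of_real (LINT x|lebesgue_on U. (norm (f x))\<^sup>2)"
proof -
  have "(\<lambda>x. f x * cnj (f x)) = (\<lambda>x. complex_of_real ((norm (f x))\<^sup>2))"
    using complex_norm_square by auto
  then show ?thesis by (simp only: L2_inner_def integral_complex_of_real)
qed

lemma L2_norm_square: "(L2_norm U f)\<^sup>2 = (LINT x|lebesgue_on U. (norm (f x))\<^sup>2)"
  by (simp add: L2_norm_def L2_inner_self)

lemma L2_norm_nonneg: "0 \<le> L2_norm U f"
  by (simp add: L2_norm_def L2_inner_self)

lemma L2_inner_self_norm: "L2_inner U f f = complex_of_real ((L2_norm U f)\<^sup>2)"
  by (simp only: L2_inner_self L2_norm_square)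

lemma ae_eq_refl: "ae_eq U f f"
  by (simp add: ae_eq_def)

lemma L2_inner_cong:
  assumes "ae_eq U f f'" "ae_eq U g g'"
    and "f \<in> L2 U" "f' \<in> L2 U" "g \<in> L2 U" "g' \<in> L2 U"
  shows "L2_inner U f g = L2_inner U f' g'"
  unfolding L2_inner_def
proof (rule integral_cong_AE)
  show "AE x in lebesgue_on U. f x * cnj (g x) = f' x * cnj (g' x)"
    using assms(1,2) unfolding ae_eq_def by eventually_elim simp
qed (use assms in \<open>auto intro!: borel_measurable_integrable L2_integrable_inner\<close>)

lemma L2_nondegenerate:
  assumes "f \<in> L2 U" "g \<in> L2 U" and "\<And>h. h \<in> L2 U \<Longrightarrow> L2_inner U f h = L2_inner U g h"
  shows "ae_eq U f g"
proof -
  let ?d = "\<lambda>x. f x - g x"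
  have d: "?d \<in> L2 U" by (intro L2_diff assms)
  have "L2_inner U ?d ?d = 0"
    using assms(3)[OF d] by (simp add: L2_inner_diff_left assms d)
  then have "(LINT x|lebesgue_on U. (norm (?d x))\<^sup>2) = 0"
    by (simp add: L2_inner_self)
  then have "AE x in lebesgue_on U. (norm (?d x))\<^sup>2 = 0"
    by (subst (asm) integral_nonneg_eq_0_iff_AE) (auto intro: L2_integrable_square d)
  then show ?thesis by (auto simp: ae_eq_def)
qed

lemma L2_Cauchy_Schwarz:
  assumes "f \<in> L2 U" "g \<in> L2 U"
  shows "norm (L2_inner U f g) \<le> L2_norm U f * L2_norm U g"
proof -
  let ?M = "lebesgue_on U"
  have fg: "integrable ?M (\<lambda>x. norm (f x) * norm (g x))"
    using integrable_norm[OF L2_integrable_mult[OF assms]] by (simp add: norm_mult)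
  have "ennreal ((LINT x|?M. norm (f x) * norm (g x))\<^sup>2)
      = (\<integral>\<^sup>+x. ennreal (norm (f x)) * ennreal (norm (g x)) \<partial>?M)\<^sup>2"
    using nn_integral_eq_integral[OF fg]
    by (simp add: ennreal_power ennreal_mult)
  also have "\<dots> \<le> (\<integral>\<^sup>+x. (ennreal (norm (f x)))\<^sup>2 \<partial>?M) * (\<integral>\<^sup>+x. (ennreal (norm (g x)))\<^sup>2 \<partial>?M)"
    using assms[THEN L2_measurable] by (intro Cauchy_Schwarz_nn_integral) auto
  also have "\<dots> = ennreal ((L2_norm U f)\<^sup>2 * (L2_norm U g)\<^sup>2)"
    using nn_integral_eq_integral[OF L2_integrable_square[OF assms(1)]]
      nn_integral_eq_integral[OF L2_integrable_square[OF assms(2)]]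
    by (simp add: ennreal_power L2_norm_square ennreal_mult)
  finally have "(LINT x|?M. norm (f x) * norm (g x))\<^sup>2 \<le> (L2_norm U f * L2_norm U g)\<^sup>2"
    by (simp add: power_mult_distrib)
  then have "(LINT x|?M. norm (f x) * norm (g x)) \<le> L2_norm U f * L2_norm U g"
    by (rule power2_le_imp_le) (simp add: L2_norm_nonneg)
  moreover have "norm (L2_inner U f g) \<le> (LINT x|?M. norm (f x) * norm (g x))"
    unfolding L2_inner_def
    by (rule order_trans[OF integral_norm_bound]) (simp add: norm_mult)
  ultimately show ?thesis by linarith
qed

lemma L2_inner_tendsto_left:
  assumes "\<And>n. f n \<in> L2 U" "f' \<in> L2 U" "g \<in> L2 U"
    and "(\<lambda>n. L2_norm U (\<lambda>x. f n x - f' x)) \<longlonglongrightarrow> 0"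
  shows "(\<lambda>n. L2_inner U (f n) g) \<longlonglongrightarrow> L2_inner U f' g"
proof -
  have "(\<lambda>n. L2_inner U (f n) g - L2_inner U f' g) \<longlonglongrightarrow> 0"
  proof (rule Lim_null_comparison)
    show "\<forall>\<^sub>F n in sequentially. norm (L2_inner U (f n) g - L2_inner U f' g)
            \<le> L2_norm U (\<lambda>x. f n x - f' x) * L2_norm U g"
      using L2_Cauchy_Schwarz[OF L2_diff[OF assms(1,2)] assms(3)]
      by (simp add: L2_inner_diff_left assms)
    show "(\<lambda>n. L2_norm U (\<lambda>x. f n x - f' x) * L2_norm U g) \<longlonglongrightarrow> 0"
      using tendsto_mult_left_zero[OF assms(4)] .
  qed
  then show ?thesis by (simp add: LIM_zero_iff)
qed

text \<open>
  Completeness, in the form in which it is used: for a sequence whose increments decay geometrically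
  the pointwise sum of the increments converges almost everywhere, because the weighted sum
  \<open>\<Sum>j. 2 ^ j * |u (j+1) - u j|\<^sup>2\<close> is integrable and therefore finite almost everywhere.
\<close>

lemma L2_complete:
  assumes u: "\<And>j. u j \<in> L2 U"
    and decay: "\<And>j. (LINT x|lebesgue_on U. (norm (u (Suc j) x - u j x))\<^sup>2) \<le> C * (1/4) ^ j"
  obtains w where "w \<in> L2 U" "(\<lambda>j. L2_norm U (\<lambda>x. u j x - w x)) \<longlonglongrightarrow> 0"
proof -
  let ?M = "lebesgue_on U"
  define e where "e j x = 2 ^ j * (norm (u (Suc j) x - u j x))\<^sup>2" for j x
  have e_nonneg: "0 \<le> e j x" for j x by (simp add: e_def)
  have um [measurable]: "u j \<in> borel_measurable ?M" for j using u by (rule L2_measurable)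
  have e_int: "integrable ?M (e j)" for j
    unfolding e_def by (intro integrable_mult_right L2_integrable_square L2_diff u)
  have em [measurable]: "e j \<in> borel_measurable ?M" for j
    using e_int by (rule borel_measurable_integrable)
  have e_le: "(LINT x|?M. e j x) \<le> C * (1/2) ^ j" for j
  proof -
    have "(LINT x|?M. e j x) \<le> 2 ^ j * (C * (1/4) ^ j)"
      unfolding e_def using decay[of j] by simp
    also have "\<dots> = C * (1/2) ^ j"
      by (simp add: power_divide mult.assoc flip: power_mult_distrib)
         (simp add: field_simps flip: power_mult_distrib)
    finally show ?thesis .
  qed
  have norm_e: "(LINT x|?M. norm (e j x)) = (LINT x|?M. e j x)" for j
    using e_nonneg by simp
  have sum_int: "summable (\<lambda>j. LINT x|?M. norm (e j x))"
  proof (rule summable_comparison_test')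
    show "summable (\<lambda>j. C * (1/2::real) ^ j)" by (intro summable_mult summable_geometric) simp
    show "norm (LINT x|?M. norm (e j x)) \<le> C * (1/2) ^ j" if "j \<ge> 0" for j
      using e_le[of j] norm_e[of j] e_nonneg by simp
  qed
  have "(\<integral>\<^sup>+x. (\<Sum>j. ennreal (e j x)) \<partial>?M) = (\<Sum>j. ennreal (LINT x|?M. e j x))"
    using e_nonneg e_int
    by (subst nn_integral_suminf) (auto simp: nn_integral_eq_integral)
  also have "\<dots> < \<infinity>"
    using sum_int e_nonneg norm_e
    by (subst suminf_ennreal2) (auto intro!: integral_nonneg_AE)
  finally have "AE x in ?M. (\<Sum>j. ennreal (e j x)) \<noteq> \<infinity>"
    by (intro nn_integral_PInf_AE) simp_all
  then have ae: "AE x in ?M. summable (\<lambda>j. e j x)"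
    by eventually_elim (auto intro: summable_suminf_not_top e_nonneg)
  define D where "D x = (\<Sum>j. e j x)" for x
  have D_int: "integrable ?M D"
    unfolding D_def
    by (rule integrable_suminf) (use e_int e_nonneg ae sum_int in \<open>auto\<close>)
  define w where "w x = lim (\<lambda>j. u j x)" for x
  have wm [measurable]: "w \<in> borel_measurable ?M"
    unfolding w_def by measurable
  \<comment> \<open>The increments decay like \<open>sqrt (D x) * q ^ j\<close> with this \<open>q\<close>, and \<open>K\<close> comes from the geometric series.\<close>
  define q where "q = sqrt (1/2::real)"
  have q: "0 < q" "q < 1" "q\<^sup>2 = 1/2" by (auto simp: q_def real_sqrt_less_iff)
  have qj: "(q ^ j)\<^sup>2 = (1/2) ^ j" for j
  proof -
    have "(q ^ j)\<^sup>2 = (q\<^sup>2) ^ j" by (simp add: power2_eq_square power_mult_distrib)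
    then show ?thesis by (simp only: q(3))
  qed
  define K where "K = (1 / (1 - q))\<^sup>2"
  have tail: "(norm (u j x - w x))\<^sup>2 \<le> K * (1/2) ^ j * D x" if s: "summable (\<lambda>j. e j x)" for j x
  proof -
    have eD: "e j x \<le> D x" for j
      unfolding D_def using sum_le_suminf[OF s, of "{j}"] e_nonneg by auto
    have D0: "D x \<ge> 0" using eD[of 0] e_nonneg[of 0 x] by linarith
    have step: "norm (u (Suc j) x - u j x) \<le> sqrt (D x) * q ^ j" for j
    proof (rule power2_le_imp_le)
      have "(norm (u (Suc j) x - u j x))\<^sup>2 = e j x * (1/2) ^ j"
        by (simp add: e_def power_divide)
      also have "\<dots> \<le> D x * (1/2) ^ j" using eD by simp
      also have "\<dots> = (sqrt (D x) * q ^ j)\<^sup>2"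
        using D0 by (simp add: power_mult_distrib qj)
      finally show "(norm (u (Suc j) x - u j x))\<^sup>2 \<le> (sqrt (D x) * q ^ j)\<^sup>2" .
      show "0 \<le> sqrt (D x) * q ^ j" using D0 q by simp
    qed
    have geo: "summable (\<lambda>j. sqrt (D x) * q ^ j)"
      using q by (intro summable_mult summable_geometric) simp
    have sn: "summable (\<lambda>j. norm (u (Suc j) x - u j x))"
      by (rule summable_comparison_test'[OF geo]) (use step in simp)
    have "convergent (\<lambda>j. u j x)"
    proof -
      have "convergent (\<lambda>n. \<Sum>j<n. u (Suc j) x - u j x)"
        using summable_norm_cancel[OF sn] by (simp add: summable_iff_convergent)
      then have "convergent (\<lambda>n. u n x - u 0 x)" 
        using sum_lessThan_telescope[of "\<lambda>j. u j x"] by simp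
      then have "convergent (\<lambda>n. (u n x - u 0 x) + u 0 x)" by (intro convergent_add convergent_const)
      then show ?thesis by simp
    qed
    then have lim: "(\<lambda>j. u j x) \<longlonglongrightarrow> w x" by (simp add: w_def convergent_LIMSEQ_iff)
    have bd: "norm (u (j + n) x - u j x) \<le> sqrt (D x) * q ^ j / (1 - q)" for n
    proof -
      have "norm (u (j + n) x - u j x) = norm (\<Sum>i<n. u (Suc (j + i)) x - u (j + i) x)"
        using sum_lessThan_telescope[of "\<lambda>i. u (j + i) x" n] by simp
      also have "\<dots> \<le> (\<Sum>i<n. norm (u (Suc (j + i)) x - u (j + i) x))" by (rule norm_sum)
      also have "\<dots> \<le> (\<Sum>i<n. sqrt (D x) * q ^ (j + i))" by (intro sum_mono step)
      also have "\<dots> = sqrt (D x) * q ^ j * (\<Sum>i<n. q ^ i)"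
        by (simp add: power_add sum_distrib_left mult.assoc)
      also have "\<dots> \<le> sqrt (D x) * q ^ j * (1 / (1 - q))"
        using D0 q by (intro mult_left_mono) (auto simp: sum_gp_strict divide_simps)
      finally show ?thesis by simp
    qed
    have "norm (w x - u j x) \<le> sqrt (D x) * q ^ j / (1 - q)"
    proof (rule Lim_bounded)
      show "(\<lambda>n. norm (u (n + j) x - u j x)) \<longlonglongrightarrow> norm (w x - u j x)"
        by (intro tendsto_intros LIMSEQ_ignore_initial_segment lim)
      show "\<forall>n\<ge>0. norm (u (n + j) x - u j x) \<le> sqrt (D x) * q ^ j / (1 - q)"
        using bd by (simp add: add.commute)
    qed
    then have "(norm (u j x - w x))\<^sup>2 \<le> (sqrt (D x) * q ^ j / (1 - q))\<^sup>2"
      by (intro power_mono) (auto simp: norm_minus_commute)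
    also have "\<dots> = K * (1/2) ^ j * D x"
      using D0 by (simp add: K_def power_mult_distrib power_divide[of _ _ 2] qj)
    finally show ?thesis .
  qed
  have dif_int: "integrable ?M (\<lambda>x. (norm (u j x - w x))\<^sup>2)" for j
  proof (rule Bochner_Integration.integrable_bound[of _ "\<lambda>x. K * (1/2) ^ j * D x"])
    show "integrable ?M (\<lambda>x. K * (1/2) ^ j * D x)" by (intro integrable_mult_right D_int)
    show "AE x in ?M. norm ((norm (u j x - w x))\<^sup>2) \<le> norm (K * (1/2) ^ j * D x)"
      using ae by eventually_elim (use tail in \<open>auto intro: order_trans[OF _ abs_ge_self]\<close>)
  qed measurable
  have dif: "(\<lambda>x. u j x - w x) \<in> L2 U" for j
    using dif_int by (simp add: L2_def)
  have "w \<in> L2 U"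
    using L2_diff[OF u[of 0] dif[of 0]] by simp
  moreover have "(\<lambda>j. L2_norm U (\<lambda>x. u j x - w x)) \<longlonglongrightarrow> 0"
  proof -
    have le: "(LINT x|?M. (norm (u j x - w x))\<^sup>2) \<le> (LINT x|?M. D x) * K * (1/2) ^ j" for j
    proof -
      have "(LINT x|?M. (norm (u j x - w x))\<^sup>2) \<le> (LINT x|?M. K * (1/2) ^ j * D x)"
        by (rule integral_mono_AE[OF dif_int])
           (use ae tail in \<open>auto intro!: integrable_mult_right D_int elim!: eventually_mono\<close>)
      then show ?thesis by (simp add: mult_ac)
    qed
    have "(\<lambda>j. (LINT x|?M. (norm (u j x - w x))\<^sup>2)) \<longlonglongrightarrow> 0"
    proof (rule Lim_null_comparison)
      show "\<forall>\<^sub>F j in sequentially. norm (LINT x|?M. (norm (u j x - w x))\<^sup>2) \<le> (LINT x|?M. D x) * K * (1/2) ^ j"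
        using le by (auto intro!: always_eventually)
      show "(\<lambda>j. (LINT x|?M. D x) * K * (1/2::real) ^ j) \<longlonglongrightarrow> 0"
        by (intro tendsto_mult_right_zero LIMSEQ_power_zero) simp
    qed
    then show ?thesis
      using tendsto_real_sqrt[of _ 0 sequentially] by (simp add: L2_norm_def L2_inner_self)
  qed
  ultimately show ?thesis using that by blast
qed

section \<open>Functional calculus of a projection-valued measure\<close>

text \<open>
  It suffices to approximate \<open>\<psi>\<close> by simple functions. The weights \<open>v\<close> and \<open>w\<close> make it possible to compare
  measures that have densities with respect to the given ones.
\<close>

lemma weighted_measures_determined:
  fixes c :: "'i \<Rightarrow> complex" and d :: "'j \<Rightarrow> complex" and v w \<psi> :: "real \<Rightarrow> real"
  assumes sets_M: "\<And>i. i \<in> I \<Longrightarrow> sets (M i) = sets borel"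
    and sets_N: "\<And>j. j \<in> J \<Longrightarrow> sets (N j) = sets borel"
    and v: "\<And>i. i \<in> I \<Longrightarrow> integrable (M i) v"
    and w: "\<And>j. j \<in> J \<Longrightarrow> integrable (N j) w"
    and eq: "\<And>B. B \<in> sets borel \<Longrightarrow>
      (\<Sum>i\<in>I. c i * complex_of_real (LINT s|M i. indicator B s * v s)) =
      (\<Sum>j\<in>J. d j * complex_of_real (LINT s|N j. indicator B s * w s))"
    and \<psi>: "\<psi> \<in> borel_measurable borel"
    and \<psi>v: "\<And>i. i \<in> I \<Longrightarrow> integrable (M i) (\<lambda>s. \<psi> s * v s)"
    and \<psi>w: "\<And>j. j \<in> J \<Longrightarrow> integrable (N j) (\<lambda>s. \<psi> s * w s)"
  shows "(\<Sum>i\<in>I. c i * complex_of_real (LINT s|M i. \<psi> s * v s)) =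
         (\<Sum>j\<in>J. d j * complex_of_real (LINT s|N j. \<psi> s * w s))"
proof -
  obtain F where F: "\<And>n. simple_function borel (F n)"
    and F_lim: "\<And>s. (\<lambda>n. F n s) \<longlonglongrightarrow> \<psi> s" and F_le: "\<And>n s. norm (F n s) \<le> 2 * norm (\<psi> s)"
    using borel_measurable_implies_sequence_metric[OF \<psi>, of 0] by (auto simp: dist_norm)
  have simple: "(LINT s|L. F n s * h s) = (\<Sum>y\<in>range (F n). y * (LINT s|L. indicator (F n -` {y}) s * h s))"
    and simple_set: "F n -` {y} \<in> sets borel"
    if L: "sets L = sets borel" "integrable L h" for n y and L :: "real measure" and h :: "real \<Rightarrow> real"
  proof -
    have fin: "finite (range (F n))" using simple_functionD(1)[OF F[of n]] by simp
    show B: "F n -` {y} \<in> sets borel" for y using simple_functionD(2)[OF F[of n], of "{y}"] by simp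
    have rep: "F n s * h s = (\<Sum>y\<in>range (F n). y * (indicator (F n -` {y}) s * h s))" for s
    proof -
      have "(\<Sum>y\<in>range (F n). y * (indicator (F n -` {y}) s * h s))
          = (\<Sum>y\<in>range (F n). if y = F n s then y * h s else 0)"
        by (intro sum.cong) (auto simp: indicator_def)
      also have "\<dots> = F n s * h s" using fin by (simp add: sum.delta)
      finally show ?thesis by simp
    qed
    have "integrable L (\<lambda>s. indicator (F n -` {y}) s * h s)" for y
      using integrable_mult_indicator[OF _ L(2), of "F n -` {y}"] B L(1) by simp
    then show "(LINT s|L. F n s * h s) = (\<Sum>y\<in>range (F n). y * (LINT s|L. indicator (F n -` {y}) s * h s))"
      unfolding rep by (subst Bochner_Integration.integral_sum) auto
  qed
  have lim: "(\<lambda>n. LINT s|L. F n s * h s) \<longlonglongrightarrow> (LINT s|L. \<psi> s * h s)"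
    if L: "sets L = sets borel" "integrable L h" "integrable L (\<lambda>s. \<psi> s * h s)"
    for L :: "real measure" and h :: "real \<Rightarrow> real"
  proof (rule integral_dominated_convergence)
    have [measurable]: "h \<in> borel_measurable L" using L(2) by (rule borel_measurable_integrable)
    have [measurable]: "F n \<in> borel_measurable L" for n
      using borel_measurable_simple_function[OF F[of n]] L(1) by (simp cong: measurable_cong_sets)
    show "(\<lambda>s. F n s * h s) \<in> borel_measurable L" for n by measurable
    show "(\<lambda>s. \<psi> s * h s) \<in> borel_measurable L" using L(3) by (rule borel_measurable_integrable)
    show "integrable L (\<lambda>s. 2 * norm (\<psi> s * h s))" by (intro integrable_mult_right integrable_norm L)
    show "AE s in L. (\<lambda>n. F n s * h s) \<longlonglongrightarrow> \<psi> s * h s" by (intro AE_I2 tendsto_intros F_lim)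
    show "AE s in L. norm (F n s * h s) \<le> 2 * norm (\<psi> s * h s)" for n
      using mult_right_mono[OF F_le[of n], of "norm (h _)"] by (auto simp: norm_mult mult.assoc abs_mult)
  qed
  have "(\<Sum>i\<in>I. c i * complex_of_real (LINT s|M i. F n s * v s))
      = (\<Sum>j\<in>J. d j * complex_of_real (LINT s|N j. F n s * w s))" for n
  proof -
    have B: "F n -` {y} \<in> sets borel" for y
      using simple_functionD(2)[OF F[of n], of "{y}"] by simp
    have "(\<Sum>i\<in>I. c i * complex_of_real (LINT s|M i. F n s * v s))
        = (\<Sum>i\<in>I. \<Sum>y\<in>range (F n). of_real y * (c i * complex_of_real (LINT s|M i. indicator (F n -` {y}) s * v s)))"
      by (intro sum.cong refl) (simp only: simple[OF sets_M v] of_real_sum of_real_mult sum_distrib_left mult.left_commute)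
    also have "\<dots> = (\<Sum>y\<in>range (F n). of_real y * (\<Sum>i\<in>I. c i * complex_of_real (LINT s|M i. indicator (F n -` {y}) s * v s)))"
      by (subst sum.swap) (simp add: sum_distrib_left)
    also have "\<dots> = (\<Sum>y\<in>range (F n). of_real y * (\<Sum>j\<in>J. d j * complex_of_real (LINT s|N j. indicator (F n -` {y}) s * w s)))"
      using eq[OF B] by simp
    also have "\<dots> = (\<Sum>j\<in>J. \<Sum>y\<in>range (F n). of_real y * (d j * complex_of_real (LINT s|N j. indicator (F n -` {y}) s * w s)))"
      by (subst sum.swap) (simp add: sum_distrib_left)
    also have "\<dots> = (\<Sum>j\<in>J. d j * complex_of_real (LINT s|N j. F n s * w s))"
      by (intro sum.cong refl) (simp only: simple[OF sets_N w] of_real_sum of_real_mult sum_distrib_left mult.left_commute)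
    finally show ?thesis .
  qed
  moreover have "(\<lambda>n. \<Sum>i\<in>I. c i * complex_of_real (LINT s|M i. F n s * v s))
      \<longlonglongrightarrow> (\<Sum>i\<in>I. c i * complex_of_real (LINT s|M i. \<psi> s * v s))"
    by (intro tendsto_intros lim sets_M v \<psi>v)
  moreover have "(\<lambda>n. \<Sum>j\<in>J. d j * complex_of_real (LINT s|N j. F n s * w s))
      \<longlonglongrightarrow> (\<Sum>j\<in>J. d j * complex_of_real (LINT s|N j. \<psi> s * w s))"
    by (intro tendsto_intros lim sets_N w \<psi>w)
  ultimately show ?thesis using LIMSEQ_unique by fastforce
qed

text \<open>
  For \<open>M\<close>, \<open>N\<close>, \<open>L\<close> the spectral measures of \<open>f + g\<close>, \<open>f\<close> and \<open>g\<close> this shows that the domain of a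
  spectral integral is closed under addition.
\<close>

lemma nn_integral_le_two_measures:
  fixes M N L :: "real measure"
  assumes [simp]: "sets M = sets borel" "sets N = sets borel" "sets L = sets borel"
    and le: "\<And>B. B \<in> sets borel \<Longrightarrow> emeasure M B \<le> 2 * emeasure N B + 2 * emeasure L B"
    and "\<phi> \<in> borel_measurable borel"
  shows "(\<integral>\<^sup>+s. \<phi> s \<partial>M) \<le> 2 * (\<integral>\<^sup>+s. \<phi> s \<partial>N) + 2 * (\<integral>\<^sup>+s. \<phi> s \<partial>L)"
  using assms(5)
proof (induction rule: borel_measurable_induct)
  case (cong f g)
  then show ?case by simp
next
  case (set A)
  then show ?case using le[of A] by simp
next
  case (mult u c)
  have [measurable]: "u \<in> borel_measurable M" "u \<in> borel_measurable N" "u \<in> borel_measurable L"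
    using mult by (simp_all cong: measurable_cong_sets)
  show ?case
    using mult_left_mono[OF mult(4), of c] by (simp add: nn_integral_cmult distrib_left mult.left_commute)
next
  case (add u v)
  have [measurable]: "u \<in> borel_measurable M" "u \<in> borel_measurable N" "u \<in> borel_measurable L"
    "v \<in> borel_measurable M" "v \<in> borel_measurable N" "v \<in> borel_measurable L"
    using add by (simp_all cong: measurable_cong_sets)
  show ?case using add_mono[OF add.IH] by (simp add: nn_integral_add distrib_left ac_simps)
next
  case (seq U)
  have [measurable]: "U i \<in> borel_measurable M" for i
    using seq by (simp cong: measurable_cong_sets)
  have "(\<integral>\<^sup>+s. (SUP i. U i s) \<partial>M) = (SUP i. \<integral>\<^sup>+s. U i s \<partial>M)"
    using seq by (intro nn_integral_monotone_convergence_SUP) auto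
  also have "\<dots> \<le> 2 * (\<integral>\<^sup>+s. (SUP i. U i s) \<partial>N) + 2 * (\<integral>\<^sup>+s. (SUP i. U i s) \<partial>L)"
  proof (rule SUP_least)
    fix i
    have "(\<integral>\<^sup>+s. U i s \<partial>M) \<le> 2 * (\<integral>\<^sup>+s. U i s \<partial>N) + 2 * (\<integral>\<^sup>+s. U i s \<partial>L)" by (rule seq)
    also have "\<dots> \<le> 2 * (\<integral>\<^sup>+s. (SUP i. U i s) \<partial>N) + 2 * (\<integral>\<^sup>+s. (SUP i. U i s) \<partial>L)"
      by (intro add_mono mult_left_mono nn_integral_mono) (auto intro: SUP_upper)
    finally show "(\<integral>\<^sup>+s. U i s \<partial>M) \<le> 2 * (\<integral>\<^sup>+s. (SUP i. U i s) \<partial>N) + 2 * (\<integral>\<^sup>+s. (SUP i. U i s) \<partial>L)" .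
  qed
  finally show ?case by (simp add: image_comp SUP_apply)
qed

text \<open>
  The integral of \<open>\<phi>\<close> against the complex measure \<open>B \<mapsto> \<langle>E B f, g\<rangle>\<close>. Polarization writes it in terms of
  positive measures, for which integrals are defined.
\<close>

definition spectral_pairing ::
    "'a::euclidean_space set \<Rightarrow> (real set \<Rightarrow> ('a \<Rightarrow> complex) \<Rightarrow> ('a \<Rightarrow> complex)) \<Rightarrow>
     ('a \<Rightarrow> complex) \<Rightarrow> ('a \<Rightarrow> complex) \<Rightarrow> (real \<Rightarrow> real) \<Rightarrow> complex" where
  "spectral_pairing U E f g \<phi> =
     (\<Sum>k<4. (\<i> ^ k / 4) *
        complex_of_real (LINT s|scalar_spectral_measure U E (\<lambda>x. f x + \<i> ^ k * g x). \<phi> s))"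

lemma spectral_integral_iff_pairing:
  "(f, u) \<in> spectral_integral U E \<phi> \<longleftrightarrow>
     f \<in> spectral_domain U E \<phi> \<and> u \<in> L2 U \<and>
     (\<forall>g\<in>spectral_domain U E \<phi>. L2_inner U u g = spectral_pairing U E f g \<phi>)"
  by (simp add: spectral_integral_def spectral_pairing_def sum_divide_distrib)

locale pvm =
  fixes U :: "'a::euclidean_space set"
    and E :: "real set \<Rightarrow> ('a \<Rightarrow> complex) \<Rightarrow> ('a \<Rightarrow> complex)"
  assumes pvm: "projection_valued_measure U E"
begin

abbreviation "\<mu> \<equiv> scalar_spectral_measure U E"
abbreviation "pairing \<equiv> spectral_pairing U E"

lemma E_L2: "B \<in> sets borel \<Longrightarrow> f \<in> L2 U \<Longrightarrow> E B f \<in> L2 U"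
  using pvm by (simp add: projection_valued_measure_def)

lemma E_linear: "B \<in> sets borel \<Longrightarrow> f \<in> L2 U \<Longrightarrow> g \<in> L2 U \<Longrightarrow>
    ae_eq U (E B (\<lambda>x. f x + c * g x)) (\<lambda>x. E B f x + c * E B g x)"
proof -
  assume *: "B \<in> sets borel" "f \<in> L2 U" "g \<in> L2 U"
  have "ae_eq U (E B (\<lambda>x. 1 * f x + c * g x)) (\<lambda>x. 1 * E B f x + c * E B g x)"
    by (rule pvm[unfolded projection_valued_measure_def, THEN conjunct2, THEN conjunct1, rule_format])
       (fact *)+
  then show ?thesis by simp
qed

lemma E_symmetric: "B \<in> sets borel \<Longrightarrow> f \<in> L2 U \<Longrightarrow> g \<in> L2 U \<Longrightarrow>
    L2_inner U (E B f) g = L2_inner U f (E B g)"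
  using pvm by (simp add: projection_valued_measure_def)

lemma E_Int: "B \<in> sets borel \<Longrightarrow> C \<in> sets borel \<Longrightarrow> f \<in> L2 U \<Longrightarrow> ae_eq U (E (B \<inter> C) f) (E B (E C f))"
  using pvm by (simp add: projection_valued_measure_def)

lemma E_UNIV: "f \<in> L2 U \<Longrightarrow> ae_eq U (E UNIV f) f"
  using pvm by (simp add: projection_valued_measure_def)

lemma E_inner_Int:
  assumes "B \<in> sets borel" "C \<in> sets borel" "f \<in> L2 U" "g \<in> L2 U"
  shows "L2_inner U (E B f) (E C g) = L2_inner U (E (C \<inter> B) f) g"
proof -
  have "L2_inner U (E B f) (E C g) = L2_inner U (E C (E B f)) g"
    using assms by (simp add: E_symmetric E_L2)
  also have "\<dots> = L2_inner U (E (C \<inter> B) f) g"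
    using assms E_Int[of C B f]
    by (intro L2_inner_cong) (auto simp: ae_eq_def E_L2 sets.Int elim: eventually_mono)
  finally show ?thesis .
qed

lemma E_inner_self:
  assumes "B \<in> sets borel" "f \<in> L2 U"
  shows "L2_inner U (E B f) f = complex_of_real ((L2_norm U (E B f))\<^sup>2)"
  using E_inner_Int[OF assms(1,1,2,2)] by (simp add: L2_inner_self_norm)

lemma E_sums:
  assumes "range B \<subseteq> sets borel" "disjoint_family B" "f \<in> L2 U" "g \<in> L2 U"
  shows "(\<lambda>i. L2_inner U (E (B i) f) g) sums L2_inner U (E (\<Union>i. B i) f) g"
proof -
  have B: "B i \<in> sets borel" for i using assms(1) by auto
  have "(\<lambda>n. L2_inner U (\<lambda>x. \<Sum>i<n. E (B i) f x) g) \<longlonglongrightarrow> L2_inner U (E (\<Union>i. B i) f) g"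
    using pvm[unfolded projection_valued_measure_def] assms B
    by (intro L2_inner_tendsto_left L2_sum E_L2) simp_all
  then show ?thesis
    unfolding sums_def using B assms by (simp add: L2_inner_sum_left E_L2)
qed

lemma sets_\<mu> [simp]: "sets (\<mu> f) = sets borel"
  unfolding scalar_spectral_measure_def
  using sets.sigma_sets_eq[of "borel :: real measure"] by (simp add: sets_measure_of_conv)

lemma space_\<mu> [simp]: "space (\<mu> f) = UNIV"
  unfolding scalar_spectral_measure_def by (simp add: space_measure_of_conv)

lemma measurable_\<mu> [simp]: "measurable (\<mu> f) N = measurable borel N"
  by (rule measurable_cong_sets) simp_all

text \<open>
  Nonnegativity comes from \<open>\<langle>E B f, f\<rangle> = |E B f|\<^sup>2\<close>, and countable additivity from strong convergence;
  without both, \<^const>\<open>measure_of\<close> would silently produce the zero measure.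
\<close>

lemma emeasure_\<mu>:
  assumes f: "f \<in> L2 U" and B: "B \<in> sets borel"
  shows "emeasure (\<mu> f) B = ennreal ((L2_norm U (E B f))\<^sup>2)"
proof -
  let ?m = "\<lambda>B. ennreal (Re (L2_inner U (E B f) f))"
  have nonneg: "0 \<le> Re (L2_inner U (E B f) f)" if "B \<in> sets borel" for B
    using E_inner_self[OF that f] by simp
  have "(\<lambda>i::nat. L2_inner U (E {} f) f) sums L2_inner U (E {} f) f"
    using E_sums[of "\<lambda>_. {}", OF _ _ f f] by (simp add: disjoint_family_on_def)
  then have "summable (\<lambda>i::nat. L2_inner U (E {} f) f)" by (rule sums_summable)
  then have empty: "L2_inner U (E {} f) f = 0" by (simp add: summable_const_iff)
  have "emeasure (\<mu> f) B = ?m B"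
  proof (rule emeasure_measure_of[OF scalar_spectral_measure_def])
    show "positive (sets (\<mu> f)) ?m" by (simp add: positive_def empty)
    show "countably_additive (sets (\<mu> f)) ?m"
    proof (rule countably_additiveI)
      fix A :: "nat \<Rightarrow> real set"
      assume A: "range A \<subseteq> sets (\<mu> f)" "disjoint_family A"
      then have "(\<lambda>i. Re (L2_inner U (E (A i) f) f)) sums Re (L2_inner U (E (\<Union>i. A i) f) f)"
        using E_sums[OF _ A(2) f f] by (intro sums_Re) auto
      moreover have "0 \<le> Re (L2_inner U (E (A i) f) f)" for i
        using A(1) by (intro nonneg) auto
      ultimately show "(\<Sum>i. ?m (A i)) = ?m (\<Union>i. A i)" by (intro suminf_ennreal_eq)
    qed
  qed (use B in auto)
  then show ?thesis by (simp add: E_inner_self B f)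
qed

lemma finite_\<mu>: "f \<in> L2 U \<Longrightarrow> finite_measure (\<mu> f)"
  by (rule finite_measureI) (simp add: emeasure_\<mu>)

lemma measure_\<mu>:
  "f \<in> L2 U \<Longrightarrow> B \<in> sets borel \<Longrightarrow> measure (\<mu> f) B = (L2_norm U (E B f))\<^sup>2"
  by (simp add: measure_def emeasure_\<mu>)

lemma of_real_measure_\<mu>:
  "f \<in> L2 U \<Longrightarrow> B \<in> sets borel \<Longrightarrow> complex_of_real (measure (\<mu> f) B) = L2_inner U (E B f) f"
  by (simp only: measure_\<mu> E_inner_self)

lemma shift_L2: "f \<in> L2 U \<Longrightarrow> g \<in> L2 U \<Longrightarrow> (\<lambda>x. f x + c * g x) \<in> L2 U"
  by (intro L2_add L2_scale)

text \<open>
  Polarization. Identities between pairings follow from their special case for indicators, which by this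
  lemma is a statement about projections.
\<close>

lemma pairing_indicator:
  assumes f: "f \<in> L2 U" and g: "g \<in> L2 U" and B: "B \<in> sets borel"
  shows "pairing f g (indicator B) = L2_inner U (E B f) g"
proof -
  have *: "complex_of_real (LINT s|\<mu> (\<lambda>x. f x + c * g x). indicator B s) =
     L2_inner U (E B f) f + cnj c * L2_inner U (E B f) g + c * L2_inner U (E B g) f
     + c * cnj c * L2_inner U (E B g) g" (is "?l = _") for c
  proof -
    have "?l = L2_inner U (E B (\<lambda>x. f x + c * g x)) (\<lambda>x. f x + c * g x)"
      using B by (simp add: of_real_measure_\<mu> shift_L2 f g)
    also have "\<dots> = L2_inner U (\<lambda>x. E B f x + c * E B g x) (\<lambda>x. f x + c * g x)"
      using B by (intro L2_inner_cong E_linear ae_eq_refl shift_L2 E_L2 f g) auto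
    also have "\<dots> = L2_inner U (E B f) f + cnj c * L2_inner U (E B f) g + c * L2_inner U (E B g) f
     + c * cnj c * L2_inner U (E B g) g"
      using B by (simp add: L2_inner_add_left L2_inner_add_right L2_inner_scale_left
        L2_inner_scale_right L2_add L2_scale E_L2 f g algebra_simps)
    finally show ?thesis .
  qed
  have "(\<Sum>k<4. \<i> ^ k / 4 * (p + cnj (\<i> ^ k) * q + \<i> ^ k * r + \<i> ^ k * cnj (\<i> ^ k) * s)) = q"
    for p q r s :: complex
  proof -
    have "{..<4::nat} = {0, 1, 2, 3}" by auto
    moreover have "\<i> ^ 3 = - \<i>" by (simp add: power3_eq_cube)
    ultimately show ?thesis by (simp add: algebra_simps)
  qed
  then show ?thesis unfolding spectral_pairing_def * .
qed

text \<open>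
  For these functions the pairing makes sense for all \<open>f\<close> and \<open>g\<close>, so that no domain has to be tracked.
  Bounded functions are of this kind, and so is \<open>exp(-t s)\<close> when the semigroup is defined everywhere.
\<close>

definition integrable_all :: "(real \<Rightarrow> real) \<Rightarrow> bool" where
  "integrable_all \<phi> \<longleftrightarrow> \<phi> \<in> borel_measurable borel \<and> (\<forall>h\<in>L2 U. integrable (\<mu> h) \<phi>)"

lemma integrable_all_bounded:
  assumes "\<phi> \<in> borel_measurable borel" "\<And>s. \<bar>\<phi> s\<bar> \<le> C"
  shows "integrable_all \<phi>"
  unfolding integrable_all_def
proof (intro conjI ballI)
  fix h assume "h \<in> L2 U"
  then interpret finite_measure "\<mu> h" by (rule finite_\<mu>)
  show "integrable (\<mu> h) \<phi>" by (rule integrable_const_bound[where B = C]) (use assms in auto)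
qed (use assms in auto)

lemma integrable_allD:
  "integrable_all \<phi> \<Longrightarrow> f \<in> L2 U \<Longrightarrow> g \<in> L2 U \<Longrightarrow> integrable (\<mu> (\<lambda>x. f x + c * g x)) \<phi>"
  "integrable_all \<phi> \<Longrightarrow> f \<in> L2 U \<Longrightarrow> integrable (\<mu> f) \<phi>"
  "integrable_all \<phi> \<Longrightarrow> \<phi> \<in> borel_measurable borel"
  by (auto simp: integrable_all_def shift_L2)

lemma integrable_all_indicator: "B \<in> sets borel \<Longrightarrow> integrable_all (indicator B)"
  by (rule integrable_all_bounded[where C = 1]) (auto simp: indicator_def)

lemma integrable_all_indicator_mult:
  assumes "B \<in> sets borel" "integrable_all \<phi>"
  shows "integrable_all (\<lambda>s. indicator B s * \<phi> s)"
proof -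
  have [measurable]: "B \<in> sets borel" "\<phi> \<in> borel_measurable borel"
    using assms by (auto simp: integrable_all_def)
  have "(\<lambda>s. indicator B s * \<phi> s) \<in> borel_measurable borel" by measurable
  then show ?thesis
    using assms integrable_mult_indicator[of B "\<mu> h" \<phi> for h] unfolding integrable_all_def by simp
qed

lemma integrable_all_scale: "integrable_all \<phi> \<Longrightarrow> integrable_all (\<lambda>s. c * \<phi> s)"
  by (auto simp: integrable_all_def)

lemma pairing_scale: "pairing f g (\<lambda>s. c * \<phi> s) = of_real c * pairing f g \<phi>"
  by (simp add: spectral_pairing_def sum_distrib_left mult_ac)

lemma pairing_diff:
  assumes "integrable_all \<phi>" "integrable_all \<psi>" "f \<in> L2 U" "g \<in> L2 U"
  shows "pairing f g (\<lambda>s. \<phi> s - \<psi> s) = pairing f g \<phi> - pairing f g \<psi>"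
proof -
  have "(LINT s|\<mu> (\<lambda>x. f x + c * g x). \<phi> s - \<psi> s)
      = (LINT s|\<mu> (\<lambda>x. f x + c * g x). \<phi> s) - (LINT s|\<mu> (\<lambda>x. f x + c * g x). \<psi> s)" for c
    by (intro Bochner_Integration.integral_diff integrable_allD(1) assms)
  then show ?thesis
    by (simp only: spectral_pairing_def of_real_diff right_diff_distrib sum_subtractf)
qed

lemma pairing_sum:
  assumes "\<And>i. i \<in> I \<Longrightarrow> integrable_all (\<phi> i)" "f \<in> L2 U" "g \<in> L2 U"
  shows "pairing f g (\<lambda>s. \<Sum>i\<in>I. \<phi> i s) = (\<Sum>i\<in>I. pairing f g (\<phi> i))"
proof -
  have "(LINT s|\<mu> (\<lambda>x. f x + c * g x). (\<Sum>i\<in>I. \<phi> i s)) = (\<Sum>i\<in>I. LINT s|\<mu> (\<lambda>x. f x + c * g x). \<phi> i s)" for c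
    by (rule Bochner_Integration.integral_sum) (use assms in \<open>auto intro: integrable_allD\<close>)
  then show ?thesis
    by (simp add: spectral_pairing_def sum_distrib_left) (rule sum.swap)
qed

lemma pairing_tendsto:
  assumes \<phi>: "\<And>n. \<phi> n \<in> borel_measurable borel" and w: "integrable_all w"
    and le: "\<And>n s. \<bar>\<phi> n s\<bar> \<le> w s" and lim: "\<And>s. (\<lambda>n. \<phi> n s) \<longlonglongrightarrow> \<psi> s"
    and fg: "f \<in> L2 U" "g \<in> L2 U"
  shows "(\<lambda>n. pairing f g (\<phi> n)) \<longlonglongrightarrow> pairing f g \<psi>"
proof -
  have "\<psi> \<in> borel_measurable borel" using borel_measurable_LIMSEQ_real[OF lim \<phi>] by simp
  then have "(\<lambda>n. LINT s|\<mu> (\<lambda>x. f x + c * g x). \<phi> n s) \<longlonglongrightarrow> (LINT s|\<mu> (\<lambda>x. f x + c * g x). \<psi> s)" for c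
    by (intro integral_dominated_convergence[where w = w])
       (use assms in \<open>auto intro: integrable_allD\<close>)
  then show ?thesis unfolding spectral_pairing_def by (intro tendsto_intros)
qed

lemma combination_determined:
  fixes I J :: "nat set"
  assumes "\<And>k. F k \<in> L2 U" "\<And>k. G k \<in> L2 U" "integrable_all v" "integrable_all w"
    and "\<And>B. B \<in> sets borel \<Longrightarrow>
      (\<Sum>k\<in>I. c k * complex_of_real (LINT s|\<mu> (F k). indicator B s * v s)) =
      (\<Sum>k\<in>J. d k * complex_of_real (LINT s|\<mu> (G k). indicator B s * w s))"
    and "\<psi> \<in> borel_measurable borel"
    and "\<And>k. integrable (\<mu> (F k)) (\<lambda>s. \<psi> s * v s)" "\<And>k. integrable (\<mu> (G k)) (\<lambda>s. \<psi> s * w s)"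
  shows "(\<Sum>k\<in>I. c k * complex_of_real (LINT s|\<mu> (F k). \<psi> s * v s)) =
         (\<Sum>k\<in>J. d k * complex_of_real (LINT s|\<mu> (G k). \<psi> s * w s))"
  by (rule weighted_measures_determined) (simp_all add: assms integrable_allD)

lemma integrable_all_one: "integrable_all (\<lambda>_. 1)"
  by (rule integrable_all_bounded[where C = 1]) auto

lemma pairing_cnj:
  assumes \<phi>: "integrable_all \<phi>" and fg: "f \<in> L2 U" "g \<in> L2 U"
  shows "cnj (pairing f g \<phi>) = pairing g f \<phi>"
proof -
  have cnj_pairing: "cnj (pairing f g \<phi>) =
      (\<Sum>k<4. cnj (\<i> ^ k / 4) * complex_of_real (LINT s|\<mu> (\<lambda>x. f x + \<i> ^ k * g x). \<phi> s * 1))" for \<phi>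
    by (simp only: spectral_pairing_def cnj_sum complex_cnj_mult complex_cnj_complex_of_real mult_1_right)
  have pairing: "pairing g f \<phi> =
      (\<Sum>k<4. (\<i> ^ k / 4) * complex_of_real (LINT s|\<mu> (\<lambda>x. g x + \<i> ^ k * f x). \<phi> s * 1))" for \<phi>
    by (simp only: spectral_pairing_def mult_1_right)
  show ?thesis unfolding cnj_pairing pairing
  proof (rule combination_determined)
    fix B :: "real set" assume B: "B \<in> sets borel"
    have "cnj (pairing f g (indicator B)) = pairing g f (indicator B)"
      using B fg by (simp add: pairing_indicator L2_inner_cnj E_symmetric)
    then show "(\<Sum>k<4. cnj (\<i> ^ k / 4) * complex_of_real (LINT s|\<mu> (\<lambda>x. f x + \<i> ^ k * g x). indicator B s * 1))
      = (\<Sum>k<4. (\<i> ^ k / 4) * complex_of_real (LINT s|\<mu> (\<lambda>x. g x + \<i> ^ k * f x). indicator B s * 1))"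
      unfolding cnj_pairing pairing .
  next
    show "integrable (\<mu> (\<lambda>x. f x + \<i> ^ k * g x)) (\<lambda>s. \<phi> s * 1)"
      "integrable (\<mu> (\<lambda>x. g x + \<i> ^ k * f x)) (\<lambda>s. \<phi> s * 1)" for k
      unfolding mult_1_right using integrable_allD(1)[OF \<phi>] fg by blast+
  qed (rule shift_L2 integrable_all_one integrable_allD(3)[OF \<phi>] fg)+
qed

lemma pairing_self:
  assumes \<phi>: "integrable_all \<phi>" and f: "f \<in> L2 U"
  shows "pairing f f \<phi> = complex_of_real (LINT s|\<mu> f. \<phi> s)"
proof -
  have pairing: "pairing f f \<phi> =
      (\<Sum>k<4. (\<i> ^ k / 4) * complex_of_real (LINT s|\<mu> (\<lambda>x. f x + \<i> ^ k * f x). \<phi> s * 1))" for \<phi>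
    by (simp only: spectral_pairing_def mult_1_right)
  have single: "complex_of_real (LINT s|\<mu> f. \<phi> s) =
      (\<Sum>k\<in>{0::nat}. 1 * complex_of_real (LINT s|\<mu> f. \<phi> s * 1))" for \<phi>
    by simp
  have "(\<Sum>k<4. (\<i> ^ k / 4) * complex_of_real (LINT s|\<mu> (\<lambda>x. f x + \<i> ^ k * f x). \<phi> s * 1))
      = (\<Sum>k\<in>{0::nat}. 1 * complex_of_real (LINT s|\<mu> f. \<phi> s * 1))"
  proof (rule combination_determined)
    fix B :: "real set" assume B: "B \<in> sets borel"
    have "pairing f f (indicator B) = complex_of_real (LINT s|\<mu> f. indicator B s)"
      using B f by (simp add: pairing_indicator of_real_measure_\<mu>)
    then show "(\<Sum>k<4. (\<i> ^ k / 4) * complex_of_real (LINT s|\<mu> (\<lambda>x. f x + \<i> ^ k * f x). indicator B s * 1))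
      = (\<Sum>k\<in>{0::nat}. 1 * complex_of_real (LINT s|\<mu> f. indicator B s * 1))"
      by (rule trans[OF trans[OF pairing[symmetric]] single])
  next
    show "integrable (\<mu> (\<lambda>x. f x + \<i> ^ k * f x)) (\<lambda>s. \<phi> s * 1)"
      "integrable (\<mu> f) (\<lambda>s. \<phi> s * 1)" for k
      unfolding mult_1_right using integrable_allD(1,2)[OF \<phi>] f by blast+
  qed (rule shift_L2 integrable_all_one integrable_allD(3)[OF \<phi>] f)+
  then show ?thesis by (rule trans[OF trans[OF pairing] single[symmetric]])
qed

lemma pairing_E:
  assumes \<phi>: "integrable_all \<phi>" and fg: "f \<in> L2 U" "g \<in> L2 U" and B: "B \<in> sets borel"
  shows "pairing f (E B g) \<phi> = pairing f g (\<lambda>s. \<phi> s * indicator B s)"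
proof -
  have pairing: "pairing f h \<phi> =
      (\<Sum>k<4. (\<i> ^ k / 4) * complex_of_real (LINT s|\<mu> (\<lambda>x. f x + \<i> ^ k * h x). \<phi> s * 1))" for \<phi> h
    by (simp only: spectral_pairing_def mult_1_right)
  have weighted: "pairing f g (\<lambda>s. \<phi> s * indicator B s) =
      (\<Sum>k<4. (\<i> ^ k / 4) * complex_of_real (LINT s|\<mu> (\<lambda>x. f x + \<i> ^ k * g x). \<phi> s * indicator B s))" for \<phi>
    by (simp only: spectral_pairing_def)
  show ?thesis unfolding pairing[of "E B g"] weighted
  proof (rule combination_determined)
    fix C :: "real set" assume C: "C \<in> sets borel"
    have "pairing f (E B g) (indicator C) = pairing f g (indicator (B \<inter> C))"
      using B C fg by (simp add: pairing_indicator E_inner_Int E_L2 sets.Int)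
    also have "indicator (B \<inter> C) = (\<lambda>s. indicator C s * indicator B s :: real)"
      by (auto simp: indicator_def)
    finally show "(\<Sum>k<4. (\<i> ^ k / 4) * complex_of_real (LINT s|\<mu> (\<lambda>x. f x + \<i> ^ k * E B g x). indicator C s * 1))
      = (\<Sum>k<4. (\<i> ^ k / 4) * complex_of_real (LINT s|\<mu> (\<lambda>x. f x + \<i> ^ k * g x). indicator C s * indicator B s))"
      unfolding pairing[of "E B g"] weighted .
  next
    show "integrable (\<mu> (\<lambda>x. f x + \<i> ^ k * E B g x)) (\<lambda>s. \<phi> s * 1)" for k
      unfolding mult_1_right using integrable_allD(1)[OF \<phi>] E_L2[OF B] fg by blast
    show "integrable (\<mu> (\<lambda>x. f x + \<i> ^ k * g x)) (\<lambda>s. \<phi> s * indicator B s)" for k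
    proof -
      have comm: "(\<lambda>s. \<phi> s * indicator B s) = (\<lambda>s. indicator B s * \<phi> s)"
        by (simp add: fun_eq_iff)
      show ?thesis
        unfolding comm by (rule integrable_allD(1)[OF integrable_all_indicator_mult[OF B \<phi>] fg])
    qed
  qed (rule shift_L2 E_L2 B integrable_all_one integrable_all_indicator integrable_allD(3)[OF \<phi>] fg)+
qed

text \<open>
  The relation \<open>u = \<phi>(A) f\<close> in weak form. It is a relation because \<open>u\<close> is only determined almost
  everywhere.
\<close>

definition represents :: "(real \<Rightarrow> real) \<Rightarrow> ('a \<Rightarrow> complex) \<Rightarrow> ('a \<Rightarrow> complex) \<Rightarrow> bool" where
  "represents \<phi> f u \<longleftrightarrow> u \<in> L2 U \<and> (\<forall>g\<in>L2 U. L2_inner U u g = pairing f g \<phi>)"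

text \<open>
  The rule \<open>\<psi>(A) \<phi>(A) f = (\<psi> \<phi>)(A) f\<close> in weak form. As \<open>\<langle>E B u, g\<rangle> = \<langle>u, E B g\<rangle>\<close>, the complex measure of
  \<open>(u, g)\<close> is \<open>\<phi>\<close> times that of \<open>(f, g)\<close>.
\<close>

lemma pairing_compose:
  assumes \<phi>: "integrable_all \<phi>" and u: "represents \<phi> f u" and fg: "f \<in> L2 U" "g \<in> L2 U"
    and \<psi>: "\<psi> \<in> borel_measurable borel"
    and \<psi>u: "\<And>k. integrable (\<mu> (\<lambda>x. u x + \<i> ^ k * g x)) \<psi>"
    and \<psi>\<phi>: "integrable_all (\<lambda>s. \<psi> s * \<phi> s)"
  shows "pairing u g \<psi> = pairing f g (\<lambda>s. \<psi> s * \<phi> s)"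
proof -
  have uL2: "u \<in> L2 U" using u by (simp add: represents_def)
  have pairing: "pairing u g \<psi> =
      (\<Sum>k<4. (\<i> ^ k / 4) * complex_of_real (LINT s|\<mu> (\<lambda>x. u x + \<i> ^ k * g x). \<psi> s * 1))" for \<psi>
    by (simp only: spectral_pairing_def mult_1_right)
  have weighted: "pairing f g (\<lambda>s. \<psi> s * \<phi> s) =
      (\<Sum>k<4. (\<i> ^ k / 4) * complex_of_real (LINT s|\<mu> (\<lambda>x. f x + \<i> ^ k * g x). \<psi> s * \<phi> s))" for \<psi>
    by (simp only: spectral_pairing_def)
  show ?thesis unfolding pairing weighted
  proof (rule combination_determined)
    fix B :: "real set" assume B: "B \<in> sets borel"
    have "pairing u g (indicator B) = L2_inner U u (E B g)"
      using B fg uL2 by (simp add: pairing_indicator E_symmetric)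
    also have "\<dots> = pairing f (E B g) \<phi>"
      using u E_L2[OF B fg(2)] by (simp add: represents_def)
    also have "\<dots> = pairing f g (\<lambda>s. indicator B s * \<phi> s)"
      using pairing_E[OF \<phi> fg B] by (simp add: mult.commute)
    finally show "(\<Sum>k<4. (\<i> ^ k / 4) * complex_of_real (LINT s|\<mu> (\<lambda>x. u x + \<i> ^ k * g x). indicator B s * 1))
      = (\<Sum>k<4. (\<i> ^ k / 4) * complex_of_real (LINT s|\<mu> (\<lambda>x. f x + \<i> ^ k * g x). indicator B s * \<phi> s))"
      unfolding pairing weighted .
  next
    show "integrable (\<mu> (\<lambda>x. u x + \<i> ^ k * g x)) (\<lambda>s. \<psi> s * 1)" for k
      unfolding mult_1_right by (rule \<psi>u)
  qed (rule shift_L2 integrable_all_one \<phi> \<psi> fg uL2 integrable_allD(1)[OF \<psi>\<phi>])+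
qed

text \<open>
  The composition rule with \<open>\<psi> = \<phi>\<close> gives \<open>|u|\<^sup>2 = \<integral> \<phi>\<^sup>2 d\<mu> f\<close>.
\<close>

lemma represents_norm:
  assumes u: "represents \<phi> f u" and f: "f \<in> L2 U"
    and \<phi>: "\<phi> \<in> borel_measurable borel" "\<And>s. \<bar>\<phi> s\<bar> \<le> C"
  shows "(L2_norm U u)\<^sup>2 \<le> C\<^sup>2 * measure (\<mu> f) UNIV"
proof -
  have uL2: "u \<in> L2 U" using u by (simp add: represents_def)
  have i1: "integrable_all \<phi>" using \<phi> by (rule integrable_all_bounded)
  have sq: "\<bar>\<phi> s * \<phi> s\<bar> \<le> C\<^sup>2" for s
    using power_mono[OF \<phi>(2)[of s], of 2] by (simp add: power2_eq_square)
  have i2: "integrable_all (\<lambda>s. \<phi> s * \<phi> s)" using \<phi>(1) sq by (intro integrable_all_bounded) auto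
  have "L2_inner U u u = cnj (pairing u f \<phi>)"
    using u uL2 f by (simp add: represents_def pairing_cnj i1)
  also have "pairing u f \<phi> = complex_of_real (LINT s|\<mu> f. \<phi> s * \<phi> s)"
    using pairing_compose[OF i1 u f f \<phi>(1) integrable_allD(1)[OF i1 uL2 f] i2] pairing_self[OF i2 f]
    by simp
  finally have "(L2_norm U u)\<^sup>2 = (LINT s|\<mu> f. \<phi> s * \<phi> s)"
    by (simp add: L2_inner_self L2_norm_square)
  also have "\<dots> \<le> (LINT s|\<mu> f. C\<^sup>2)"
    using sq finite_measure.integrable_const[OF finite_\<mu>[OF f]]
    by (intro integral_mono integrable_allD(2)[OF i2 f]) (auto intro: order_trans[OF abs_ge_self])
  finally show ?thesis by (simp add: mult.commute)
qed

lemma represents_simple: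
  assumes fin: "finite (range \<phi>)" and \<phi>: "\<phi> \<in> borel_measurable borel" and f: "f \<in> L2 U"
  shows "\<exists>u. represents \<phi> f u"
proof
  let ?B = "\<lambda>y. \<phi> -` {y}"
  have B: "?B y \<in> sets borel" for y using measurable_sets[OF \<phi>, of "{y}"] by simp
  have rep: "\<phi> s = (\<Sum>y\<in>range \<phi>. y * indicator (?B y) s)" for s
  proof -
    have "(\<Sum>y\<in>range \<phi>. y * indicator (?B y) s) = (\<Sum>y\<in>range \<phi>. if y = \<phi> s then y else 0)"
      by (intro sum.cong) (auto simp: indicator_def)
    also have "\<dots> = \<phi> s" using fin by (simp add: sum.delta)
    finally show ?thesis by simp
  qed
  show "represents \<phi> f (\<lambda>x. \<Sum>y\<in>range \<phi>. of_real y * E (?B y) f x)"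
    unfolding represents_def
  proof (intro conjI ballI)
    show "(\<lambda>x. \<Sum>y\<in>range \<phi>. of_real y * E (?B y) f x) \<in> L2 U"
      by (intro L2_sum L2_scale E_L2 B f)
    fix g assume g: "g \<in> L2 U"
    have "pairing f g \<phi> = pairing f g (\<lambda>s. \<Sum>y\<in>range \<phi>. y * indicator (?B y) s)"
      using rep by (metis (no_types, lifting) ext)
    also have "\<dots> = (\<Sum>y\<in>range \<phi>. of_real y * L2_inner U (E (?B y) f) g)"
      by (subst pairing_sum)
         (auto simp: pairing_scale pairing_indicator f g B intro!: integrable_all_scale integrable_all_indicator)
    also have "\<dots> = L2_inner U (\<lambda>x. \<Sum>y\<in>range \<phi>. of_real y * E (?B y) f x) g"
      by (subst L2_inner_sum_left) (auto simp: L2_inner_scale_left intro!: L2_scale E_L2 B f g)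
    finally show "L2_inner U (\<lambda>x. \<Sum>y\<in>range \<phi>. of_real y * E (?B y) f x) g = pairing f g \<phi>" by simp
  qed
qed

text \<open>
  Rounding \<open>\<phi>\<close> down to multiples of \<open>2 ^ (-j)\<close> gives simple functions that converge uniformly. Their
  differences are bounded by \<open>2 * 2 ^ (-j)\<close>, so the vectors that they represent converge by completeness.
\<close>

lemma represents_exists:
  assumes \<phi>: "\<phi> \<in> borel_measurable borel" "\<And>s. \<bar>\<phi> s\<bar> \<le> C" and f: "f \<in> L2 U"
  shows "\<exists>u. represents \<phi> f u"
proof -
  define S where "S j s = of_int \<lfloor>2 ^ j * \<phi> s\<rfloor> / (2 ^ j :: real)" for j s
  have S_meas: "S j \<in> borel_measurable borel" for j
    unfolding S_def using \<phi>(1) by measurable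
  have S_close: "\<bar>S j s - \<phi> s\<bar> \<le> (1/2) ^ j" for j s
  proof -
    have "\<bar>S j s - \<phi> s\<bar> = \<bar>of_int \<lfloor>2 ^ j * \<phi> s\<rfloor> - 2 ^ j * \<phi> s\<bar> / 2 ^ j"
      by (simp add: S_def field_simps abs_mult flip: abs_divide)
    also have "\<dots> \<le> 1 / 2 ^ j" by (intro divide_right_mono) (linarith, simp)
    finally show ?thesis by (simp add: power_divide)
  qed
  have S_bd: "\<bar>S j s\<bar> \<le> C + 1" for j s
    using S_close[of j s] \<phi>(2)[of s] power_le_one[of "1/2::real" j] by linarith
  have S_fin: "finite (range (S j))" for j
  proof -
    have "range (S j) \<subseteq> (\<lambda>i. of_int i / 2 ^ j) ` {\<lfloor>- (2 ^ j * C)\<rfloor>..\<lfloor>2 ^ j * C\<rfloor>}"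
    proof (clarify)
      fix s
      have "2 ^ j * \<phi> s \<le> 2 ^ j * C" "- (2 ^ j * C) \<le> 2 ^ j * \<phi> s"
        using \<phi>(2)[of s] mult_left_mono[of "\<phi> s" C "2 ^ j"] mult_left_mono[of "- C" "\<phi> s" "2 ^ j"]
        by (simp_all add: abs_le_iff minus_le_iff)
      then show "S j s \<in> (\<lambda>i. of_int i / 2 ^ j) ` {\<lfloor>- (2 ^ j * C)\<rfloor>..\<lfloor>2 ^ j * C\<rfloor>}"
        unfolding S_def by (intro imageI) (simp add: floor_mono)
    qed
    then show ?thesis by (rule finite_subset) simp
  qed
  have "\<forall>j. \<exists>u. represents (S j) f u" using represents_simple[OF S_fin S_meas f] by blast
  then obtain u where u: "\<And>j. represents (S j) f (u j)" by metis
  have uL2: "u j \<in> L2 U" for j using u by (simp add: represents_def)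
  have Si: "integrable_all (S j)" for j by (rule integrable_all_bounded[OF S_meas S_bd])
  have "represents (\<lambda>s. S (Suc j) s - S j s) f (\<lambda>x. u (Suc j) x - u j x)" for j
    using u[of j] u[of "Suc j"]
    by (auto simp: represents_def L2_diff L2_inner_diff_left pairing_diff Si f)
  then have le: "(L2_norm U (\<lambda>x. u (Suc j) x - u j x))\<^sup>2 \<le> (2 * (1/2) ^ j)\<^sup>2 * measure (\<mu> f) UNIV" for j
  proof (rule represents_norm[OF _ f])
    show "\<bar>S (Suc j) s - S j s\<bar> \<le> 2 * (1/2) ^ j" for s
      using S_close[of j s] S_close[of "Suc j" s] power_decreasing[of j "Suc j" "1/2::real"] by linarith
  qed (use S_meas in measurable)
  have "(LINT x|lebesgue_on U. (norm (u (Suc j) x - u j x))\<^sup>2) \<le> (4 * measure (\<mu> f) UNIV) * (1/4) ^ j" for j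
  proof -
    have "(2 * (1/2) ^ j)\<^sup>2 = 4 * ((1/2 * (1/2)) ^ j :: real)"
      by (simp only: power2_eq_square power_mult_distrib)
    then have "(2 * (1/2) ^ j)\<^sup>2 = 4 * (1/4::real) ^ j" by simp
    then show ?thesis using le[of j] by (simp only: L2_norm_square mult_ac)
  qed
  then obtain w where w: "w \<in> L2 U" "(\<lambda>j. L2_norm U (\<lambda>x. u j x - w x)) \<longlonglongrightarrow> 0"
    using L2_complete[of u U, OF uL2] by blast
  have "L2_inner U w g = pairing f g \<phi>" if g: "g \<in> L2 U" for g
  proof (rule LIMSEQ_unique)
    show "(\<lambda>j. L2_inner U (u j) g) \<longlonglongrightarrow> L2_inner U w g"
      by (rule L2_inner_tendsto_left[OF uL2 w(1) g w(2)])
    have "(\<lambda>j. pairing f g (S j)) \<longlonglongrightarrow> pairing f g \<phi>"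
    proof (rule pairing_tendsto[OF S_meas _ S_bd _ f g])
      show "integrable_all (\<lambda>_. C + 1)" by (rule integrable_all_bounded) auto
      fix s
      have "(\<lambda>j. S j s - \<phi> s) \<longlonglongrightarrow> 0"
        by (rule Lim_null_comparison[of _ "\<lambda>j. (1/2::real) ^ j"])
           (use S_close in \<open>auto intro!: always_eventually LIMSEQ_power_zero\<close>)
      then show "(\<lambda>j. S j s) \<longlonglongrightarrow> \<phi> s" by (simp add: LIM_zero_iff)
    qed
    then show "(\<lambda>j. L2_inner U (u j) g) \<longlonglongrightarrow> pairing f g \<phi>"
      using u g by (simp add: represents_def)
  qed
  then show ?thesis using w(1) by (auto simp: represents_def)
qed

end

section \<open>Intertwining of semigroups\<close>

context pvm
begin

lemma integrable_of_square:
  fixes \<phi> :: "real \<Rightarrow> real"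
  assumes "h \<in> L2 U" "\<phi> \<in> borel_measurable borel" "integrable (\<mu> h) (\<lambda>s. (\<phi> s)\<^sup>2)"
  shows "integrable (\<mu> h) \<phi>"
proof (rule Bochner_Integration.integrable_bound)
  show "integrable (\<mu> h) (\<lambda>s. 1 + (\<phi> s)\<^sup>2)"
    using assms(3) finite_measure.integrable_const[OF finite_\<mu>[OF assms(1)]]
    by (intro Bochner_Integration.integrable_add) auto
  have "\<bar>a\<bar> \<le> 1 + a\<^sup>2" for a :: real
    using sum_squares_bound[of 1 "\<bar>a\<bar>"] by (simp add: power2_eq_square)
  then show "AE s in \<mu> h. norm (\<phi> s) \<le> norm (1 + (\<phi> s)\<^sup>2)"
    by (intro AE_I2) (simp add: add_nonneg_nonneg)
qed (use assms(2) in simp)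

text \<open>
  The projections satisfy \<open>|E B (h + c g)|\<^sup>2 \<le> 2 |E B h|\<^sup>2 + 2 |E B g|\<^sup>2\<close> for \<open>|c| = 1\<close>; polarization
  uses the scalars \<open>c = \<i> ^ k\<close>.
\<close>

lemma spectral_domain_add:
  assumes h: "h \<in> spectral_domain U E \<phi>" and g: "g \<in> spectral_domain U E \<phi>"
    and \<phi>: "\<phi> \<in> borel_measurable borel" and c: "norm c = 1"
  shows "(\<lambda>x. h x + c * g x) \<in> spectral_domain U E \<phi>"
proof -
  have L2: "h \<in> L2 U" "g \<in> L2 U" using h g by (auto simp: spectral_domain_def)
  let ?s = "\<lambda>x. h x + c * g x"
  have sL2: "?s \<in> L2 U" by (intro shift_L2 L2)
  have le: "emeasure (\<mu> ?s) B \<le> 2 * emeasure (\<mu> h) B + 2 * emeasure (\<mu> g) B"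
    if B: "B \<in> sets borel" for B
  proof -
    have EL2: "E B h \<in> L2 U" "E B g \<in> L2 U" using B L2 by (auto intro: E_L2)
    have "(L2_norm U (E B ?s))\<^sup>2 = (LINT x|lebesgue_on U. (norm (E B h x + c * E B g x))\<^sup>2)"
    proof -
      have "L2_inner U (E B ?s) (E B ?s)
          = L2_inner U (\<lambda>x. E B h x + c * E B g x) (\<lambda>x. E B h x + c * E B g x)"
        using B by (intro L2_inner_cong E_linear E_L2 shift_L2 L2)
      then show ?thesis by (simp add: L2_norm_def L2_inner_self)
    qed
    also have "\<dots> \<le> (LINT x|lebesgue_on U. 2 * (norm (E B h x))\<^sup>2 + 2 * (norm (E B g x))\<^sup>2)"
    proof (rule integral_mono)
      show "(norm (E B h x + c * E B g x))\<^sup>2 \<le> 2 * (norm (E B h x))\<^sup>2 + 2 * (norm (E B g x))\<^sup>2" for x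
        using norm_add_square_le[of "E B h x" "c * E B g x"] c by (simp add: norm_mult)
    qed (intro L2_integrable_square Bochner_Integration.integrable_add integrable_mult_right shift_L2 EL2)+
    also have "\<dots> = 2 * (L2_norm U (E B h))\<^sup>2 + 2 * (L2_norm U (E B g))\<^sup>2"
      using EL2 by (simp add: L2_norm_square L2_integrable_square)
    finally show ?thesis
      using B by (simp add: emeasure_\<mu> sL2 L2 flip: ennreal_plus ennreal_mult ennreal_numeral)
  qed
  have "integrable (\<mu> ?s) (\<lambda>s. (\<phi> s)\<^sup>2)"
  proof (rule integrableI_nonneg)
    have "(\<integral>\<^sup>+s. ennreal ((\<phi> s)\<^sup>2) \<partial>\<mu> ?s)
        \<le> 2 * (\<integral>\<^sup>+s. ennreal ((\<phi> s)\<^sup>2) \<partial>\<mu> h) + 2 * (\<integral>\<^sup>+s. ennreal ((\<phi> s)\<^sup>2) \<partial>\<mu> g)"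
      using \<phi> by (intro nn_integral_le_two_measures le) auto
    also have "\<dots> < \<infinity>"
      using h g by (auto simp: spectral_domain_def nn_integral_eq_integral ennreal_mult_less_top)
    finally show "(\<integral>\<^sup>+s. ennreal ((\<phi> s)\<^sup>2) \<partial>\<mu> ?s) < \<infinity>" .
  qed (use \<phi> in auto)
  then show ?thesis using sL2 by (simp add: spectral_domain_def)
qed

abbreviation truncated_power :: "nat \<Rightarrow> nat \<Rightarrow> real \<Rightarrow> real" where
  "truncated_power n k s \<equiv> s ^ k * indicator {- real n..real n} s"

lemma truncated_power_le: "\<bar>truncated_power n k s\<bar> \<le> real n ^ k"
  by (auto simp: indicator_def abs_mult power_abs intro!: power_mono)

lemma truncated_power_measurable: "truncated_power n k \<in> borel_measurable borel"
  by measurable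

lemma integrable_all_truncated_power: "integrable_all (truncated_power n k)"
  by (rule integrable_all_bounded[OF truncated_power_measurable truncated_power_le])

text \<open>
  The vectors \<open>A ^ k E[-n, n] f\<close>. They exist because \<open>s ^ k\<close> is bounded on \<open>[-n, n]\<close>, and they stay in the
  domain of \<open>A\<close>.
\<close>

lemma truncated_iterates:
  assumes f: "f \<in> L2 U"
  obtains F where "\<And>n k. represents (truncated_power n k) f (F n k)"
    and "\<And>n k. (F n k, F n (Suc k)) \<in> spectral_integral U E (\<lambda>s. s)"
proof -
  have "\<forall>n k. \<exists>u. represents (truncated_power n k) f u"
    using represents_exists[OF truncated_power_measurable truncated_power_le f] by blast
  then obtain F where F: "\<And>n k. represents (truncated_power n k) f (F n k)" by metis
  have FL2: "F n k \<in> L2 U" for n k using F by (simp add: represents_def)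
  \<comment> \<open>The vector \<open>F n k\<close> lies in the range of \<open>E [-n, n]\<close>, so its measure has bounded support.\<close>
  have null: "AE s in \<mu> (F n k). s \<in> {- real n..real n}" for n k
  proof -
    let ?C = "- {- real n..real n}"
    have C: "?C \<in> sets borel" by auto
    have "complex_of_real (measure (\<mu> (F n k)) ?C) = L2_inner U (F n k) (E ?C (F n k))"
      by (simp only: of_real_measure_\<mu> FL2 C E_symmetric)
    also have "\<dots> = pairing f (F n k) (\<lambda>s. truncated_power n k s * indicator ?C s)"
      using F[where n = n and k = k] E_L2[OF C FL2[of n k]]
      by (simp only: represents_def pairing_E[OF integrable_all_truncated_power f FL2 C])
    also have "(\<lambda>s. truncated_power n k s * indicator ?C s) = (\<lambda>s. 0)"
      by (auto simp: indicator_def fun_eq_iff)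
    also have "pairing f (F n k) (\<lambda>s. 0) = 0" by (simp add: spectral_pairing_def)
    finally have "measure (\<mu> (F n k)) ?C = 0" by simp
    then have "emeasure (\<mu> (F n k)) ?C = 0"
      by (simp add: finite_measure.emeasure_eq_measure[OF finite_\<mu>[OF FL2]])
    then have "?C \<in> null_sets (\<mu> (F n k))" using C by (intro null_setsI) auto
    then show ?thesis by (rule AE_I') auto
  qed
  have dom: "F n k \<in> spectral_domain U E (\<lambda>s. s)" for n k
  proof -
    interpret finite_measure "\<mu> (F n k)" by (rule finite_\<mu>[OF FL2])
    have "integrable (\<mu> (F n k)) (\<lambda>s. s\<^sup>2)"
    proof (rule integrable_const_bound)
      show "AE s in \<mu> (F n k). norm (s\<^sup>2) \<le> (real n)\<^sup>2"
        using null[of n k] by eventually_elim (auto simp: power2_le_iff_abs_le abs_le_iff)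
    qed simp
    then show ?thesis using FL2 by (simp add: spectral_domain_def)
  qed
  have "(F n k, F n (Suc k)) \<in> spectral_integral U E (\<lambda>s. s)" for n k
    unfolding spectral_integral_iff_pairing
  proof (intro conjI ballI dom FL2)
    fix g assume g: "g \<in> spectral_domain U E (\<lambda>s. s)"
    then have gL2: "g \<in> L2 U" by (simp add: spectral_domain_def)
    have int: "integrable (\<mu> (\<lambda>x. F n k x + \<i> ^ j * g x)) (\<lambda>s. s)" for j
    proof -
      have "(\<lambda>x. F n k x + \<i> ^ j * g x) \<in> spectral_domain U E (\<lambda>s. s)"
        by (rule spectral_domain_add[OF dom g]) (simp_all add: norm_power)
      then show ?thesis
        using integrable_of_square[of "\<lambda>x. F n k x + \<i> ^ j * g x" "\<lambda>s. s"]
        by (simp add: spectral_domain_def)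
    qed
    have eq: "(\<lambda>s. s * truncated_power n k s) = truncated_power n (Suc k)" by (simp add: fun_eq_iff mult.assoc)
    have tr: "integrable_all (\<lambda>s. s * truncated_power n k s)"
      unfolding eq by (rule integrable_all_truncated_power)
    have "pairing (F n k) g (\<lambda>s. s) = pairing f g (\<lambda>s. s * truncated_power n k s)"
      by (rule pairing_compose[OF integrable_all_truncated_power F f gL2 _ int tr]) simp
    then have "pairing (F n k) g (\<lambda>s. s) = pairing f g (truncated_power n (Suc k))"
      unfolding eq .
    then show "L2_inner U (F n (Suc k)) g = pairing (F n k) g (\<lambda>s. s)"
      using F[where n = n and k = "Suc k"] gL2 by (simp add: represents_def)
  qed
  then show ?thesis using that F by blast
qed

lemma truncation_tendsto:
  assumes f: "f \<in> L2 U" and g: "g \<in> L2 U" and F: "\<And>n. represents (truncated_power n 0) f (F n)"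
  shows "(\<lambda>n. L2_inner U (F n) g) \<longlonglongrightarrow> L2_inner U f g"
proof -
  have "(\<lambda>n. pairing f g (truncated_power n 0)) \<longlonglongrightarrow> pairing f g (\<lambda>_. 1)"
  proof (rule pairing_tendsto[OF truncated_power_measurable integrable_all_one _ _ f g])
    show "\<bar>truncated_power n 0 s\<bar> \<le> 1" for n s by (simp add: indicator_def)
    fix s :: real
    obtain N :: nat where N: "\<bar>s\<bar> \<le> real N" using real_arch_simple by blast
    have "truncated_power n 0 s = 1" if "n \<ge> N" for n
      using N that by (auto simp: indicator_def abs_le_iff)
    then show "(\<lambda>n. truncated_power n 0 s) \<longlonglongrightarrow> 1"
      by (intro tendsto_eventually) (auto simp: eventually_sequentially)
  qed
  moreover have "pairing f g (\<lambda>_. 1) = L2_inner U f g"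
    using pairing_indicator[OF f g, of UNIV] L2_inner_cong[OF E_UNIV[OF f] ae_eq_refl _ f g g] E_L2[of UNIV] f
    by simp
  ultimately show ?thesis using F g by (simp add: represents_def)
qed

text \<open>
  On \<open>[-n, n]\<close> the exponential series converges boundedly, so it may be integrated term by term.
\<close>

lemma pairing_exp_sums:
  assumes f: "f \<in> L2 U" and g: "g \<in> L2 U"
    and F: "\<And>k. represents (truncated_power n k) f (F k)"
    and ex: "integrable_all (\<lambda>s. exp (- t * s))"
  shows "(\<lambda>k. complex_of_real ((- t) ^ k / fact k) * L2_inner U (F k) g)
           sums pairing (F 0) g (\<lambda>s. exp (- t * s))"
proof -
  let ?e = "\<lambda>s. exp (- t * s)"
  define S where "S N s = (\<Sum>k<N. (- t) ^ k / fact k * truncated_power n k s)" for N s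
  have FL2: "F k \<in> L2 U" for k using F by (simp add: represents_def)
  have tr: "integrable_all (\<lambda>s. ?e s * truncated_power n 0 s)"
    using integrable_all_indicator_mult[OF _ ex, of "{- real n..real n}"] by (simp add: mult.commute)
  have S_eq: "S N s = (\<Sum>k<N. (- t * s) ^ k /\<^sub>R fact k) * indicator {- real n..real n} s" for N s
    unfolding S_def power_mult_distrib
    by (simp add: sum_distrib_left divide_inverse mult_ac)
  have "(\<lambda>N. pairing f g (S N)) \<longlonglongrightarrow> pairing f g (\<lambda>s. ?e s * truncated_power n 0 s)"
  proof (rule pairing_tendsto[OF _ _ _ _ f g])
    show "S N \<in> borel_measurable borel" for N unfolding S_def by measurable
    show "integrable_all (\<lambda>_. exp (\<bar>t\<bar> * n))" by (rule integrable_all_bounded) auto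
    show "\<bar>S N s\<bar> \<le> exp (\<bar>t\<bar> * n)" for N s
    proof (cases "s \<in> {- real n..real n}")
      case True
      have "\<bar>S N s\<bar> \<le> (\<Sum>k<N. (\<bar>t * s\<bar>) ^ k /\<^sub>R fact k)"
        using True unfolding S_eq
        by (auto intro!: order_trans[OF sum_abs] sum_mono simp: abs_mult power_abs)
      also have "\<dots> \<le> exp \<bar>t * s\<bar>"
        unfolding exp_def by (rule sum_le_suminf[OF summable_exp_generic]) auto
      also have "\<dots> \<le> exp (\<bar>t\<bar> * n)"
        using True by (auto simp: abs_mult abs_le_iff intro!: mult_left_mono)
      finally show ?thesis .
    qed (simp add: S_eq)
    show "(\<lambda>N. S N s) \<longlonglongrightarrow> ?e s * truncated_power n 0 s" for s
      using tendsto_mult_right[OF exp_converges[of "- t * s", unfolded sums_def], of "indicator {- real n..real n} s"]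
      unfolding S_eq by simp
  qed
  also have "pairing f g (\<lambda>s. ?e s * truncated_power n 0 s) = pairing (F 0) g ?e"
    by (rule pairing_compose[OF integrable_all_truncated_power F f g _ _ tr, symmetric])
       (fact f g FL2 integrable_allD(3)[OF ex] integrable_allD(1)[OF ex FL2 g])+
  also have "(\<lambda>N. pairing f g (S N)) = (\<lambda>N. \<Sum>k<N. complex_of_real ((- t) ^ k / fact k) * L2_inner U (F k) g)"
  proof
    fix N
    have "pairing f g (S N) = (\<Sum>k<N. pairing f g (\<lambda>s. (- t) ^ k / fact k * truncated_power n k s))"
      unfolding S_def by (rule pairing_sum[OF integrable_all_scale[OF integrable_all_truncated_power] f g])
    also have "\<dots> = (\<Sum>k<N. complex_of_real ((- t) ^ k / fact k) * L2_inner U (F k) g)"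
      using F g by (simp only: pairing_scale) (simp add: represents_def)
    finally show "pairing f g (S N) = (\<Sum>k<N. complex_of_real ((- t) ^ k / fact k) * L2_inner U (F k) g)" .
  qed
  finally show ?thesis by (simp only: sums_def)
qed

lemma integrable_all_of_total:
  assumes \<phi>: "\<phi> \<in> borel_measurable borel"
    and total: "\<And>f. f \<in> L2 U \<Longrightarrow> \<exists>u. (f, u) \<in> spectral_integral U E \<phi>"
  shows "integrable_all \<phi>"
  unfolding integrable_all_def
proof (intro conjI ballI \<phi>)
  fix h assume h: "h \<in> L2 U"
  then have "h \<in> spectral_domain U E \<phi>" using total by (auto simp: spectral_integral_def)
  then show "integrable (\<mu> h) \<phi>" using integrable_of_square[OF h \<phi>] by (simp add: spectral_domain_def)
qed

lemma spectral_integral_represents: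
  assumes total: "\<And>f. f \<in> L2 U \<Longrightarrow> \<exists>u. (f, u) \<in> spectral_integral U E \<phi>"
    and fu: "(f, u) \<in> spectral_integral U E \<phi>"
  shows "represents \<phi> f u"
proof -
  have "g \<in> spectral_domain U E \<phi>" if "g \<in> L2 U" for g
    using total[OF that] by (auto simp: spectral_integral_def)
  then show ?thesis using fu by (auto simp: represents_def spectral_integral_iff_pairing)
qed

lemma represents_symmetric:
  assumes "integrable_all \<phi>" "represents \<phi> f u" "represents \<phi> g w" "f \<in> L2 U" "g \<in> L2 U"
  shows "L2_inner U u g = L2_inner U f w"
proof -
  have "L2_inner U u g = cnj (pairing g f \<phi>)"
    using assms by (simp add: represents_def pairing_cnj)
  also have "\<dots> = cnj (L2_inner U w f)" using assms by (simp add: represents_def)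
  finally show ?thesis by (simp add: L2_inner_cnj)
qed

end

text \<open>
  \<open>R A \<subseteq> A' R\<close> implies \<open>R exp(-t A) = exp(-t A') R\<close>. For \<open>f\<close> and \<open>g\<close> in spectral subspaces of bounded
  intervals, \<open>\<langle>R A ^ k f, g\<rangle> = \<langle>R f, A' ^ k g\<rangle>\<close>: one power at a time is moved through \<open>R\<close> and then to \<open>g\<close> by
  symmetry of \<open>A'\<close>. Working with \<open>g\<close> as well avoids the question whether \<open>R f\<close> lies in a spectral subspace of
  \<open>A'\<close>. The adjoint \<open>S\<close> of \<open>R\<close> replaces continuity of \<open>R\<close> in the passage to the limit.
\<close>

theorem semigroup_intertwining:
  fixes R :: "('a::euclidean_space \<Rightarrow> complex) \<Rightarrow> 'b::euclidean_space \<Rightarrow> complex"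
  assumes E: "is_spectral_resolution U A E" and E': "is_spectral_resolution V A' E'"
    and RL2: "\<And>f. f \<in> L2 U \<Longrightarrow> R f \<in> L2 V" and SL2: "\<And>g. g \<in> L2 V \<Longrightarrow> S g \<in> L2 U"
    and adjoint: "\<And>f g. f \<in> L2 U \<Longrightarrow> g \<in> L2 V \<Longrightarrow> L2_inner V (R f) g = L2_inner U f (S g)"
    and intertwines: "\<And>h u. (h, u) \<in> A \<Longrightarrow> (R h, R u) \<in> A'"
    and symmetric: "\<And>h u h' u'. (h, u) \<in> A' \<Longrightarrow> (h', u') \<in> A' \<Longrightarrow> L2_inner V u h' = L2_inner V h u'"
    and total: "\<And>f. f \<in> L2 U \<Longrightarrow> \<exists>u. (f, u) \<in> spectral_integral U E (\<lambda>s. exp (- t * s))"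
    and total': "\<And>f. f \<in> L2 V \<Longrightarrow> \<exists>u. (f, u) \<in> spectral_integral V E' (\<lambda>s. exp (- t * s))"
    and f: "f \<in> L2 U" and u: "(f, u) \<in> spectral_integral U E (\<lambda>s. exp (- t * s))"
    and w: "(R f, w) \<in> spectral_integral V E' (\<lambda>s. exp (- t * s))"
  shows "ae_eq V (R u) w"
proof -
  interpret U: pvm U E using E by unfold_locales (simp add: is_spectral_resolution_def)
  interpret V: pvm V E' using E' by unfold_locales (simp add: is_spectral_resolution_def)
  have A: "A = spectral_integral U E (\<lambda>s. s)" and A': "A' = spectral_integral V E' (\<lambda>s. s)"
    using E E' by (auto simp: is_spectral_resolution_def)
  let ?e = "\<lambda>s. exp (- t * s)"
  have e: "?e \<in> borel_measurable borel" by measurable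
  have eU: "U.integrable_all ?e" by (rule U.integrable_all_of_total[OF e total])
  have eV: "V.integrable_all ?e" by (rule V.integrable_all_of_total[OF e total'])
  have uT: "U.represents ?e f u" by (rule U.spectral_integral_represents[OF total u])
  have wT: "V.represents ?e (R f) w" by (rule V.spectral_integral_represents[OF total' w])
  have uL2: "u \<in> L2 U" and wL2: "w \<in> L2 V"
    using uT wT by (auto simp: U.represents_def V.represents_def)

  \<comment> \<open>On truncated vectors both exponentials are given by their power series.\<close>
  have truncated: "U.pairing (F 0) (S (G 0)) ?e = V.pairing (R (F 0)) (G 0) ?e"
    if f: "f \<in> L2 U" and g: "g \<in> L2 V"
      and F: "\<And>k. U.represents (U.truncated_power n k) f (F k)" "\<And>k. (F k, F (Suc k)) \<in> A"
      and G: "\<And>k. V.represents (V.truncated_power m k) g (G k)" "\<And>k. (G k, G (Suc k)) \<in> A'"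
    for f g F G n m
  proof -
    have FL2: "F k \<in> L2 U" and GL2: "G k \<in> L2 V" for k
      using F(1) G(1) by (auto simp: U.represents_def V.represents_def)
    have move: "L2_inner V (R (F k)) (G j) = L2_inner V (R (F 0)) (G (k + j))" for k j
    proof (induction k arbitrary: j)
      case (Suc k)
      have "L2_inner V (R (F (Suc k))) (G j) = L2_inner V (R (F k)) (G (Suc j))"
        by (rule symmetric[OF intertwines[OF F(2)] G(2)])
      then show ?case using Suc[of "Suc j"] by simp
    qed simp
    have "(\<lambda>k. complex_of_real ((- t) ^ k / fact k) * L2_inner U (F k) (S (G 0)))
        sums U.pairing (F 0) (S (G 0)) ?e"
      by (rule U.pairing_exp_sums[OF f SL2[OF GL2] F(1) eU])
    moreover have "L2_inner U (F k) (S (G 0)) = cnj (L2_inner V (G k) (R (F 0)))" for k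
      using adjoint[OF FL2[of k] GL2[of 0]] move[of k 0] by (simp add: L2_inner_cnj)
    ultimately have "(\<lambda>k. cnj (complex_of_real ((- t) ^ k / fact k) * L2_inner V (G k) (R (F 0))))
        sums U.pairing (F 0) (S (G 0)) ?e"
      by simp
    moreover have "(\<lambda>k. cnj (complex_of_real ((- t) ^ k / fact k) * L2_inner V (G k) (R (F 0))))
        sums cnj (V.pairing (G 0) (R (F 0)) ?e)"
      unfolding sums_cnj by (rule V.pairing_exp_sums[OF g RL2[OF FL2] G(1) eV])
    ultimately show ?thesis
      using V.pairing_cnj[OF eV GL2[of 0] RL2[OF FL2[of 0]]] by (simp add: sums_unique2)
  qed

  \<comment> \<open>Remove the truncation, first of \<open>f\<close> and then of \<open>g\<close>.\<close>
  have weak: "L2_inner V (R u) (G 0) = L2_inner V w (G 0)"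
    if g: "g \<in> L2 V" and G: "\<And>k. V.represents (V.truncated_power m k) g (G k)" "\<And>k. (G k, G (Suc k)) \<in> A'"
    for g G m
  proof -
    have GL2: "G 0 \<in> L2 V" using G(1) by (auto simp: V.represents_def)
    obtain F where F: "\<And>n k. U.represents (U.truncated_power n k) f (F n k)"
        "\<And>n k. (F n k, F n (Suc k)) \<in> A"
      unfolding A by (rule U.truncated_iterates[OF f]) blast
    have FL2: "F n k \<in> L2 U" for n k using F(1) by (auto simp: U.represents_def)
    obtain a where a: "(S (G 0), a) \<in> spectral_integral U E ?e" using total SL2 GL2 by blast
    obtain b where b: "(G 0, b) \<in> spectral_integral V E' ?e" using total' GL2 by blast
    have aT: "U.represents ?e (S (G 0)) a" by (rule U.spectral_integral_represents[OF total a])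
    have bT: "V.represents ?e (G 0) b" by (rule V.spectral_integral_represents[OF total' b])
    have aL2: "a \<in> L2 U" and bL2: "b \<in> L2 V"
      using aT bT by (auto simp: U.represents_def V.represents_def)
    have "L2_inner U (F n 0) a = L2_inner U (F n 0) (S b)" for n
    proof -
      have "L2_inner U (F n 0) a = cnj (U.pairing (S (G 0)) (F n 0) ?e)"
        using aT FL2 by (simp add: U.represents_def L2_inner_cnj[symmetric, of U "F n 0"])
      also have "\<dots> = U.pairing (F n 0) (S (G 0)) ?e"
        by (rule U.pairing_cnj[OF eU SL2[OF GL2] FL2])
      also have "\<dots> = V.pairing (R (F n 0)) (G 0) ?e"
        by (rule truncated[OF f g F(1) F(2) G])
      also have "\<dots> = cnj (V.pairing (G 0) (R (F n 0)) ?e)"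
        by (rule V.pairing_cnj[OF eV GL2 RL2[OF FL2], symmetric])
      also have "\<dots> = cnj (L2_inner V b (R (F n 0)))"
        using bT RL2[OF FL2] by (simp add: V.represents_def)
      also have "\<dots> = L2_inner U (F n 0) (S b)"
        using adjoint[OF FL2 bL2] by (simp add: L2_inner_cnj)
      finally show ?thesis .
    qed
    moreover have "(\<lambda>n. L2_inner U (F n 0) a) \<longlonglongrightarrow> L2_inner U f a"
      "(\<lambda>n. L2_inner U (F n 0) (S b)) \<longlonglongrightarrow> L2_inner U f (S b)"
      using F(1) aL2 SL2[OF bL2] by (auto intro!: U.truncation_tendsto f)
    ultimately have "L2_inner U f a = L2_inner U f (S b)"
      using LIMSEQ_unique by fastforce
    have "L2_inner V (R u) (G 0) = L2_inner U u (S (G 0))"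
      by (rule adjoint[OF uL2 GL2])
    also have "\<dots> = L2_inner U f a"
      by (rule U.represents_symmetric[OF eU uT aT f SL2[OF GL2]])
    also have "\<dots> = L2_inner V (R f) b" 
      using \<open>L2_inner U f a = L2_inner U f (S b)\<close> adjoint[OF f bL2] by simp
    also have "\<dots> = L2_inner V w (G 0)"
      by (rule V.represents_symmetric[OF eV wT bT RL2[OF f] GL2, symmetric])
    finally show ?thesis .
  qed
  show ?thesis
  proof (rule L2_nondegenerate[OF RL2[OF uL2] wL2])
    fix g assume g: "g \<in> L2 V"
    obtain G where G: "\<And>n k. V.represents (V.truncated_power n k) g (G n k)"
        "\<And>n k. (G n k, G n (Suc k)) \<in> A'"
      unfolding A' by (rule V.truncated_iterates[OF g]) blast
    have lim: "(\<lambda>n. L2_inner V z (G n 0)) \<longlonglongrightarrow> L2_inner V z g" if z: "z \<in> L2 V" for z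
      using tendsto_cnj[OF V.truncation_tendsto[OF g z G(1)]] by (simp add: L2_inner_cnj)
    have "L2_inner V (R u) (G n 0) = L2_inner V w (G n 0)" for n by (rule weak[OF g G])
    then show "L2_inner V (R u) g = L2_inner V w g"
      using LIMSEQ_unique[OF lim[OF RL2[OF uL2]]] lim[OF wL2] by simp
  qed
qed

section \<open>Smooth functions\<close>

lemma Ck_on_Suc_imp: "Ck_on (Suc k) UNIV f \<Longrightarrow> Ck_on k UNIV f"
proof (induction k arbitrary: f)
  case 0
  then show ?case by (auto intro!: continuous_at_imp_continuous_on differentiable_imp_continuous_within)
next
  case (Suc k)
  then show ?case by (metis Ck_on.simps(2))
qed

lemma Ck_on_const: "Ck_on k UNIV (\<lambda>x. c)"
  by (induction k arbitrary: c) auto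

lemma frechet_derivative_eq: "(f has_derivative D) (at x) \<Longrightarrow> frechet_derivative f (at x) h = D h"
  by (metis frechet_derivative_at)

lemma has_frechet_derivative: "f differentiable (at x) \<Longrightarrow> (f has_derivative frechet_derivative f (at x)) (at x)"
  by (simp add: frechet_derivative_works)

lemma Ck_on_add:
  "Ck_on k UNIV f \<Longrightarrow> Ck_on k UNIV g \<Longrightarrow> Ck_on k UNIV (\<lambda>x. f x + g x)"
proof (induction k arbitrary: f g)
  case 0
  then show ?case by (auto intro: continuous_intros)
next
  case (Suc k)
  have D: "((\<lambda>x. f x + g x) has_derivative (\<lambda>h. frechet_derivative f (at x) h + frechet_derivative g (at x) h)) (at x)" for x
    using Suc.prems by (intro has_derivative_add has_frechet_derivative) auto
  show ?case using Suc by (auto simp: frechet_derivative_eq[OF D] intro: differentiableI[OF D])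
qed

lemma Ck_on_mult:
  fixes f g :: "'a::real_normed_vector \<Rightarrow> 'b::real_normed_algebra"
  shows "Ck_on k UNIV f \<Longrightarrow> Ck_on k UNIV g \<Longrightarrow> Ck_on k UNIV (\<lambda>x. f x * g x)"
proof (induction k arbitrary: f g)
  case 0
  then show ?case by (auto intro: continuous_intros)
next
  case (Suc k)
  have D: "((\<lambda>x. f x * g x) has_derivative (\<lambda>h. f x * frechet_derivative g (at x) h + frechet_derivative f (at x) h * g x)) (at x)" for x
    using Suc.prems by (intro has_derivative_mult has_frechet_derivative) auto
  have "Ck_on k UNIV (\<lambda>x. frechet_derivative (\<lambda>x. f x * g x) (at x) h)" for h
    unfolding frechet_derivative_eq[OF D]
    using Suc.prems by (intro Ck_on_add Suc.IH) (auto intro: Ck_on_Suc_imp)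
  then show ?case using differentiableI[OF D] by simp
qed

lemma Ck_on_affine:
  fixes f :: "'a::real_normed_vector \<Rightarrow> 'b::real_normed_vector"
  assumes L: "bounded_linear L"
  shows "Ck_on k UNIV f \<Longrightarrow> Ck_on k UNIV (\<lambda>x. f (L x + c))"
proof (induction k arbitrary: f)
  case 0
  then show ?case
    using L by (auto intro!: continuous_on_compose2[of UNIV f] continuous_intros
        bounded_linear.continuous_on[OF L])
next
  case (Suc k)
  have A: "((\<lambda>x. L x + c) has_derivative L) (at x)" for x
    using has_derivative_add_const bounded_linear_imp_has_derivative[OF L] by blast
  have D: "((\<lambda>x. f (L x + c)) has_derivative (\<lambda>h. frechet_derivative f (at (L x + c)) (L h))) (at x)" for x
    using Suc.prems by (intro has_derivative_compose[OF A has_frechet_derivative]) auto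
  have "Ck_on k UNIV (\<lambda>x. frechet_derivative (\<lambda>x. f (L x + c)) (at x) h)" for h
    unfolding frechet_derivative_eq[OF D]
    using Suc.prems by (intro Suc.IH) auto
  then show ?case using differentiableI[OF D] by simp
qed

lemma Ck_on_bounded_linear:
  assumes L: "bounded_linear L"
  shows "Ck_on k UNIV f \<Longrightarrow> Ck_on k UNIV (\<lambda>x. L (f x))"
proof (induction k arbitrary: f)
  case 0
  then show ?case by (auto intro: bounded_linear.continuous_on[OF L])
next
  case (Suc k)
  have D: "((\<lambda>x. L (f x)) has_derivative (\<lambda>h. L (frechet_derivative f (at x) h))) (at x)" for x
    using Suc.prems by (intro bounded_linear.has_derivative[OF L] has_frechet_derivative) auto
  show ?case using Suc by (auto simp: frechet_derivative_eq[OF D] intro: differentiableI[OF D])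
qed

lemma smooth_differentiable: "smooth_on UNIV f \<Longrightarrow> f differentiable (at x)"
  unfolding smooth_on_def by (metis Ck_on.simps(2) UNIV_I)

lemma smooth_has_derivative:
  "smooth_on UNIV f \<Longrightarrow> (f has_derivative frechet_derivative f (at x)) (at x)"
  by (intro has_frechet_derivative smooth_differentiable)

lemma smooth_continuous: "smooth_on UNIV f \<Longrightarrow> continuous_on S f"
  unfolding smooth_on_def by (metis Ck_on.simps(1) continuous_on_subset subset_UNIV)

lemma smooth_derivative: "smooth_on UNIV f \<Longrightarrow> smooth_on UNIV (\<lambda>x. frechet_derivative f (at x) w)"
  unfolding smooth_on_def by (metis Ck_on.simps(2))

lemma smooth_const: "smooth_on UNIV (\<lambda>x. c)"
  by (simp add: smooth_on_def Ck_on_const)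

lemma smooth_add: "smooth_on UNIV f \<Longrightarrow> smooth_on UNIV g \<Longrightarrow> smooth_on UNIV (\<lambda>x. f x + g x)"
  by (simp add: smooth_on_def Ck_on_add)

lemma smooth_mult:
  fixes f g :: "'a::real_normed_vector \<Rightarrow> 'b::real_normed_algebra"
  shows "smooth_on UNIV f \<Longrightarrow> smooth_on UNIV g \<Longrightarrow> smooth_on UNIV (\<lambda>x. f x * g x)"
  by (simp add: smooth_on_def Ck_on_mult)

lemma smooth_affine:
  fixes f :: "'a::real_normed_vector \<Rightarrow> 'b::real_normed_vector"
  shows "bounded_linear L \<Longrightarrow> smooth_on UNIV f \<Longrightarrow> smooth_on UNIV (\<lambda>x. f (L x + c))"
  by (simp add: smooth_on_def Ck_on_affine)

lemma smooth_bounded_linear: "bounded_linear L \<Longrightarrow> smooth_on UNIV f \<Longrightarrow> smooth_on UNIV (\<lambda>x. L (f x))"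
  by (simp add: smooth_on_def Ck_on_bounded_linear)

lemma smooth_prod:
  fixes f :: "'i \<Rightarrow> 'a::real_normed_vector \<Rightarrow> 'b::{real_normed_algebra,comm_ring_1}"
  shows "(\<And>i. i \<in> I \<Longrightarrow> smooth_on UNIV (f i)) \<Longrightarrow> smooth_on UNIV (\<lambda>x. \<Prod>i\<in>I. f i x)"
  by (induction I rule: infinite_finite_induct) (auto intro: smooth_const smooth_mult)

lemma smooth_derivative_add:
  assumes "smooth_on UNIV f" "smooth_on UNIV g"
  shows "frechet_derivative (\<lambda>x. f x + g x) (at x) w = frechet_derivative f (at x) w + frechet_derivative g (at x) w"
  by (rule frechet_derivative_eq[OF has_derivative_add[OF assms[THEN smooth_has_derivative]]])

lemma smooth_derivative_mult:
  fixes f g :: "'a::real_normed_vector \<Rightarrow> 'b::real_normed_algebra"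
  assumes "smooth_on UNIV f" "smooth_on UNIV g"
  shows "frechet_derivative (\<lambda>x. f x * g x) (at x) w
       = f x * frechet_derivative g (at x) w + frechet_derivative f (at x) w * g x"
  by (rule frechet_derivative_eq[OF has_derivative_mult[OF assms[THEN smooth_has_derivative]]])

lemma smooth_derivative_scale:
  fixes f :: "'a::real_normed_vector \<Rightarrow> 'b::real_normed_algebra"
  assumes "smooth_on UNIV f"
  shows "frechet_derivative (\<lambda>x. c * f x) (at x) w = c * frechet_derivative f (at x) w"
  by (rule frechet_derivative_eq[OF has_derivative_mult_right[OF smooth_has_derivative[OF assms]]])

lemma smooth_derivative_linear:
  assumes "smooth_on UNIV f"
  shows "linear (frechet_derivative f (at x))"
  using smooth_has_derivative[OF assms] by (rule has_derivative_linear)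

lemma derivative_along_line:
  assumes "smooth_on UNIV \<phi>"
  shows "((\<lambda>t. \<phi> (x + t *\<^sub>R w)) has_derivative (\<lambda>h. h *\<^sub>R frechet_derivative \<phi> (at (x + t *\<^sub>R w)) w)) (at t)"
proof -
  have "((\<lambda>t. x + t *\<^sub>R w) has_derivative (\<lambda>h. h *\<^sub>R w)) (at t)"
    by (auto intro!: derivative_eq_intros)
  from has_derivative_compose[OF this smooth_has_derivative[OF assms]]
  show ?thesis by (simp add: linear_scale[OF smooth_derivative_linear[OF assms]])
qed

text \<open>
  The functions \<open>x ^ (-m) * exp (-1/x)\<close>, continued by zero to \<open>x \<le> 0\<close>. The derivative of each is a
  combination of two others, so all of them are smooth; the case \<open>m = 0\<close> is the usual transition
  function.
\<close>

definition flat_exp :: "nat \<Rightarrow> real \<Rightarrow> real" where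
  "flat_exp m x = (if x \<le> 0 then 0 else (1/x) ^ m * exp (- (1/x)))"

lemma flat_exp_nonneg: "0 \<le> flat_exp m x"
  by (simp add: flat_exp_def)

lemma flat_exp_le: "flat_exp m x \<le> fact m"
proof (cases "x \<le> 0")
  case False
  define z where "z = 1 / x"
  have z: "0 \<le> z" using False by (simp add: z_def)
  have "z ^ m / fact m = (\<Sum>k\<in>{m}. z ^ k /\<^sub>R fact k)" by (simp add: divide_inverse)
  also have "\<dots> \<le> exp z"
    unfolding exp_def using z by (intro sum_le_suminf summable_exp_generic) auto
  finally have "z ^ m \<le> fact m * exp z" by (simp add: field_simps)
  then have "z ^ m * exp (- z) \<le> fact m" by (simp add: exp_minus field_simps)
  then show ?thesis using False by (simp add: flat_exp_def z_def)
qed (simp add: flat_exp_def)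

lemma flat_exp_Suc: "flat_exp (Suc m) x = flat_exp m x / x"
  by (simp add: flat_exp_def)

lemma flat_exp_has_derivative:
  "(flat_exp m has_real_derivative (flat_exp (m + 2) x - real m * flat_exp (m + 1) x)) (at x)"
proof -
  consider "x < 0" | "x = 0" | "x > 0" by linarith
  then show ?thesis
  proof cases
    case 1
    have "((\<lambda>x. 0) has_real_derivative 0) (at x)" by simp
    then have "(flat_exp m has_real_derivative 0) (at x)"
      by (rule has_field_derivative_transform_within_open[of _ _ _ "{..<0}"])
         (use 1 in \<open>auto simp: flat_exp_def\<close>)
    then show ?thesis using 1 by (simp add: flat_exp_def)
  next
    case 2
    have "((\<lambda>h. flat_exp (Suc m) h) \<longlongrightarrow> 0) (at 0)"
      unfolding filterlim_at_split
    proof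
      show "((\<lambda>h. flat_exp (Suc m) h) \<longlongrightarrow> 0) (at_left 0)"
        by (rule tendsto_eventually) (auto simp: eventually_at_filter flat_exp_def)
      have "((\<lambda>h. (inverse h) ^ Suc m / exp (inverse h)) \<longlongrightarrow> 0) (at_right (0::real))"
        by (rule filterlim_compose[OF tendsto_power_div_exp_0 filterlim_inverse_at_top_right])
      then show "((\<lambda>h. flat_exp (Suc m) h) \<longlongrightarrow> 0) (at_right 0)"
        by (rule Lim_transform_eventually)
           (auto simp: eventually_at_filter flat_exp_def exp_minus divide_inverse)
    qed
    then have "(flat_exp m has_real_derivative 0) (at 0)"
      by (simp add: has_field_derivative_iff flat_exp_Suc) (simp add: flat_exp_def)
    then show ?thesis using 2 by (simp add: flat_exp_def)
  next
    case 3
    have "((\<lambda>x. (1/x) ^ m * exp (- (1/x))) has_real_derivative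
        ((1/x) ^ (m + 2) * exp (- (1/x)) - real m * ((1/x) ^ (m + 1) * exp (- (1/x))))) (at x)"
    proof -
      have inv: "((\<lambda>x. 1/x) has_real_derivative - ((1/x)\<^sup>2)) (at x)"
        using 3 by (auto intro!: derivative_eq_intros simp: power2_eq_square)
      have pow: "((\<lambda>x. (1/x) ^ m) has_real_derivative - (real m * (1/x) ^ (m + 1))) (at x)"
      proof (cases m)
        case (Suc j)
        have "real m * (- ((1/x)\<^sup>2) * (1/x) ^ (m - Suc 0)) = - (real m * (1/x) ^ (m + 1))"
          by (simp add: Suc power2_eq_square)
        with DERIV_power[OF inv, of m] show ?thesis by (simp only:)
      qed simp
      have ex: "((\<lambda>x. exp (- (1/x))) has_real_derivative exp (- (1/x)) * (1/x)\<^sup>2) (at x)"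
        using DERIV_fun_exp[OF DERIV_minus[OF inv]] by simp
      have "- (real m * z ^ (m + 1)) * e + e * z\<^sup>2 * z ^ m = z ^ (m + 2) * e - real m * (z ^ (m + 1) * e)"
        for z e :: real
        by (simp add: power2_eq_square algebra_simps)
      then show ?thesis by (rule DERIV_cong[OF DERIV_mult[OF pow ex]])
    qed
    then have "(flat_exp m has_real_derivative
        ((1/x) ^ (m + 2) * exp (- (1/x)) - real m * ((1/x) ^ (m + 1) * exp (- (1/x))))) (at x)"
      by (rule has_field_derivative_transform_within_open[of _ _ _ "{0<..}"])
         (use 3 in \<open>auto simp: flat_exp_def\<close>)
    then show ?thesis using 3 by (simp add: flat_exp_def)
  qed
qed

lemma frechet_derivative_flat_exp:
  "frechet_derivative (flat_exp m) (at x) h = h * flat_exp (m + 2) x + h * (- real m) * flat_exp (m + 1) x"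
  using frechet_derivative_eq[OF has_field_derivative_imp_has_derivative[OF flat_exp_has_derivative]]
  by (simp add: algebra_simps)

lemma smooth_flat_exp: "smooth_on UNIV (flat_exp m)"
proof -
  have "Ck_on k UNIV (flat_exp m)" for k
  proof (induction k arbitrary: m)
    case 0
    then show ?case
      using DERIV_isCont[OF flat_exp_has_derivative] by (auto intro!: continuous_at_imp_continuous_on)
  next
    case (Suc k)
    have "Ck_on k UNIV (\<lambda>x. frechet_derivative (flat_exp m) (at x) h)" for h
      unfolding frechet_derivative_flat_exp by (intro Ck_on_add Ck_on_mult Ck_on_const Suc)
    then show ?case
      using has_field_derivative_imp_has_derivative[OF flat_exp_has_derivative]
      by (auto intro: differentiableI)
  qed
  then show ?thesis by (simp add: smooth_on_def)
qed

lemma flat_exp_0_tendsto: "(flat_exp 0 \<longlongrightarrow> 1) at_top"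
proof -
  have "((\<lambda>x::real. exp (- inverse x)) \<longlongrightarrow> exp (- 0)) at_top"
    by (rule tendsto_exp[OF tendsto_minus[OF tendsto_inverse_0_at_top[OF filterlim_ident]]])
  then have "((\<lambda>x::real. exp (- inverse x)) \<longlongrightarrow> 1) at_top" by simp
  then show ?thesis
    by (rule Lim_transform_eventually)
       (use eventually_gt_at_top[of 0] in eventually_elim, simp add: flat_exp_def divide_inverse)
qed

lemma flat_exp_Suc_tendsto: "(flat_exp (Suc m) \<longlongrightarrow> 0) at_top"
proof (rule Lim_null_comparison)
  show "((\<lambda>x. fact m * inverse x) \<longlongrightarrow> (0::real)) at_top"
    by (intro tendsto_mult_right_zero tendsto_inverse_0_at_top filterlim_ident)
  show "\<forall>\<^sub>F x in at_top. norm (flat_exp (Suc m) x) \<le> fact m * inverse x"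
    using eventually_gt_at_top[of 0]
    by eventually_elim
       (use flat_exp_le[of m] flat_exp_nonneg[of m] in \<open>simp add: flat_exp_Suc divide_inverse mult_right_mono\<close>)
qed

section \<open>Test functions\<close>

lemma test_functionsI:
  assumes "smooth_on UNIV \<phi>" "compact K" "K \<subseteq> U" "\<And>x. x \<notin> K \<Longrightarrow> \<phi> x = 0"
  shows "\<phi> \<in> test_functions U"
proof -
  have "closure {x. \<phi> x \<noteq> 0} \<subseteq> K"
    using assms(2,4) by (intro closure_minimal compact_imp_closed) auto
  moreover from this have "compact (closure {x. \<phi> x \<noteq> 0})"
    using compact_Int_closed[OF assms(2) closed_closure] by (metis Int_absorb1)
  ultimately show ?thesis using assms by (auto simp: test_functions_def)
qed

lemma test_functions_smooth: "\<phi> \<in> test_functions U \<Longrightarrow> smooth_on UNIV \<phi>"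
  by (simp add: test_functions_def)

lemma test_functionsE:
  assumes "\<phi> \<in> test_functions U"
  obtains K where "compact K" "K \<subseteq> U" "\<And>x. x \<notin> K \<Longrightarrow> \<phi> x = 0"
    "\<And>x w. x \<notin> K \<Longrightarrow> frechet_derivative \<phi> (at x) w = 0"
proof
  let ?K = "closure {x. \<phi> x \<noteq> 0}"
  show "compact ?K" "?K \<subseteq> U" using assms by (auto simp: test_functions_def)
  show z: "\<phi> x = 0" if "x \<notin> ?K" for x
    using that closure_subset[of "{x. \<phi> x \<noteq> 0}"] by auto
  show "frechet_derivative \<phi> (at x) w = 0" if "x \<notin> ?K" for x w
  proof (rule frechet_derivative_eq)
    have "((\<lambda>x. 0) has_derivative (\<lambda>w. 0)) (at x)" by simp
    then show "(\<phi> has_derivative (\<lambda>w. 0)) (at x)"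
      by (rule has_derivative_transform_within_open[OF _ open_Compl[OF closed_closure[of "{x. \<phi> x \<noteq> 0}"]]])
         (simp_all only: Compl_iff that z not_False_eq_True)
  qed
qed

lemma test_functions_mono: "U \<subseteq> V \<Longrightarrow> \<phi> \<in> test_functions U \<Longrightarrow> \<phi> \<in> test_functions V"
  by (auto simp: test_functions_def)

lemma test_functions_add:
  assumes "\<phi> \<in> test_functions U" "\<psi> \<in> test_functions U"
  shows "(\<lambda>x. \<phi> x + \<psi> x) \<in> test_functions U"
proof -
  obtain K where K: "compact K" "K \<subseteq> U" "\<And>x. x \<notin> K \<Longrightarrow> \<phi> x = 0"
    by (rule test_functionsE[OF assms(1)]) blast
  obtain L where L: "compact L" "L \<subseteq> U" "\<And>x. x \<notin> L \<Longrightarrow> \<psi> x = 0"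
    by (rule test_functionsE[OF assms(2)]) blast
  show ?thesis
    by (rule test_functionsI[of _ "K \<union> L"])
       (simp_all add: K L smooth_add assms[THEN test_functions_smooth] compact_Un)
qed

lemma test_functions_mult:
  assumes \<phi>: "\<phi> \<in> test_functions U" and "smooth_on UNIV \<eta>"
  shows "(\<lambda>x. \<eta> x * \<phi> x) \<in> test_functions U"
proof -
  obtain K where "compact K" "K \<subseteq> U" "\<And>x. x \<notin> K \<Longrightarrow> \<phi> x = 0"
    by (rule test_functionsE[OF \<phi>]) blast
  then show ?thesis
    by (intro test_functionsI[of _ K] smooth_mult assms(2) test_functions_smooth[OF \<phi>]) simp_all
qed

lemma test_functions_scale: "\<phi> \<in> test_functions U \<Longrightarrow> (\<lambda>x. c * \<phi> x) \<in> test_functions U"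
  by (rule test_functions_mult[OF _ smooth_const])

lemma test_functions_derivative:
  assumes \<phi>: "\<phi> \<in> test_functions U"
  shows "(\<lambda>x. frechet_derivative \<phi> (at x) w) \<in> test_functions U"
proof -
  obtain K where "compact K" "K \<subseteq> U" "\<And>x. x \<notin> K \<Longrightarrow> frechet_derivative \<phi> (at x) w = 0"
    by (rule test_functionsE[OF \<phi>]) blast
  then show ?thesis
    by (intro test_functionsI[of _ K] smooth_derivative test_functions_smooth[OF \<phi>]) simp_all
qed

lemma test_functions_bounded:
  assumes \<phi>: "\<phi> \<in> test_functions U"
  obtains C where "C \<ge> 0" "\<And>x. norm (\<phi> x) \<le> C"
proof -
  obtain K where K: "compact K" "\<And>x. x \<notin> K \<Longrightarrow> \<phi> x = 0"
    by (rule test_functionsE[OF \<phi>]) blast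
  have "compact (\<phi> ` K)"
    by (rule compact_continuous_image[OF smooth_continuous[OF test_functions_smooth[OF \<phi>]] K(1)])
  then have "bounded (\<phi> ` K)" by (rule compact_imp_bounded)
  then obtain C where C: "\<And>y. y \<in> \<phi> ` K \<Longrightarrow> norm y \<le> C"
    unfolding bounded_iff by blast
  have "norm (\<phi> x) \<le> max C 0" for x
    using C[of "\<phi> x"] K(2)[of x] by (cases "x \<in> K") auto
  then show ?thesis using that[of "max C 0"] by auto
qed

text \<open>
  The mean value inequality along a line; the bound is uniform since the derivative has compact support.
\<close>

lemma test_function_increment:
  fixes \<phi> :: "'a::euclidean_space \<Rightarrow> complex"
  assumes \<phi>: "\<phi> \<in> test_functions U"
  obtains C where "C \<ge> 0" "\<And>x t. norm (\<phi> (x + t *\<^sub>R w) - \<phi> x) \<le> C * \<bar>t\<bar>"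
proof -
  note sm = test_functions_smooth[OF \<phi>]
  obtain C where C: "C \<ge> 0" "\<And>x. norm (frechet_derivative \<phi> (at x) w) \<le> C"
    by (rule test_functions_bounded[OF test_functions_derivative[OF \<phi>, of w]]) blast
  have "norm (\<phi> (x + t *\<^sub>R w) - \<phi> x) \<le> C * \<bar>t\<bar>" for x t
  proof -
    have "norm (\<phi> (x + t *\<^sub>R w) - \<phi> (x + 0 *\<^sub>R w)) \<le> C * norm (t - 0)"
    proof (rule differentiable_bound[of UNIV "\<lambda>t. \<phi> (x + t *\<^sub>R w)"])
      show "onorm (\<lambda>h. h *\<^sub>R frechet_derivative \<phi> (at (x + s *\<^sub>R w)) w) \<le> C" for s
        using C(2)[of "x + s *\<^sub>R w"] C(1)
        by (intro onorm_le) (simp add: mult.commute[of C] mult_left_mono)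
    qed (use derivative_along_line[OF sm] in auto)
    then show ?thesis by simp
  qed
  with C(1) show ?thesis by (rule that)
qed

lemma continuous_measurable_on:
  fixes f :: "'a::euclidean_space \<Rightarrow> 'b::euclidean_space"
  assumes "continuous_on UNIV f"
  shows "f \<in> borel_measurable (lebesgue_on S)"
  by (rule measurable_restrict_space1[OF measurable_completion])
     (use borel_measurable_continuous_onI[OF assms] in simp)

lemma test_functions_measurable:
  fixes \<phi> :: "'a::euclidean_space \<Rightarrow> complex"
  shows "\<phi> \<in> test_functions U \<Longrightarrow> \<phi> \<in> borel_measurable (lebesgue_on S)"
  by (intro continuous_measurable_on smooth_continuous test_functions_smooth)

lemma compact_indicator_integrable:
  fixes K :: "'a::euclidean_space set"
  assumes "compact K" "S \<in> sets lebesgue"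
  shows "integrable (lebesgue_on S) (\<lambda>x. indicator K x :: real)"
proof -
  have "K \<inter> S \<in> lmeasurable"
    using assms by (intro fmeasurable_Int_fmeasurable lmeasurable_compact) auto
  then have "integrable lebesgue (\<lambda>x. indicator (K \<inter> S) x :: real)"
    by (simp only: lmeasurable_iff_integrable)
  moreover have "indicator (K \<inter> S) x = indicator S x *\<^sub>R (indicator K x :: real)" for x
    by (auto simp: indicator_def)
  ultimately show ?thesis
    using assms by (subst integrable_restrict_space) auto
qed

lemma L2_of_bounded_support:
  fixes f :: "'a::euclidean_space \<Rightarrow> complex"
  assumes "f \<in> borel_measurable (lebesgue_on S)" "compact K" "S \<in> sets lebesgue"
    and "\<And>x. norm (f x) \<le> C * indicator K x"
  shows "f \<in> L2 S"
proof (rule L2_bounded_by[OF assms(1)])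
  show "integrable (lebesgue_on S) (\<lambda>x. C\<^sup>2 * indicator K x)"
    by (intro integrable_mult_right compact_indicator_integrable assms)
  show "(norm (f x))\<^sup>2 \<le> C\<^sup>2 * indicator K x" for x
    using power_mono[OF assms(4)[of x], of 2] by (cases "x \<in> K") simp_all
qed

lemma test_functions_L2:
  fixes \<phi> :: "'a::euclidean_space \<Rightarrow> complex"
  assumes \<phi>: "\<phi> \<in> test_functions U" and S: "S \<in> sets lebesgue"
  shows "\<phi> \<in> L2 S"
proof -
  obtain K where K: "compact K" "\<And>x. x \<notin> K \<Longrightarrow> \<phi> x = 0"
    by (rule test_functionsE[OF \<phi>]) blast
  obtain C where C: "C \<ge> 0" "\<And>x. norm (\<phi> x) \<le> C"
    by (rule test_functions_bounded[OF \<phi>]) blast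
  have "norm (\<phi> x) \<le> C * indicator K x" for x
    using K(2)[of x] C(2)[of x] by (cases "x \<in> K") simp_all
  then show ?thesis
    by (rule L2_of_bounded_support[OF test_functions_measurable[OF \<phi>] K(1) S])
qed

section \<open>Integration by parts and uniqueness of weak derivatives\<close>

lemma integral_lebesgue_on_support:
  fixes f :: "'a::euclidean_space \<Rightarrow> complex"
  assumes "S \<in> sets lebesgue" "T \<in> sets lebesgue" "\<And>x. x \<in> S - T \<Longrightarrow> f x = 0" "\<And>x. x \<in> T - S \<Longrightarrow> f x = 0"
  shows "(LINT x|lebesgue_on S. f x) = (LINT x|lebesgue_on T. f x)"
proof -
  have "indicator S x *\<^sub>R f x = indicator T x *\<^sub>R f x" for x
    using assms(3,4)[of x] by (auto simp: indicator_def)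
  then have "(\<lambda>x. indicator S x *\<^sub>R f x) = (\<lambda>x. indicator T x *\<^sub>R f x)" by (rule ext)
  moreover have "S \<inter> space lebesgue \<in> sets lebesgue" "T \<inter> space lebesgue \<in> sets lebesgue"
    using assms(1,2) by simp_all
  ultimately show ?thesis by (simp only: integral_restrict_space)
qed

text \<open>
  The difference quotients \<open>n (\<phi> (x + w / n) - \<phi> x)\<close> have integral zero by translation invariance.
\<close>

lemma integral_derivative_test_function:
  fixes \<phi> :: "'a::euclidean_space \<Rightarrow> complex"
  assumes \<phi>: "\<phi> \<in> test_functions UNIV"
  shows "(LINT x|lebesgue. frechet_derivative \<phi> (at x) w) = 0"
proof -
  note sm = test_functions_smooth[OF \<phi>]
  let ?D = "\<lambda>x. frechet_derivative \<phi> (at x) w"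
  obtain K where K: "compact K" "\<And>x. x \<notin> K \<Longrightarrow> \<phi> x = 0"
    by (rule test_functionsE[OF \<phi>]) blast
  obtain C where C: "C \<ge> 0" "\<And>x t. norm (\<phi> (x + t *\<^sub>R w) - \<phi> x) \<le> C * \<bar>t\<bar>"
    by (rule test_function_increment[OF \<phi>, of w]) blast
  obtain R where R: "\<And>x. x \<in> K \<Longrightarrow> norm x \<le> R"
    using compact_imp_bounded[OF K(1)] unfolding bounded_iff by blast
  define q where "q n x = of_real (real (Suc n)) * (\<phi> (x + (1 / real (Suc n)) *\<^sub>R w) - \<phi> x)" for n x
  have cont: "continuous_on UNIV \<phi>" by (rule smooth_continuous[OF sm])
  have meas: "\<phi> \<in> borel_measurable borel" by (rule borel_measurable_continuous_onI[OF cont])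
  have zero: "(LINT x|lborel. q n x) = 0" for n
  proof -
    let ?c = "(1 / real (Suc n)) *\<^sub>R w"
    have int: "integrable lborel \<phi>"
    proof -
      have "(\<lambda>x. indicator K x *\<^sub>R \<phi> x) = \<phi>"
      proof
        show "indicator K x *\<^sub>R \<phi> x = \<phi> x" for x using K(2)[of x] by (cases "x \<in> K") simp_all
      qed
      then show ?thesis
        using borel_integrable_compact[OF K(1) continuous_on_subset[OF cont subset_UNIV]] by simp
    qed
    have "(LINT x|lborel. \<phi> (?c + x)) = (LINT x|distr lborel borel ((+) ?c). \<phi> x)"
      using meas by (subst integral_distr) auto
    then have eq: "(LINT x|lborel. \<phi> (x + ?c)) = (LINT x|lborel. \<phi> x)"
      by (simp add: lborel_distr_plus add.commute)
    have "integrable (distr lborel borel ((+) ?c)) \<phi>" using int by (simp add: lborel_distr_plus)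
    then have int2: "integrable lborel (\<lambda>x. \<phi> (x + ?c))"
      using meas by (subst (asm) integrable_distr_eq) (auto simp: add.commute)
    show ?thesis unfolding q_def using int int2 eq by simp
  qed
  have lim: "(\<lambda>n. q n x) \<longlonglongrightarrow> ?D x" for x
  proof -
    let ?Q = "\<lambda>h. (\<phi> (x + h *\<^sub>R w) - \<phi> x) /\<^sub>R h"
    have "((\<lambda>h. norm (\<phi> (x + h *\<^sub>R w) - \<phi> x - h *\<^sub>R ?D x) / norm h) \<longlongrightarrow> 0) (at 0)"
      using derivative_along_line[OF sm, of x w 0] by (simp add: has_derivative_iff_norm)
    then have "((\<lambda>h. norm (?Q h - ?D x)) \<longlongrightarrow> 0) (at 0)"
    proof (rule Lim_transform_eventually)
      have "norm (\<phi> (x + h *\<^sub>R w) - \<phi> x - h *\<^sub>R ?D x) / norm h = norm (?Q h - ?D x)" if "h \<noteq> 0" for h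
      proof -
        have "\<phi> (x + h *\<^sub>R w) - \<phi> x - h *\<^sub>R ?D x = h *\<^sub>R (?Q h - ?D x)"
          using that by (simp add: scaleR_diff_right)
        then have "norm (\<phi> (x + h *\<^sub>R w) - \<phi> x - h *\<^sub>R ?D x) = norm h * norm (?Q h - ?D x)"
          by (simp only: norm_scaleR real_norm_def)
        then show ?thesis using that by simp
      qed
      then show "\<forall>\<^sub>F h in at 0. norm (\<phi> (x + h *\<^sub>R w) - \<phi> x - h *\<^sub>R ?D x) / norm h = norm (?Q h - ?D x)"
        by (simp add: eventually_at_filter)
    qed
    then have "(?Q \<longlongrightarrow> ?D x) (at 0)" by (simp only: tendsto_norm_zero_iff LIM_zero_iff)
    moreover have "filterlim (\<lambda>n. 1 / real (Suc n)) (at 0) sequentially"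
      using LIMSEQ_inverse_real_of_nat by (simp add: filterlim_at inverse_eq_divide)
    ultimately have "(\<lambda>n. (\<phi> (x + (1 / real (Suc n)) *\<^sub>R w) - \<phi> x) /\<^sub>R (1 / real (Suc n))) \<longlonglongrightarrow> ?D x"
      by (rule filterlim_compose)
    then show ?thesis by (simp add: q_def scaleR_conv_of_real)
  qed
  have "(\<lambda>n. LINT x|lborel. q n x) \<longlonglongrightarrow> (LINT x|lborel. ?D x)"
  proof (rule integral_dominated_convergence)
    show "?D \<in> borel_measurable lborel"
      using borel_measurable_continuous_onI[OF smooth_continuous[OF smooth_derivative[OF sm]]] by simp
    show "q n \<in> borel_measurable lborel" for n unfolding q_def using meas by measurable
    show "integrable lborel (\<lambda>x. C * indicator (cball 0 (R + norm w)) x :: real)"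
      by (intro integrable_mult_right integrable_real_indicator) (use emeasure_bounded_finite[OF bounded_cball, of 0 "R + norm w"] in auto)
    show "AE x in lborel. (\<lambda>n. q n x) \<longlonglongrightarrow> ?D x" using lim by simp
    show "AE x in lborel. norm (q n x) \<le> C * indicator (cball 0 (R + norm w)) x" for n
    proof (rule AE_I2)
      fix x
      show "norm (q n x) \<le> C * indicator (cball 0 (R + norm w)) x"
      proof (cases "x \<in> cball 0 (R + norm w)")
        case True
        have "norm (q n x) = real (Suc n) * norm (\<phi> (x + (1 / real (Suc n)) *\<^sub>R w) - \<phi> x)"
          by (simp only: q_def norm_mult norm_of_real abs_of_nat)
        also have "\<dots> \<le> real (Suc n) * (C * \<bar>1 / real (Suc n)\<bar>)"
          by (intro mult_left_mono C(2)) simp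
        finally show ?thesis using True by simp
      next
        case False
        then have far: "norm x > R + norm w" by simp
        have "norm ((1 / real (Suc n)) *\<^sub>R w) \<le> norm w"
          by (simp add: divide_le_eq mult_le_cancel_left1)
        then have "norm (x + (1 / real (Suc n)) *\<^sub>R w) > R"
          using far norm_diff_ineq[of x "(1 / real (Suc n)) *\<^sub>R w"] by linarith
        then have "x \<notin> K" "x + (1 / real (Suc n)) *\<^sub>R w \<notin> K"
          using R[of x] R[of "x + (1 / real (Suc n)) *\<^sub>R w"] far norm_ge_zero[of w] by linarith+
        then show ?thesis using K(2) False by (simp add: q_def)
      qed
    qed
  qed
  then have "(LINT x|lborel. ?D x) = 0" using zero by (simp add: LIMSEQ_const_iff)
  then show ?thesis
    using borel_measurable_continuous_onI[OF smooth_continuous[OF smooth_derivative[OF sm]]]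
    by (simp add: integral_completion)
qed

text \<open>
  The product of \<open>\<psi>\<close> with a test function on \<open>U\<close> is again a test function on \<open>U\<close>, and its derivative has
  integral zero.
\<close>

lemma smooth_weak_deriv:
  fixes \<psi> :: "'a::euclidean_space \<Rightarrow> complex"
  assumes \<psi>: "\<psi> \<in> test_functions V" and U: "U \<in> sets lebesgue"
  shows "is_weak_deriv U w \<psi> (\<lambda>x. frechet_derivative \<psi> (at x) w)"
  unfolding is_weak_deriv_def
proof
  fix \<phi> :: "'a \<Rightarrow> complex" assume \<phi>: "\<phi> \<in> test_functions U"
  let ?D = "\<lambda>f x. frechet_derivative f (at x) w"
  have p: "(\<lambda>x. \<psi> x * \<phi> x) \<in> test_functions U"
    by (rule test_functions_mult[OF \<phi> test_functions_smooth[OF \<psi>]])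
  have D: "?D (\<lambda>x. \<psi> x * \<phi> x) x = \<psi> x * ?D \<phi> x + ?D \<psi> x * \<phi> x" for x
    by (rule smooth_derivative_mult[OF test_functions_smooth[OF \<psi>] test_functions_smooth[OF \<phi>]])
  obtain K where K: "K \<subseteq> U" "\<And>x. x \<notin> K \<Longrightarrow> ?D (\<lambda>x. \<psi> x * \<phi> x) x = 0"
    by (rule test_functionsE[OF p]) blast
  have "(LINT x|lebesgue_on U. ?D (\<lambda>x. \<psi> x * \<phi> x) x) = (LINT x|lebesgue_on UNIV. ?D (\<lambda>x. \<psi> x * \<phi> x) x)"
    using K by (intro integral_lebesgue_on_support U) auto
  also have "\<dots> = 0"
    unfolding lebesgue_on_UNIV_eq by (rule integral_derivative_test_function[OF test_functions_mono[OF _ p]]) simp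
  finally have "(LINT x|lebesgue_on U. \<psi> x * ?D \<phi> x + ?D \<psi> x * \<phi> x) = 0" unfolding D .
  moreover have "integrable (lebesgue_on U) (\<lambda>x. \<psi> x * ?D \<phi> x)" "integrable (lebesgue_on U) (\<lambda>x. ?D \<psi> x * \<phi> x)"
    by (intro L2_integrable_mult test_functions_L2[OF _ U] test_functions_derivative \<phi> \<psi>;
        rule \<phi> \<psi> test_functions_derivative)+
  ultimately show "(LINT x|lebesgue_on U. \<psi> x * ?D \<phi> x) = - (LINT x|lebesgue_on U. ?D \<psi> x * \<phi> x)"
    by (simp add: eq_neg_iff_add_eq_0)
qed

text \<open>Smooth functions supported in a box and increasing to its indicator.\<close>

definition box_bump :: "'a::euclidean_space \<Rightarrow> 'a \<Rightarrow> nat \<Rightarrow> 'a \<Rightarrow> real" where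
  "box_bump a c n x = (\<Prod>b\<in>Basis. flat_exp 0 (real n * ((x - a) \<bullet> b) - 1) * flat_exp 0 (real n * ((c - x) \<bullet> b) - 1))"

lemma box_bump_smooth: "smooth_on UNIV (box_bump a c n)"
proof -
  have lin: "bounded_linear (\<lambda>x::'a. r * (x \<bullet> b))" for r b
    by (intro bounded_linear_const_mult bounded_linear_inner_left)
  have "smooth_on UNIV (\<lambda>x::'a. flat_exp 0 (r * (x \<bullet> b) + s))" for r b s
    by (rule smooth_affine[OF lin smooth_flat_exp])
  from this[of "real n"] this[of "- real n"]
  have "smooth_on UNIV (\<lambda>x. flat_exp 0 (real n * ((x - a) \<bullet> b) - 1))"
    "smooth_on UNIV (\<lambda>x. flat_exp 0 (real n * ((c - x) \<bullet> b) - 1))" for b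
  proof -
    have e1: "real n * ((x - a) \<bullet> b) - 1 = real n * (x \<bullet> b) + (- real n * (a \<bullet> b) - 1)"
      and e2: "real n * ((c - x) \<bullet> b) - 1 = - real n * (x \<bullet> b) + (real n * (c \<bullet> b) - 1)" for x
      by (simp_all add: inner_diff_left algebra_simps)
    show "smooth_on UNIV (\<lambda>x. flat_exp 0 (real n * ((x - a) \<bullet> b) - 1))"
      unfolding e1 by fact
    show "smooth_on UNIV (\<lambda>x. flat_exp 0 (real n * ((c - x) \<bullet> b) - 1))"
      unfolding e2 by fact
  qed
  then show ?thesis unfolding box_bump_def[abs_def] by (intro smooth_prod smooth_mult)
qed

lemma flat_exp_0_le_1: "flat_exp 0 x \<le> 1"
  using flat_exp_le[of 0 x] by simp

lemma box_bump_nonneg: "0 \<le> box_bump a c n x"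
  unfolding box_bump_def by (intro prod_nonneg mult_nonneg_nonneg ballI flat_exp_nonneg)

lemma box_bump_le_1: "box_bump a c n x \<le> 1"
  unfolding box_bump_def
  by (intro prod_le_1 conjI mult_nonneg_nonneg mult_le_one flat_exp_nonneg flat_exp_0_le_1)

lemma box_bump_nonzero:
  assumes "box_bump a c n x \<noteq> 0" "b \<in> Basis"
  shows "real n * ((x - a) \<bullet> b) > 1" "real n * ((c - x) \<bullet> b) > 1"
proof -
  have "flat_exp 0 (real n * ((x - a) \<bullet> b) - 1) * flat_exp 0 (real n * ((c - x) \<bullet> b) - 1) \<noteq> 0"
    using assms by (auto simp: box_bump_def prod_zero_iff)
  then show "real n * ((x - a) \<bullet> b) > 1" "real n * ((c - x) \<bullet> b) > 1"
    by (auto simp: flat_exp_def split: if_splits)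
qed

lemma box_bump_test_function:
  assumes "box a c \<subseteq> U"
  shows "(\<lambda>x. complex_of_real (box_bump a c n x)) \<in> test_functions U"
proof (cases "n = 0")
  \<comment> \<open>For \<open>n = 0\<close> the bump vanishes; the box shrunk by \<open>1 / n\<close> used below would be the whole box.\<close>
  case True
  have "box_bump a c n x = 0" for x
    using box_bump_nonzero(1)[of a c n x "SOME b. b \<in> Basis"] True SOME_Basis by fastforce
  then show ?thesis using test_functionsI[of "\<lambda>_. 0" "{}" U] by (simp add: smooth_const)
next
  case False
  let ?a = "\<Sum>b\<in>Basis. (a \<bullet> b + 1 / real n) *\<^sub>R b" and ?c = "\<Sum>b\<in>Basis. (c \<bullet> b - 1 / real n) *\<^sub>R b"
  show ?thesis
  proof (rule test_functionsI)
    show "smooth_on UNIV (\<lambda>x. complex_of_real (box_bump a c n x))"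
      by (rule smooth_bounded_linear[OF bounded_linear_of_real box_bump_smooth])
    show "compact (cbox ?a ?c)" by (rule compact_cbox)
    have "cbox ?a ?c \<subseteq> box a c"
    proof
      fix x assume x: "x \<in> cbox ?a ?c"
      have "a \<bullet> b < x \<bullet> b \<and> x \<bullet> b < c \<bullet> b" if b: "b \<in> Basis" for b
      proof -
        have "a \<bullet> b + 1 / real n \<le> x \<bullet> b" "x \<bullet> b \<le> c \<bullet> b - 1 / real n"
          using x b by (auto simp: mem_box)
        moreover have "1 / real n > 0" using False by simp
        ultimately show ?thesis by linarith
      qed
      then show "x \<in> box a c" by (simp add: mem_box)
    qed
    then show "cbox ?a ?c \<subseteq> U" using assms by blast
    show "complex_of_real (box_bump a c n x) = 0" if "x \<notin> cbox ?a ?c" for x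
    proof (rule ccontr)
      assume "complex_of_real (box_bump a c n x) \<noteq> 0"
      then have nz: "box_bump a c n x \<noteq> 0" by simp
      have "x \<in> cbox ?a ?c"
        using box_bump_nonzero[OF nz] False by (auto simp: mem_box inner_diff_left field_simps less_imp_le)
      then show False using that by simp
    qed
  qed
qed

lemma filterlim_linear_at_top:
  assumes "0 < (r::real)"
  shows "filterlim (\<lambda>n. real n * r - 1) at_top sequentially"
proof -
  have "filterlim (\<lambda>n. real n * r) at_top sequentially"
    by (rule filterlim_at_top_mult_tendsto_pos[OF tendsto_const assms filterlim_real_sequentially])
  then show ?thesis
    using filterlim_tendsto_add_at_top[OF tendsto_const[of "-1"]] by fastforce
qed

lemma box_bump_tendsto: "(\<lambda>n. box_bump a c n x) \<longlonglongrightarrow> indicator (box a c) x"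
proof (cases "x \<in> box a c")
  case True
  have "(\<lambda>n. box_bump a c n x) \<longlonglongrightarrow> (\<Prod>b\<in>(Basis::'a set). 1 * 1)"
    unfolding box_bump_def
  proof (intro tendsto_prod tendsto_mult)
    fix b :: 'a assume b: "b \<in> Basis"
    show "(\<lambda>n. flat_exp 0 (real n * ((x - a) \<bullet> b) - 1)) \<longlonglongrightarrow> 1"
      "(\<lambda>n. flat_exp 0 (real n * ((c - x) \<bullet> b) - 1)) \<longlonglongrightarrow> 1"
      using True b
      by (auto intro!: filterlim_compose[OF flat_exp_0_tendsto] filterlim_linear_at_top
          simp: mem_box inner_diff_left)
  qed
  then show ?thesis using True by simp
next
  case False
  have "box_bump a c n x = 0" for n
  proof (rule ccontr)
    assume nz: "box_bump a c n x \<noteq> 0"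
    have "a \<bullet> b < x \<bullet> b \<and> x \<bullet> b < c \<bullet> b" if b: "b \<in> Basis" for b
    proof -
      have "0 < real n * ((x - a) \<bullet> b)" "0 < real n * ((c - x) \<bullet> b)"
        using box_bump_nonzero[OF nz b] by linarith+
      then show ?thesis by (simp add: zero_less_mult_iff inner_diff_left)
    qed
    then show False using False by (simp add: mem_box)
  qed
  then show ?thesis using False by simp
qed

lemma sigma_finite_lebesgue: "sigma_finite_measure (lebesgue :: 'a::euclidean_space measure)"
proof -
  obtain A :: "'a set set" where A: "countable A" "A \<subseteq> sets lborel" "\<Union>A = space lborel"
      "\<forall>a\<in>A. emeasure lborel a \<noteq> \<infinity>"
    using lborel.sigma_finite_countable by blast
  have "A \<subseteq> sets lebesgue" using A(2) by auto
  moreover have "\<forall>a\<in>A. emeasure lebesgue a \<noteq> \<infinity>"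
  proof
    fix a assume "a \<in> A"
    then have "a \<in> sets lborel" "emeasure lborel a \<noteq> \<infinity>" using A(2,4) by blast+
    then show "emeasure lebesgue a \<noteq> \<infinity>" by (simp add: main_part)
  qed
  ultimately show ?thesis
    using A(1,3) by (intro sigma_finite_measure.intro exI[of _ A]) simp
qed

text \<open>
  The sets over which \<open>h\<close> has integral zero form a Dynkin system that contains the boxes, hence all Borel
  sets; a Lebesgue set differs from a Borel set by a null set.
\<close>

lemma box_integrals_determine_zero:
  fixes h :: "'a::euclidean_space \<Rightarrow> complex"
  assumes h: "integrable lebesgue h"
    and zero: "\<And>a c. (LINT x|lebesgue. indicator (box a c) x *\<^sub>R h x) = 0"
    and total: "(LINT x|lebesgue. h x) = 0"
  shows "AE x in lebesgue. h x = 0"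
proof -
  have int: "integrable lebesgue (\<lambda>x. indicator A x *\<^sub>R h x)" if "A \<in> sets lebesgue" for A
    by (rule integrable_mult_indicator[OF that h])
  have borel: "(LINT x|lebesgue. indicator A x *\<^sub>R h x) = 0" if "A \<in> sets borel" for A
  proof -
    have gen: "A \<in> sigma_sets UNIV (range (\<lambda>(a, b). box a b))"
      using that by (simp add: borel_eq_box)
    have meas: "B \<in> sets lebesgue" if "B \<in> sigma_sets UNIV (range (\<lambda>(a, b). box a b))" for B :: "'a set"
    proof -
      have "B \<in> sets borel" using that by (simp add: borel_eq_box)
      then show ?thesis by simp
    qed
    show ?thesis
    proof (rule sigma_sets_induct_disjoint[OF _ _ gen])
      show "Int_stable (range (\<lambda>(a, b). box a b :: 'a set))"
        by (auto simp: Int_stable_def box_Int_box)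
    next
      fix B :: "'a set" assume "B \<in> range (\<lambda>(a, b). box a b)"
      then show "(LINT x|lebesgue. indicator B x *\<^sub>R h x) = 0" using zero by auto
    next
      fix B :: "'a set"
      assume B: "B \<in> sigma_sets UNIV (range (\<lambda>(a, b). box a b))" "(LINT x|lebesgue. indicator B x *\<^sub>R h x) = 0"
      have "indicator (UNIV - B) x *\<^sub>R h x = h x - indicator B x *\<^sub>R h x" for x
        by (simp add: indicator_def)
      then show "(LINT x|lebesgue. indicator (UNIV - B) x *\<^sub>R h x) = 0"
        using B(2) total int[OF meas[OF B(1)]] h by simp
    next
      fix B :: "nat \<Rightarrow> 'a set"
      assume B: "disjoint_family B" "range B \<subseteq> sigma_sets UNIV (range (\<lambda>(a, b). box a b))"
        "\<And>i. (LINT x|lebesgue. indicator (B i) x *\<^sub>R h x) = 0"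
      have Bm: "B i \<in> sets lebesgue" for i using B(2) by (intro meas) auto
      have "(LINT x:(\<Union>i. B i)|lebesgue. h x) = (\<Sum>i. LINT x:B i|lebesgue. h x)"
        using B(1) int[of "\<Union>i. B i"] Bm
        by (intro lebesgue_integral_countable_add Bm) (auto simp: set_integrable_def disjoint_family_on_def)
      then show "(LINT x|lebesgue. indicator (\<Union>i. B i) x *\<^sub>R h x) = 0"
        using B(3) by (simp add: set_lebesgue_integral_def)
    qed simp_all
  qed
  show ?thesis
  proof (rule sigma_finite_measure.density_zero[OF sigma_finite_lebesgue h])
    fix A :: "'a set" assume A: "A \<in> sets lebesgue"
    then obtain S N N' where S: "A = S \<union> N" "N \<subseteq> N'" "N' \<in> null_sets lborel" "S \<in> sets lborel"
      by (rule sets_completionE)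
    have "AE x in lebesgue. x \<notin> N'"
      using S(3) by (intro AE_not_in null_sets_completionI)
    then have "AE x in lebesgue. indicator A x *\<^sub>R h x = indicator S x *\<^sub>R h x"
      by eventually_elim (use S(1,2) in \<open>auto simp: indicator_def\<close>)
    then have "(LINT x:A|lebesgue. h x) = (LINT x|lebesgue. indicator S x *\<^sub>R h x)"
      unfolding set_lebesgue_integral_def using A S(4)
      by (intro integral_cong_AE borel_measurable_integrable int) auto
    also have "\<dots> = 0" using S(4) by (intro borel) simp
    finally show "(LINT x:A|lebesgue. h x) = 0" .
  qed
qed

lemma indicator_L2:
  assumes "compact K" "S \<in> sets lebesgue"
  shows "(\<lambda>x. complex_of_real (C * indicator K x)) \<in> L2 S"
proof (rule L2_of_bounded_support[OF _ assms])
  have "(\<lambda>x. complex_of_real (C * indicator K x)) \<in> borel_measurable borel"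
    using borel_compact[OF assms(1)] by measurable
  then show "(\<lambda>x. complex_of_real (C * indicator K x)) \<in> borel_measurable (lebesgue_on S)"
    by (intro measurable_restrict_space1 measurable_completion) simp
  show "norm (complex_of_real (C * indicator K x)) \<le> \<bar>C\<bar> * indicator K x" for x
    by (simp add: norm_mult)
qed

text \<open>
  The fundamental lemma of the calculus of variations. The bumps converge boundedly to indicators of boxes,
  so the integrals of \<open>f\<close> over all boxes in \<open>U\<close> vanish; countably many such boxes cover \<open>U\<close>.
\<close>

lemma fundamental_lemma:
  fixes f :: "'a::euclidean_space \<Rightarrow> complex"
  assumes U: "open U" and f: "f \<in> L2 U"
    and zero: "\<And>\<phi>. \<phi> \<in> test_functions U \<Longrightarrow> (LINT x|lebesgue_on U. f x * \<phi> x) = 0"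
  shows "AE x in lebesgue_on U. f x = 0"
proof -
  have Um: "U \<in> sets lebesgue" using U by simp
  then have Us: "U \<inter> space lebesgue \<in> sets lebesgue" by simp
  have box_meas: "box a c \<in> sets lebesgue" for a c :: 'a by simp
  have ind_int: "integrable (lebesgue_on U) (\<lambda>x. f x * complex_of_real (1 * indicator (cbox a c) x))" for a c
    by (intro L2_integrable_mult f indicator_L2 compact_cbox Um)
  have box_zero: "(LINT x|lebesgue. indicator (box a c) x *\<^sub>R f x) = 0" if sub: "box a c \<subseteq> U" for a c
  proof -
    have "(\<lambda>n. LINT x|lebesgue_on U. f x * complex_of_real (box_bump a c n x))
        \<longlonglongrightarrow> (LINT x|lebesgue_on U. f x * complex_of_real (indicator (box a c) x))"
    proof (rule integral_dominated_convergence)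
      show "integrable (lebesgue_on U) (\<lambda>x. norm (f x * complex_of_real (1 * indicator (cbox a c) x)))"
        by (intro integrable_norm ind_int)
      show "(\<lambda>x. f x * complex_of_real (box_bump a c n x)) \<in> borel_measurable (lebesgue_on U)" for n
        using L2_measurable[OF f] test_functions_measurable[OF box_bump_test_function[OF sub]]
        by (intro borel_measurable_times)
      have "(\<lambda>x. complex_of_real (indicator (box a c) x)) \<in> borel_measurable (lebesgue_on U)"
        by (intro measurable_restrict_space1 measurable_completion) simp
      then show "(\<lambda>x. f x * complex_of_real (indicator (box a c) x)) \<in> borel_measurable (lebesgue_on U)"
        using L2_measurable[OF f] by (intro borel_measurable_times)
      show "AE x in lebesgue_on U. (\<lambda>n. f x * complex_of_real (box_bump a c n x))
          \<longlonglongrightarrow> f x * complex_of_real (indicator (box a c) x)"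
        by (intro AE_I2 tendsto_intros box_bump_tendsto)
      show "AE x in lebesgue_on U. norm (f x * complex_of_real (box_bump a c n x))
          \<le> norm (f x * complex_of_real (1 * indicator (cbox a c) x))" for n
      proof (rule AE_I2)
        fix x
        have "\<bar>box_bump a c n x\<bar> \<le> indicator (cbox a c) x"
        proof (cases "box_bump a c n x = 0")
          case False
          have "a \<bullet> b \<le> x \<bullet> b \<and> x \<bullet> b \<le> c \<bullet> b" if b: "b \<in> Basis" for b
          proof -
            have "0 < real n * ((x - a) \<bullet> b)" "0 < real n * ((c - x) \<bullet> b)"
              using box_bump_nonzero[OF False b] by linarith+
            then show ?thesis by (simp add: zero_less_mult_iff inner_diff_left)
          qed
          then have "x \<in> cbox a c" by (simp add: mem_box)
          then show ?thesis using box_bump_nonneg[of a c n x] box_bump_le_1[of a c n x] by simp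
        qed simp
        then show "norm (f x * complex_of_real (box_bump a c n x))
          \<le> norm (f x * complex_of_real (1 * indicator (cbox a c) x))"
          by (simp add: norm_mult mult_left_mono)
      qed
    qed
    moreover have "(LINT x|lebesgue_on U. f x * complex_of_real (box_bump a c n x)) = 0" for n
      by (intro zero box_bump_test_function sub)
    ultimately have "(LINT x|lebesgue_on U. f x * complex_of_real (indicator (box a c) x)) = 0"
      by (simp add: LIMSEQ_const_iff)
    moreover have "(\<lambda>x. indicator U x *\<^sub>R (f x * complex_of_real (indicator (box a c) x)))
        = (\<lambda>x. indicator (box a c) x *\<^sub>R f x)"
      using sub by (auto simp: indicator_def fun_eq_iff)
    ultimately show ?thesis by (simp only: integral_restrict_space[OF Us])
  qed
  have ae_box: "AE x in lebesgue. x \<in> box a c \<longrightarrow> f x = 0" if sub: "box a c \<subseteq> U" for a c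
  proof -
    let ?h = "\<lambda>x. indicator (box a c) x *\<^sub>R f x"
    have "AE x in lebesgue. ?h x = 0"
    proof (rule box_integrals_determine_zero)
      have "integrable lebesgue (\<lambda>x. indicator U x *\<^sub>R (f x * complex_of_real (1 * indicator (cbox a c) x)))"
        using ind_int[of a c] by (simp only: integrable_restrict_space[OF Us])
      from integrable_mult_indicator[OF box_meas[of a c] this]
      show "integrable lebesgue ?h"
        by (rule Bochner_Integration.integrable_cong[THEN iffD1, rotated 2])
           (use sub box_subset_cbox[of a c] in \<open>auto simp: indicator_def\<close>)
      show "(LINT x|lebesgue. indicator (box a' c') x *\<^sub>R ?h x) = 0" for a' c'
      proof -
        obtain p q where pq: "box a' c' \<inter> box a c = box p q"
          using box_Int_box[of a' c' a c] by metis
        have "(\<lambda>x. indicator (box a' c') x *\<^sub>R ?h x) = (\<lambda>x. indicator (box p q) x *\<^sub>R f x)"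
          unfolding pq[symmetric] by (auto simp: indicator_def fun_eq_iff)
        moreover have "box p q \<subseteq> U" using pq sub by blast
        ultimately show ?thesis using box_zero by simp
      qed
      show "(LINT x|lebesgue. ?h x) = 0" by (rule box_zero[OF sub])
    qed
    then show ?thesis by eventually_elim (auto simp: indicator_def)
  qed
  obtain \<D> where D: "countable \<D>" "\<D> \<subseteq> Pow U" "\<And>X. X \<in> \<D> \<Longrightarrow> \<exists>a b. X = box a b" "\<Union>\<D> = U"
    using open_countable_Union_open_box[OF U] by blast
  have "AE x in lebesgue. \<forall>X\<in>\<D>. x \<in> X \<longrightarrow> f x = 0"
  proof (subst AE_ball_countable[OF D(1)], rule ballI)
    fix X assume X: "X \<in> \<D>"
    then obtain a c where "X = box a c" using D(3) by blast
    moreover have "X \<subseteq> U" using X D(2) by blast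
    ultimately show "AE x in lebesgue. x \<in> X \<longrightarrow> f x = 0" using ae_box by simp
  qed
  then have "AE x in lebesgue. x \<in> U \<longrightarrow> f x = 0"
    by eventually_elim (use D(4) in blast)
  then show ?thesis using Us by (subst AE_restrict_space_iff) auto
qed

lemma weak_deriv_unique:
  assumes U: "open U" and g: "g \<in> L2 U" "g' \<in> L2 U"
    and w: "is_weak_deriv U w f g" "is_weak_deriv U w f g'"
  shows "ae_eq U g g'"
proof -
  have Um: "U \<in> sets lebesgue" using U by simp
  have "AE x in lebesgue_on U. g x - g' x = 0"
  proof (rule fundamental_lemma[OF U L2_diff[OF g]])
    fix \<phi> :: "'a \<Rightarrow> complex" assume \<phi>: "\<phi> \<in> test_functions U"
    have "integrable (lebesgue_on U) (\<lambda>x. g x * \<phi> x)" "integrable (lebesgue_on U) (\<lambda>x. g' x * \<phi> x)"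
      by (intro L2_integrable_mult g test_functions_L2[OF \<phi> Um])+
    moreover have "(LINT x|lebesgue_on U. g x * \<phi> x) = (LINT x|lebesgue_on U. g' x * \<phi> x)"
      using w \<phi> unfolding is_weak_deriv_def by (metis neg_equal_iff_equal)
    ultimately show "(LINT x|lebesgue_on U. (g x - g' x) * \<phi> x) = 0"
      by (simp add: left_diff_distrib)
  qed
  then show ?thesis by (simp add: ae_eq_def)
qed

section \<open>Weak gradients\<close>

definition weak_gradient ::
    "'a::euclidean_space set \<Rightarrow> ('a \<Rightarrow> complex) \<Rightarrow> ('a \<Rightarrow> 'a \<Rightarrow> complex) \<Rightarrow> bool" where
  "weak_gradient U f G \<longleftrightarrow> f \<in> L2 U \<and> (\<forall>b\<in>Basis. G b \<in> L2 U \<and> is_weak_deriv U b f (G b))"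

text \<open>The derivative in direction \<open>w\<close>, computed from the gradient.\<close>

definition along :: "'a::euclidean_space \<Rightarrow> ('a \<Rightarrow> 'a \<Rightarrow> complex) \<Rightarrow> 'a \<Rightarrow> complex" where
  "along w G x = (\<Sum>b\<in>Basis. of_real (w \<bullet> b) * G b x)"

lemma weak_gradientD:
  "weak_gradient U f G \<Longrightarrow> f \<in> L2 U"
  "weak_gradient U f G \<Longrightarrow> b \<in> Basis \<Longrightarrow> G b \<in> L2 U"
  "weak_gradient U f G \<Longrightarrow> b \<in> Basis \<Longrightarrow> is_weak_deriv U b f (G b)"
  by (simp_all add: weak_gradient_def)

lemma along_Basis: "b \<in> Basis \<Longrightarrow> along b G x = G b x"
  by (simp add: along_def inner_Basis if_distrib if_distribR sum.delta' cong: if_cong)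

lemma along_add: "along (u + w) G x = along u G x + along w G x"
  by (simp add: along_def inner_add_left distrib_right sum.distrib)

lemma along_scale: "along (r *\<^sub>R w) G x = of_real r * along w G x"
  by (simp add: along_def sum_distrib_left mult.assoc)

lemma along_L2: "(\<And>b. b \<in> Basis \<Longrightarrow> G b \<in> L2 U) \<Longrightarrow> along w G \<in> L2 U"
  unfolding along_def[abs_def] by (intro L2_sum L2_scale)

lemma smooth_along:
  assumes "smooth_on UNIV \<phi>"
  shows "along w (\<lambda>b x. frechet_derivative \<phi> (at x) b) x = frechet_derivative \<phi> (at x) w"
proof -
  interpret linear "frechet_derivative \<phi> (at x)" by (rule smooth_derivative_linear[OF assms])
  have "frechet_derivative \<phi> (at x) w = frechet_derivative \<phi> (at x) (\<Sum>b\<in>Basis. (w \<bullet> b) *\<^sub>R b)"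
    by (simp add: euclidean_representation)
  also have "\<dots> = (\<Sum>b\<in>Basis. (w \<bullet> b) *\<^sub>R frechet_derivative \<phi> (at x) b)"
    by (simp add: sum scale)
  finally show ?thesis by (simp add: along_def scaleR_conv_of_real)
qed

lemma weak_deriv_along:
  assumes U: "U \<in> sets lebesgue" and G: "weak_gradient U f G"
  shows "is_weak_deriv U w f (along w G)"
  unfolding is_weak_deriv_def
proof
  fix \<phi> :: "'a \<Rightarrow> complex" assume \<phi>: "\<phi> \<in> test_functions U"
  let ?D = "\<lambda>b x. frechet_derivative \<phi> (at x) b"
  have i1: "integrable (lebesgue_on U) (\<lambda>x. f x * ?D b x)" for b
    by (intro L2_integrable_mult weak_gradientD(1)[OF G] test_functions_L2[OF test_functions_derivative[OF \<phi>] U])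
  have i2: "integrable (lebesgue_on U) (\<lambda>x. G b x * \<phi> x)" if "b \<in> Basis" for b
    by (intro L2_integrable_mult weak_gradientD(2)[OF G that] test_functions_L2[OF \<phi> U])
  have "(LINT x|lebesgue_on U. f x * ?D w x) = (LINT x|lebesgue_on U. (\<Sum>b\<in>Basis. of_real (w \<bullet> b) * (f x * ?D b x)))"
    unfolding smooth_along[OF test_functions_smooth[OF \<phi>], of w, symmetric] along_def
    by (simp add: sum_distrib_left mult_ac)
  also have "\<dots> = (\<Sum>b\<in>Basis. of_real (w \<bullet> b) * (LINT x|lebesgue_on U. f x * ?D b x))"
    by (subst Bochner_Integration.integral_sum) (auto intro: integrable_mult_right i1)
  also have "\<dots> = (\<Sum>b\<in>Basis. of_real (w \<bullet> b) * - (LINT x|lebesgue_on U. G b x * \<phi> x))"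
    using weak_gradientD(3)[OF G] \<phi> by (simp add: is_weak_deriv_def)
  also have "\<dots> = - (LINT x|lebesgue_on U. (\<Sum>b\<in>Basis. of_real (w \<bullet> b) * (G b x * \<phi> x)))"
    by (subst Bochner_Integration.integral_sum) (auto intro: integrable_mult_right i2 simp: sum_negf)
  also have "\<dots> = - (LINT x|lebesgue_on U. along w G x * \<phi> x)"
    by (simp add: along_def sum_distrib_right mult.assoc)
  finally show "(LINT x|lebesgue_on U. f x * ?D w x) = - (LINT x|lebesgue_on U. along w G x * \<phi> x)" .
qed

lemma is_weak_deriv_combine:
  assumes U: "U \<in> sets lebesgue" and L2: "f \<in> L2 U" "g \<in> L2 U" "f' \<in> L2 U" "g' \<in> L2 U"
    and w: "is_weak_deriv U w f f'" "is_weak_deriv U w g g'"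
  shows "is_weak_deriv U w (\<lambda>x. f x + c * g x) (\<lambda>x. f' x + c * g' x)"
  unfolding is_weak_deriv_def
proof
  fix \<phi> :: "'a \<Rightarrow> complex" assume \<phi>: "\<phi> \<in> test_functions U"
  let ?D = "\<lambda>x. frechet_derivative \<phi> (at x) w"
  have D: "?D \<in> L2 U" and P: "\<phi> \<in> L2 U"
    by (rule test_functions_L2[OF test_functions_derivative[OF \<phi>] U] test_functions_L2[OF \<phi> U])+
  have "(LINT x|lebesgue_on U. (f x + c * g x) * ?D x)
      = (LINT x|lebesgue_on U. f x * ?D x) + c * (LINT x|lebesgue_on U. g x * ?D x)"
    using L2 by (simp add: distrib_right mult.assoc L2_integrable_mult D)
  also have "\<dots> = - (LINT x|lebesgue_on U. f' x * \<phi> x) + c * - (LINT x|lebesgue_on U. g' x * \<phi> x)"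
    using w \<phi> by (simp add: is_weak_deriv_def)
  also have "\<dots> = - (LINT x|lebesgue_on U. (f' x + c * g' x) * \<phi> x)"
    using L2 by (simp add: distrib_right mult.assoc L2_integrable_mult P)
  finally show "(LINT x|lebesgue_on U. (f x + c * g x) * ?D x) = - (LINT x|lebesgue_on U. (f' x + c * g' x) * \<phi> x)" .
qed

lemma weak_gradient_combine:
  assumes U: "U \<in> sets lebesgue" and "weak_gradient U f F" "weak_gradient U g G"
  shows "weak_gradient U (\<lambda>x. f x + c * g x) (\<lambda>b x. F b x + c * G b x)"
  using assms(2,3) unfolding weak_gradient_def
  by (auto intro!: L2_add L2_scale is_weak_deriv_combine[OF U])

lemma weak_gradient_diff:
  assumes "U \<in> sets lebesgue" "weak_gradient U f F" "weak_gradient U g G"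
  shows "weak_gradient U (\<lambda>x. f x - g x) (\<lambda>b x. F b x - G b x)"
  using weak_gradient_combine[OF assms, of "-1"] by simp

lemma weak_gradient_test_function:
  assumes "\<phi> \<in> test_functions V" "U \<in> sets lebesgue"
  shows "weak_gradient U \<phi> (\<lambda>b x. frechet_derivative \<phi> (at x) b)"
  unfolding weak_gradient_def
  using test_functions_L2[OF assms] test_functions_L2[OF test_functions_derivative[OF assms(1)] assms(2)]
    smooth_weak_deriv[OF assms] by auto

lemma weak_gradient_mono:
  assumes G: "weak_gradient U f G" and VU: "V \<subseteq> U" and meas: "U \<in> sets lebesgue" "V \<in> sets lebesgue"
  shows "weak_gradient V f G"
  unfolding weak_gradient_def is_weak_deriv_def
proof (intro conjI ballI)
  show "f \<in> L2 V" by (rule L2_mono[OF VU meas weak_gradientD(1)[OF G]])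
next
  fix b :: 'a assume b: "b \<in> Basis"
  show "G b \<in> L2 V" by (rule L2_mono[OF VU meas weak_gradientD(2)[OF G b]])
  fix \<phi> :: "'a \<Rightarrow> complex" assume \<phi>: "\<phi> \<in> test_functions V"
  obtain K where K: "K \<subseteq> V" "\<And>x. x \<notin> K \<Longrightarrow> \<phi> x = 0" "\<And>x w. x \<notin> K \<Longrightarrow> frechet_derivative \<phi> (at x) w = 0"
    by (rule test_functionsE[OF \<phi>]) blast
  have "(LINT x|lebesgue_on V. f x * frechet_derivative \<phi> (at x) b)
      = (LINT x|lebesgue_on U. f x * frechet_derivative \<phi> (at x) b)"
    using K VU by (intro integral_lebesgue_on_support meas) auto
  also have "\<dots> = - (LINT x|lebesgue_on U. G b x * \<phi> x)"
    using weak_gradientD(3)[OF G b] test_functions_mono[OF VU \<phi>] by (simp add: is_weak_deriv_def)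
  also have "(LINT x|lebesgue_on U. G b x * \<phi> x) = (LINT x|lebesgue_on V. G b x * \<phi> x)"
    using K VU by (intro integral_lebesgue_on_support meas) auto
  finally show "(LINT x|lebesgue_on V. f x * frechet_derivative \<phi> (at x) b) = - (LINT x|lebesgue_on V. G b x * \<phi> x)" .
qed

lemma H1_weak_gradient: "f \<in> H1 U \<Longrightarrow> weak_gradient U f (\<lambda>b. weak_deriv U b f)"
proof -
  assume f: "f \<in> H1 U"
  have "weak_deriv U b f \<in> L2 U \<and> is_weak_deriv U b f (weak_deriv U b f)" if "b \<in> Basis" for b
  proof -
    have "\<exists>g. g \<in> L2 U \<and> is_weak_deriv U b f g" using f that by (auto simp: H1_def)
    from someI_ex[OF this] show ?thesis by (simp add: weak_deriv_def)
  qed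
  then show ?thesis using f by (auto simp: weak_gradient_def H1_def)
qed

lemma weak_gradient_H1: "weak_gradient U f G \<Longrightarrow> f \<in> H1 U"
  by (auto simp: weak_gradient_def H1_def)

lemma weak_deriv_ae_eq:
  assumes "open U" "weak_gradient U f G" "b \<in> Basis"
  shows "ae_eq U (weak_deriv U b f) (G b)"
  using weak_gradientD[OF H1_weak_gradient[OF weak_gradient_H1[OF assms(2)]]] weak_gradientD[OF assms(2)] assms
  by (intro weak_deriv_unique[of U _ _ b f]) auto

text \<open>
  \<^const>\<open>weak_deriv\<close> is a choice among functions that agree almost everywhere, so the form can be computed
  from any gradient.
\<close>

lemma gradient_form_eq:
  assumes U: "open U" and F: "weak_gradient U f F" and G: "weak_gradient U g G"
  shows "gradient_form U f g = (\<Sum>b\<in>Basis. L2_inner U (F b) (G b))"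
proof -
  let ?F = "\<lambda>b. weak_deriv U b f" and ?G = "\<lambda>b. weak_deriv U b g"
  have F': "weak_gradient U f ?F" and G': "weak_gradient U g ?G"
    using F G by (auto intro: H1_weak_gradient weak_gradient_H1)
  have "gradient_form U f g = (\<Sum>b\<in>Basis. L2_inner U (?F b) (?G b))"
    unfolding gradient_form_def L2_inner_def
    by (rule Bochner_Integration.integral_sum)
       (rule L2_integrable_inner[OF weak_gradientD(2)[OF F'] weak_gradientD(2)[OF G']])
  also have "\<dots> = (\<Sum>b\<in>Basis. L2_inner U (F b) (G b))"
    using U F G F' G'
    by (intro sum.cong refl L2_inner_cong weak_deriv_ae_eq) (auto dest: weak_gradientD)
  finally show ?thesis .
qed

lemma H1_norm_square:
  assumes U: "open U" and F: "weak_gradient U f F"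
  shows "(H1_norm U f)\<^sup>2 = (L2_norm U f)\<^sup>2 + (\<Sum>b\<in>Basis. (L2_norm U (F b))\<^sup>2)"
proof -
  have F': "weak_gradient U f (\<lambda>b. weak_deriv U b f)"
    using F by (auto intro: H1_weak_gradient weak_gradient_H1)
  have "H1_inner U f f = L2_inner U f f + (\<Sum>b\<in>Basis. L2_inner U (F b) (F b))"
    unfolding H1_inner_def using U F F'
    by (intro arg_cong2[where f = "(+)"] sum.cong refl L2_inner_cong weak_deriv_ae_eq) (auto dest: weak_gradientD)
  also have "\<dots> = complex_of_real ((L2_norm U f)\<^sup>2 + (\<Sum>b\<in>Basis. (L2_norm U (F b))\<^sup>2))"
    by (simp only: L2_inner_self_norm of_real_add of_real_sum)
  finally show ?thesis
    by (simp add: H1_norm_def add_nonneg_nonneg sum_nonneg)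
qed

lemma H1_norm_nonneg: "open U \<Longrightarrow> weak_gradient U f F \<Longrightarrow> 0 \<le> H1_norm U f"
  unfolding H1_norm_def H1_inner_def
  by (simp add: L2_inner_self sum_nonneg add_nonneg_nonneg)

section \<open>Convergence in the Sobolev norm\<close>

text \<open>
  Squares of norms are used because the square of the \<open>H\<^sup>1\<close> norm is a sum over the components.
\<close>

definition L2_lim :: "'a::euclidean_space set \<Rightarrow> (nat \<Rightarrow> 'a \<Rightarrow> complex) \<Rightarrow> ('a \<Rightarrow> complex) \<Rightarrow> bool" where
  "L2_lim U X f \<longleftrightarrow> (\<forall>n. X n \<in> L2 U) \<and> f \<in> L2 U \<and> (\<lambda>n. (L2_norm U (\<lambda>x. f x - X n x))\<^sup>2) \<longlonglongrightarrow> 0"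

lemma L2_norm_add_square_le:
  assumes "f \<in> L2 U" "g \<in> L2 U"
  shows "(L2_norm U (\<lambda>x. f x + g x))\<^sup>2 \<le> 2 * (L2_norm U f)\<^sup>2 + 2 * (L2_norm U g)\<^sup>2"
proof -
  have "(L2_norm U (\<lambda>x. f x + g x))\<^sup>2 \<le> (LINT x|lebesgue_on U. 2 * (norm (f x))\<^sup>2 + 2 * (norm (g x))\<^sup>2)"
    unfolding L2_norm_square
    by (intro integral_mono norm_add_square_le L2_integrable_square L2_add assms
        Bochner_Integration.integrable_add integrable_mult_right)
  then show ?thesis using assms by (simp add: L2_norm_square L2_integrable_square)
qed

lemma L2_norm_scale_square: "(L2_norm U (\<lambda>x. c * f x))\<^sup>2 = (norm c)\<^sup>2 * (L2_norm U f)\<^sup>2"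
  by (simp add: L2_norm_square norm_mult power_mult_distrib)

lemma L2_lim_combine:
  assumes X: "L2_lim U X f" and Y: "L2_lim U Y g"
  shows "L2_lim U (\<lambda>n x. X n x + c * Y n x) (\<lambda>x. f x + c * g x)"
  unfolding L2_lim_def
proof (intro conjI allI)
  have L2: "X n \<in> L2 U" "Y n \<in> L2 U" "f \<in> L2 U" "g \<in> L2 U" for n
    using X Y by (auto simp: L2_lim_def)
  show "(\<lambda>x. X n x + c * Y n x) \<in> L2 U" "(\<lambda>x. f x + c * g x) \<in> L2 U" for n
    by (intro L2_add L2_scale L2)+
  show "(\<lambda>n. (L2_norm U (\<lambda>x. f x + c * g x - (X n x + c * Y n x)))\<^sup>2) \<longlonglongrightarrow> 0"
  proof (rule Lim_null_comparison)
    show "\<forall>\<^sub>F n in sequentially. norm ((L2_norm U (\<lambda>x. f x + c * g x - (X n x + c * Y n x)))\<^sup>2)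
        \<le> 2 * (L2_norm U (\<lambda>x. f x - X n x))\<^sup>2 + 2 * ((norm c)\<^sup>2 * (L2_norm U (\<lambda>x. g x - Y n x))\<^sup>2)"
    proof (rule always_eventually, rule allI)
      fix n
      have "(\<lambda>x. f x + c * g x - (X n x + c * Y n x)) = (\<lambda>x. (f x - X n x) + c * (g x - Y n x))"
        by (simp add: algebra_simps)
      then show "norm ((L2_norm U (\<lambda>x. f x + c * g x - (X n x + c * Y n x)))\<^sup>2)
        \<le> 2 * (L2_norm U (\<lambda>x. f x - X n x))\<^sup>2 + 2 * ((norm c)\<^sup>2 * (L2_norm U (\<lambda>x. g x - Y n x))\<^sup>2)"
        using L2_norm_add_square_le[OF L2_diff[OF L2(3,1)] L2_scale[OF L2_diff[OF L2(4,2)]], of n c n]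
        by (simp only: L2_norm_scale_square) simp
    qed
    show "(\<lambda>n. 2 * (L2_norm U (\<lambda>x. f x - X n x))\<^sup>2 + 2 * ((norm c)\<^sup>2 * (L2_norm U (\<lambda>x. g x - Y n x))\<^sup>2)) \<longlonglongrightarrow> 0"
      using X Y by (auto simp: L2_lim_def intro!: tendsto_add_zero tendsto_mult_right_zero)
  qed
qed

lemma L2_lim_const: "f \<in> L2 U \<Longrightarrow> L2_lim U (\<lambda>n. f) f"
  by (simp add: L2_lim_def L2_norm_square)

lemma L2_lim_sum:
  assumes "\<And>i. i \<in> I \<Longrightarrow> L2_lim U (X i) (f i)"
  shows "L2_lim U (\<lambda>n x. \<Sum>i\<in>I. c i * X i n x) (\<lambda>x. \<Sum>i\<in>I. c i * f i x)"
  using assms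
proof (induction I rule: infinite_finite_induct)
  case (insert i I)
  have "L2_lim U (\<lambda>n x. (\<Sum>i\<in>I. c i * X i n x) + c i * X i n x) (\<lambda>x. (\<Sum>i\<in>I. c i * f i x) + c i * f i x)"
    using insert by (intro L2_lim_combine) auto
  then show ?case using insert by (simp add: add.commute)
qed (simp_all add: L2_lim_const L2_zero)

lemma L2_lim_along:
  assumes "\<And>b. b \<in> Basis \<Longrightarrow> L2_lim U (\<lambda>n. X n b) (G b)"
  shows "L2_lim U (\<lambda>n. along w (X n)) (along w G)"
  unfolding along_def[abs_def] using assms by (rule L2_lim_sum)

lemma L2_lim_inner:
  assumes "L2_lim U X f" "g \<in> L2 U"
  shows "(\<lambda>n. L2_inner U (X n) g) \<longlonglongrightarrow> L2_inner U f g"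
proof (rule L2_inner_tendsto_left)
  have "(\<lambda>n. sqrt ((L2_norm U (\<lambda>x. f x - X n x))\<^sup>2)) \<longlonglongrightarrow> sqrt 0"
    using assms(1) by (intro tendsto_real_sqrt) (simp add: L2_lim_def)
  moreover have "L2_norm U (\<lambda>x. f x - X n x) = L2_norm U (\<lambda>x. X n x - f x)" for n
    by (simp add: L2_norm_def L2_inner_self norm_minus_commute)
  ultimately show "(\<lambda>n. L2_norm U (\<lambda>x. X n x - f x)) \<longlonglongrightarrow> 0"
    by (simp add: L2_norm_nonneg)
qed (use assms in \<open>auto simp: L2_lim_def\<close>)

lemma L2_norm_mono:
  assumes VU: "V \<subseteq> U" "U \<in> sets lebesgue" "V \<in> sets lebesgue" and f: "f \<in> L2 U"
  shows "(L2_norm V f)\<^sup>2 \<le> (L2_norm U f)\<^sup>2"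
proof -
  have Us: "U \<inter> space lebesgue \<in> sets lebesgue" and Vs: "V \<inter> space lebesgue \<in> sets lebesgue"
    using VU by simp_all
  have "(LINT x|lebesgue. indicator V x *\<^sub>R (norm (f x))\<^sup>2) \<le> (LINT x|lebesgue. indicator U x *\<^sub>R (norm (f x))\<^sup>2)"
  proof (rule integral_mono)
    show "integrable lebesgue (\<lambda>x. indicator V x *\<^sub>R (norm (f x))\<^sup>2)"
      using L2_integrable_square[OF L2_mono[OF VU f]] by (simp only: integrable_restrict_space[OF Vs])
    show "integrable lebesgue (\<lambda>x. indicator U x *\<^sub>R (norm (f x))\<^sup>2)"
      using L2_integrable_square[OF f] by (simp only: integrable_restrict_space[OF Us])
  qed (use VU(1) in \<open>auto simp: indicator_def\<close>)
  then show ?thesis by (simp only: L2_norm_square integral_restrict_space[OF Us] integral_restrict_space[OF Vs])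
qed

lemma L2_lim_bounded_map:
  assumes X: "L2_lim U X f" and le: "\<And>n. (L2_norm V (\<lambda>x. T f x - T (X n) x))\<^sup>2 \<le> (L2_norm U (\<lambda>x. f x - X n x))\<^sup>2"
    and T: "\<And>f. f \<in> L2 U \<Longrightarrow> T f \<in> L2 V"
  shows "L2_lim V (\<lambda>n. T (X n)) (T f)"
proof -
  have "(\<lambda>n. (L2_norm V (\<lambda>x. T f x - T (X n) x))\<^sup>2) \<longlonglongrightarrow> 0"
    by (rule Lim_null_comparison[of _ "\<lambda>n. (L2_norm U (\<lambda>x. f x - X n x))\<^sup>2"])
       (use X le in \<open>auto simp: L2_lim_def intro!: always_eventually\<close>)
  then show ?thesis using X T by (simp add: L2_lim_def)
qed

lemma L2_lim_mono:
  assumes VU: "V \<subseteq> U" "U \<in> sets lebesgue" "V \<in> sets lebesgue" and X: "L2_lim U X f"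
  shows "L2_lim V X f"
  using X L2_norm_mono[OF VU] L2_mono[OF VU]
  by (intro L2_lim_bounded_map[of U X f V "\<lambda>f. f"]) (auto simp: L2_lim_def L2_diff)

lemma L2_lim_dominated:
  assumes X: "\<And>n. X n \<in> borel_measurable (lebesgue_on U)" and f: "f \<in> borel_measurable (lebesgue_on U)"
    and w: "w \<in> L2 U" and le: "\<And>n x. x \<in> U \<Longrightarrow> norm (X n x) \<le> norm (w x)"
    and lim: "\<And>x. x \<in> U \<Longrightarrow> (\<lambda>n. X n x) \<longlonglongrightarrow> f x"
  shows "L2_lim U X f"
proof -
  have fle: "norm (f x) \<le> norm (w x)" if "x \<in> U" for x
    using tendsto_norm[OF lim[OF that]] le[OF that] by (intro Lim_bounded[where M = 0]) auto
  have dominated: "h \<in> L2 U" if "h \<in> borel_measurable (lebesgue_on U)" "\<And>x. x \<in> U \<Longrightarrow> norm (h x) \<le> norm (w x)" for h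
  proof -
    have "integrable (lebesgue_on U) (\<lambda>x. (norm (h x))\<^sup>2)"
      using that by (intro Bochner_Integration.integrable_bound[OF L2_integrable_square[OF w]])
        (auto intro!: AE_I2 power_mono simp: space_restrict_space)
    then show ?thesis using that by (simp add: L2_def)
  qed
  have "(\<lambda>n. LINT x|lebesgue_on U. (norm (f x - X n x))\<^sup>2) \<longlonglongrightarrow> (LINT x|lebesgue_on U. 0)"
  proof (rule integral_dominated_convergence)
    show "integrable (lebesgue_on U) (\<lambda>x. 4 * (norm (w x))\<^sup>2)"
      by (intro integrable_mult_right L2_integrable_square w)
    show "(\<lambda>x. (norm (f x - X n x))\<^sup>2) \<in> borel_measurable (lebesgue_on U)" for n
      using X f by measurable
    show "AE x in lebesgue_on U. (\<lambda>n. (norm (f x - X n x))\<^sup>2) \<longlonglongrightarrow> 0"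
    proof (rule AE_I2)
      fix x assume "x \<in> space (lebesgue_on U)"
      then have "x \<in> U" by (simp add: space_restrict_space)
      then have "(\<lambda>n. (norm (f x - X n x))\<^sup>2) \<longlonglongrightarrow> (norm (f x - f x))\<^sup>2"
        by (intro tendsto_intros lim)
      then show "(\<lambda>n. (norm (f x - X n x))\<^sup>2) \<longlonglongrightarrow> 0" by simp
    qed
    show "AE x in lebesgue_on U. norm ((norm (f x - X n x))\<^sup>2) \<le> 4 * (norm (w x))\<^sup>2" for n
    proof (rule AE_I2)
      fix x assume "x \<in> space (lebesgue_on U)"
      then have x: "x \<in> U" by (simp add: space_restrict_space)
      have "norm (f x - X n x) \<le> 2 * norm (w x)"
        using norm_triangle_ineq4[of "f x" "X n x"] fle[OF x] le[OF x, of n] by linarith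
      from power_mono[OF this, of 2] show "norm ((norm (f x - X n x))\<^sup>2) \<le> 4 * (norm (w x))\<^sup>2"
        by (simp add: power_mult_distrib)
    qed
  qed simp
  then show ?thesis
    using dominated[OF X le] dominated[OF f fle] by (simp add: L2_lim_def L2_norm_square)
qed

lemma H10_D: "f \<in> H10 U \<Longrightarrow> f \<in> H1 U"
  by (simp add: H10_def)

lemma H10_sequence:
  assumes U: "open U" and f: "f \<in> H10 U" and F: "weak_gradient U f F"
  obtains \<phi> where "\<And>n. \<phi> n \<in> test_functions U" "L2_lim U \<phi> f"
    "\<And>b. b \<in> Basis \<Longrightarrow> L2_lim U (\<lambda>n x. frechet_derivative (\<phi> n) (at x) b) (F b)"
proof -
  have Um: "U \<in> sets lebesgue" using U by simp
  have "\<exists>\<phi>\<in>test_functions U. H1_norm U (\<lambda>x. f x - \<phi> x) < 1 / real (Suc n)" for n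
    using f by (simp add: H10_def)
  then obtain \<phi> where \<phi>: "\<And>n. \<phi> n \<in> test_functions U" "\<And>n. H1_norm U (\<lambda>x. f x - \<phi> n x) < 1 / real (Suc n)"
    by metis
  let ?D = "\<lambda>n b x. frechet_derivative (\<phi> n) (at x) b"
  have G: "weak_gradient U (\<phi> n) (?D n)" for n by (rule weak_gradient_test_function[OF \<phi>(1) Um])
  have sq: "(H1_norm U (\<lambda>x. f x - \<phi> n x))\<^sup>2 = (L2_norm U (\<lambda>x. f x - \<phi> n x))\<^sup>2
      + (\<Sum>b\<in>Basis. (L2_norm U (\<lambda>x. F b x - ?D n b x))\<^sup>2)" for n
    by (rule H1_norm_square[OF U weak_gradient_diff[OF Um F G]])
  have nonneg: "0 \<le> H1_norm U (\<lambda>x. f x - \<phi> n x)" for n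
    by (rule H1_norm_nonneg[OF U weak_gradient_diff[OF Um F G]])
  have small: "(H1_norm U (\<lambda>x. f x - \<phi> n x))\<^sup>2 \<le> (1 / real (Suc n))\<^sup>2" for n
    using \<phi>(2)[of n] nonneg[of n] by (intro power_mono) auto
  have lim0: "(\<lambda>n. (1 / real (Suc n))\<^sup>2) \<longlonglongrightarrow> 0"
    using tendsto_power[OF LIMSEQ_inverse_real_of_nat, of 2] by (simp add: inverse_eq_divide)
  have c: "X \<longlonglongrightarrow> 0" if "\<And>n. 0 \<le> X n" "\<And>n. X n \<le> (H1_norm U (\<lambda>x. f x - \<phi> n x))\<^sup>2" for X :: "nat \<Rightarrow> real"
    using that small by (intro Lim_null_comparison[OF _ lim0] always_eventually allI)
      (metis abs_of_nonneg order_trans real_norm_def)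
  show ?thesis
  proof (rule that[OF \<phi>(1)])
    have "(\<lambda>n. (L2_norm U (\<lambda>x. f x - \<phi> n x))\<^sup>2) \<longlonglongrightarrow> 0"
      by (rule c) (simp_all add: sq sum_nonneg)
    then show "L2_lim U \<phi> f"
      unfolding L2_lim_def using weak_gradientD(1)[OF F] weak_gradientD(1)[OF G] by simp
    fix b :: 'a assume b: "b \<in> Basis"
    have "(L2_norm U (\<lambda>x. F b x - ?D n b x))\<^sup>2 \<le> (\<Sum>b\<in>Basis. (L2_norm U (\<lambda>x. F b x - ?D n b x))\<^sup>2)" for n
      using b by (intro member_le_sum) auto
    then have "(\<lambda>n. (L2_norm U (\<lambda>x. F b x - ?D n b x))\<^sup>2) \<longlonglongrightarrow> 0"
      by (intro c) (simp_all add: sq add_increasing)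
    then show "L2_lim U (\<lambda>n x. frechet_derivative (\<phi> n) (at x) b) (F b)"
      unfolding L2_lim_def using weak_gradientD(2)[OF F b] weak_gradientD(2)[OF G b] by simp
  qed
qed

text \<open>
  Approximating by functions that can themselves be approximated by test functions is enough.
\<close>

lemma H10_closed:
  assumes U: "open U" and F: "weak_gradient U f F"
    and \<psi>: "\<And>n. \<psi> n \<in> H10 U" "\<And>n. weak_gradient U (\<psi> n) (\<Psi> n)"
    and lim: "L2_lim U \<psi> f" "\<And>b. b \<in> Basis \<Longrightarrow> L2_lim U (\<lambda>n. \<Psi> n b) (F b)"
  shows "f \<in> H10 U"
  unfolding H10_def
proof (intro CollectI conjI allI impI weak_gradient_H1[OF F])
  fix \<epsilon> :: real assume \<epsilon>: "\<epsilon> > 0"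
  have Um: "U \<in> sets lebesgue" using U by simp
  have sq: "(H1_norm U (\<lambda>x. f x - \<psi> n x))\<^sup>2 = (L2_norm U (\<lambda>x. f x - \<psi> n x))\<^sup>2
      + (\<Sum>b\<in>Basis. (L2_norm U (\<lambda>x. F b x - \<Psi> n b x))\<^sup>2)" for n
    by (rule H1_norm_square[OF U weak_gradient_diff[OF Um F \<psi>(2)]])
  have "(\<lambda>n. (L2_norm U (\<lambda>x. f x - \<psi> n x))\<^sup>2
      + (\<Sum>b\<in>Basis. (L2_norm U (\<lambda>x. F b x - \<Psi> n b x))\<^sup>2)) \<longlonglongrightarrow> 0 + (\<Sum>b\<in>(Basis::'a set). 0)"
    using lim by (intro tendsto_add tendsto_sum) (auto simp: L2_lim_def)
  then have "(\<lambda>n. (H1_norm U (\<lambda>x. f x - \<psi> n x))\<^sup>2) \<longlonglongrightarrow> 0" unfolding sq by simp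
  then have "\<forall>\<^sub>F n in sequentially. (H1_norm U (\<lambda>x. f x - \<psi> n x))\<^sup>2 < (\<epsilon> / 2)\<^sup>2"
    by (rule order_tendstoD(2)) (use \<epsilon> in simp)
  then obtain n where n: "(H1_norm U (\<lambda>x. f x - \<psi> n x))\<^sup>2 < (\<epsilon> / 2)\<^sup>2"
    by (auto simp: eventually_sequentially)
  obtain \<phi> where \<phi>: "\<phi> \<in> test_functions U" "H1_norm U (\<lambda>x. \<psi> n x - \<phi> x) < \<epsilon> / 2"
    using \<psi>(1)[of n] half_gt_zero[OF \<epsilon>] unfolding H10_def by blast
  let ?D = "\<lambda>b x. frechet_derivative \<phi> (at x) b"
  have G: "weak_gradient U \<phi> ?D" by (rule weak_gradient_test_function[OF \<phi>(1) Um])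
  have sq2: "(H1_norm U (\<lambda>x. \<psi> n x - \<phi> x))\<^sup>2 = (L2_norm U (\<lambda>x. \<psi> n x - \<phi> x))\<^sup>2
      + (\<Sum>b\<in>Basis. (L2_norm U (\<lambda>x. \<Psi> n b x - ?D b x))\<^sup>2)"
    by (rule H1_norm_square[OF U weak_gradient_diff[OF Um \<psi>(2) G]])
  have sq3: "(H1_norm U (\<lambda>x. f x - \<phi> x))\<^sup>2 = (L2_norm U (\<lambda>x. f x - \<phi> x))\<^sup>2
      + (\<Sum>b\<in>Basis. (L2_norm U (\<lambda>x. F b x - ?D b x))\<^sup>2)"
    by (rule H1_norm_square[OF U weak_gradient_diff[OF Um F G]])
  have H1_nonneg: "0 \<le> H1_norm U (\<lambda>x. \<psi> n x - \<phi> x)"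
    by (rule H1_norm_nonneg[OF U weak_gradient_diff[OF Um \<psi>(2) G]])
  have tri: "(L2_norm U (\<lambda>x. a x - c x))\<^sup>2 \<le> 2 * (L2_norm U (\<lambda>x. a x - b x))\<^sup>2 + 2 * (L2_norm U (\<lambda>x. b x - c x))\<^sup>2"
    if "a \<in> L2 U" "b \<in> L2 U" "c \<in> L2 U" for a b c
    using L2_norm_add_square_le[OF L2_diff[OF that(1,2)] L2_diff[OF that(2,3)]] by simp
  have "(H1_norm U (\<lambda>x. f x - \<phi> x))\<^sup>2 \<le> 2 * (H1_norm U (\<lambda>x. f x - \<psi> n x))\<^sup>2 + 2 * (H1_norm U (\<lambda>x. \<psi> n x - \<phi> x))\<^sup>2"
  proof -
    have "(\<Sum>b\<in>Basis. (L2_norm U (\<lambda>x. F b x - ?D b x))\<^sup>2)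
        \<le> (\<Sum>b\<in>Basis. 2 * (L2_norm U (\<lambda>x. F b x - \<Psi> n b x))\<^sup>2 + 2 * (L2_norm U (\<lambda>x. \<Psi> n b x - ?D b x))\<^sup>2)"
      by (intro sum_mono tri weak_gradientD(2)[OF F] weak_gradientD(2)[OF G] weak_gradientD(2)[OF \<psi>(2)])
    moreover have "(L2_norm U (\<lambda>x. f x - \<phi> x))\<^sup>2
        \<le> 2 * (L2_norm U (\<lambda>x. f x - \<psi> n x))\<^sup>2 + 2 * (L2_norm U (\<lambda>x. \<psi> n x - \<phi> x))\<^sup>2"
      by (intro tri weak_gradientD(1)[OF F] weak_gradientD(1)[OF G] weak_gradientD(1)[OF \<psi>(2)])
    ultimately show ?thesis
      unfolding sq sq2 sq3 by (simp add: sum.distrib sum_distrib_left[symmetric])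
  qed
  also have "\<dots> < 2 * (\<epsilon> / 2)\<^sup>2 + 2 * (\<epsilon> / 2)\<^sup>2"
    using n power_strict_mono[OF \<phi>(2) H1_nonneg, of 2] by simp
  also have "\<dots> = \<epsilon>\<^sup>2" by (simp add: power2_eq_square)
  finally have "H1_norm U (\<lambda>x. f x - \<phi> x) < \<epsilon>"
    using \<epsilon> by (simp add: power_less_imp_less_base)
  then show "\<exists>\<phi>\<in>test_functions U. H1_norm U (\<lambda>x. f x - \<phi> x) < \<epsilon>" using \<phi>(1) by blast
qed

lemma test_functions_H10:
  assumes U: "open U" and \<phi>: "\<phi> \<in> test_functions U"
  shows "\<phi> \<in> H10 U"
proof -
  have Um: "U \<in> sets lebesgue" using U by simp
  have G: "weak_gradient U \<phi> (\<lambda>b x. frechet_derivative \<phi> (at x) b)"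
    by (rule weak_gradient_test_function[OF \<phi> Um])
  have "(H1_norm U (\<lambda>x. \<phi> x - \<phi> x))\<^sup>2 = 0"
    using H1_norm_square[OF U weak_gradient_diff[OF Um G G]] by (simp add: L2_norm_square)
  then have "H1_norm U (\<lambda>x. \<phi> x - \<phi> x) = 0" by simp
  then have "\<forall>\<epsilon>>0. \<exists>\<eta>\<in>test_functions U. H1_norm U (\<lambda>x. \<phi> x - \<eta> x) < \<epsilon>"
    using \<phi> by (intro allI impI bexI[of _ \<phi>]) simp_all
  then show ?thesis using weak_gradient_H1[OF G] by (simp add: H10_def)
qed

section \<open>Reflection in a hyperplane\<close>

lemma reflection_linear: "linear (hyperplane_reflection v)"
  unfolding hyperplane_reflection_def[abs_def]
  by (rule linearI) (simp_all add: inner_add_right algebra_simps add_divide_distrib)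

lemma reflection_involution: "hyperplane_reflection v (hyperplane_reflection v x) = x"
proof (cases "v = 0")
  case False
  define r where "r = 2 * (v \<bullet> x) / (norm v)\<^sup>2"
  have "2 * (v \<bullet> (x - r *\<^sub>R v)) / (norm v)\<^sup>2 = - r"
    using False by (simp add: r_def inner_diff_right dot_square_norm field_simps)
  then show ?thesis
    unfolding hyperplane_reflection_def r_def[symmetric] by simp
qed (simp add: hyperplane_reflection_def)

lemma reflection_symmetric: "hyperplane_reflection v x \<bullet> y = x \<bullet> hyperplane_reflection v y"
  by (simp add: hyperplane_reflection_def inner_diff_left inner_diff_right inner_commute)

lemma reflection_inner: "hyperplane_reflection v x \<bullet> hyperplane_reflection v y = x \<bullet> y"
  by (simp add: reflection_symmetric reflection_involution)

lemma reflection_norm: "norm (hyperplane_reflection v x) = norm x"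
  by (simp add: norm_eq_sqrt_inner reflection_inner)

lemma reflection_dist: "dist (hyperplane_reflection v x) (hyperplane_reflection v y) = dist x y"
  by (metis dist_norm linear_diff reflection_linear reflection_norm)

lemma reflection_bounded_linear:
  "bounded_linear (hyperplane_reflection v :: 'a::euclidean_space \<Rightarrow> 'a)"
  by (rule linear_conv_bounded_linear[THEN iffD1, OF reflection_linear])

lemma reflection_vimage: "hyperplane_reflection v -` A = hyperplane_reflection v ` A"
  by (metis (no_types, lifting) image_eqI reflection_involution set_eq_iff vimage_eq imageE)

lemma reflection_ball: "hyperplane_reflection v ` ball x r = ball (hyperplane_reflection v x) r"
proof -
  have "y \<in> hyperplane_reflection v ` ball x r \<longleftrightarrow> y \<in> ball (hyperplane_reflection v x) r" for y
    using reflection_dist[of v x "hyperplane_reflection v y"]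
    by (auto simp flip: reflection_vimage simp: reflection_involution)
  then show ?thesis by blast
qed

lemma reflection_measurable: "hyperplane_reflection v \<in> borel_measurable borel" for v :: "'a::euclidean_space"
  by (intro borel_measurable_continuous_onI bounded_linear.continuous_on[OF reflection_bounded_linear] continuous_on_id)

lemma reflection_negligible:
  fixes v :: "'a::euclidean_space"
  assumes "negligible N"
  shows "negligible (hyperplane_reflection v ` N)"
proof (rule negligible_locally_Lipschitz_image[OF _ assms])
  show "\<exists>T B. open T \<and> x \<in> T \<and> (\<forall>y\<in>N \<inter> T. norm (hyperplane_reflection v y - hyperplane_reflection v x) \<le> B * norm (y - x))"
    if "x \<in> N" for x
    using reflection_dist[of v] by (intro exI[of _ UNIV] exI[of _ 1]) (simp add: dist_norm)
qed simp

text \<open>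
  An open set is, up to a null set, a countable disjoint union of balls, and a reflection maps a ball
  to a ball of the same radius.
\<close>

lemma lborel_reflection_open:
  fixes v :: "'a::euclidean_space"
  assumes B: "open B"
  shows "emeasure lborel (hyperplane_reflection v ` B) = emeasure lborel B"
proof -
  let ?\<sigma> = "hyperplane_reflection v"
  let ?K = "{(x, r). 0 < r \<and> ball x r \<subseteq> B}"
  obtain C where C: "countable C" "C \<subseteq> ?K"
    "pairwise (\<lambda>i j. disjnt (ball (fst i) (snd i)) (ball (fst j) (snd j))) C"
    "negligible (B - (\<Union>i\<in>C. ball (fst i) (snd i)))"
  proof (rule Vitali_covering_theorem_balls[of B ?K fst snd])
    fix x d :: 'a and e :: real
    assume x: "x \<in> B" and e: "0 < e"
    obtain r where r: "0 < r" "ball x r \<subseteq> B" using B x openE by blast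
    define q where "q = min r (e / 2)"
    have "ball x q \<subseteq> B" using r(2) by (auto simp: q_def)
    then show "\<exists>i. i \<in> ?K \<and> x \<in> ball (fst i) (snd i) \<and> snd i < e"
      using r e by (intro exI[of _ "(x, q)"]) (auto simp: q_def min_def)
  qed blast
  have sub: "(\<Union>i\<in>C. ball (fst i) (snd i)) \<subseteq> B"
  proof (rule UN_least)
    fix i assume "i \<in> C"
    then have "i \<in> ?K" using C(2) by blast
    then show "ball (fst i) (snd i) \<subseteq> B" by auto
  qed
  have dis: "disjoint_family_on (\<lambda>i. ball (fst i) (snd i)) C"
    using C(3) by (auto simp: disjoint_family_on_def pairwise_def disjnt_def)
  have dis': "disjoint_family_on (\<lambda>i. ball (?\<sigma> (fst i)) (snd i)) C"
    unfolding disjoint_family_on_def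
  proof (intro ballI impI)
    fix i j assume "i \<in> C" "j \<in> C" "i \<noteq> j"
    then have "ball (fst i) (snd i) \<inter> ball (fst j) (snd j) = {}" using dis by (auto simp: disjoint_family_on_def)
    then have "?\<sigma> -` ball (fst i) (snd i) \<inter> ?\<sigma> -` ball (fst j) (snd j) = {}" by blast
    then show "ball (?\<sigma> (fst i)) (snd i) \<inter> ball (?\<sigma> (fst j)) (snd j) = {}"
      by (simp only: reflection_vimage reflection_ball)
  qed
  have eq: "emeasure lborel S = emeasure lborel T"
    if "T \<subseteq> S" "negligible (S - T)" "open S" "open T" for S T :: "'a set"
  proof -
    have "S - T \<in> null_sets lborel"
      using that(2-4) by (simp add: negligible_iff_null_sets null_sets_completion_iff)
    then have "emeasure lborel (T \<union> (S - T)) = emeasure lborel T"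
      using that(4) by (intro emeasure_Un_null_set) auto
    then show ?thesis using that(1) by (simp add: Un_absorb1)
  qed
  have openB: "open (?\<sigma> ` B)"
    using open_vimage[OF B bounded_linear.continuous_on[OF reflection_bounded_linear[of v] continuous_on_id]]
    by (simp add: reflection_vimage)
  have "emeasure lborel (?\<sigma> ` B) = emeasure lborel (\<Union>i\<in>C. ball (?\<sigma> (fst i)) (snd i))"
  proof (rule eq[OF _ _ openB])
    show "(\<Union>i\<in>C. ball (?\<sigma> (fst i)) (snd i)) \<subseteq> ?\<sigma> ` B"
      unfolding reflection_ball[symmetric] using sub by blast
    have "?\<sigma> ` B - (\<Union>i\<in>C. ball (?\<sigma> (fst i)) (snd i)) \<subseteq> ?\<sigma> ` (B - (\<Union>i\<in>C. ball (fst i) (snd i)))"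
      unfolding reflection_ball[symmetric] by blast
    then show "negligible (?\<sigma> ` B - (\<Union>i\<in>C. ball (?\<sigma> (fst i)) (snd i)))"
      using reflection_negligible[OF C(4)] negligible_subset by blast
  qed auto
  also have "\<dots> = (\<integral>\<^sup>+i. emeasure lborel (ball (?\<sigma> (fst i)) (snd i)) \<partial>count_space C)"
    by (rule emeasure_UN_countable[OF _ C(1) dis']) auto
  also have "\<dots> = (\<integral>\<^sup>+i. emeasure lborel (ball (fst i) (snd i)) \<partial>count_space C)"
    using C(2) by (intro nn_integral_cong) (auto simp: emeasure_ball less_imp_le)
  also have "\<dots> = emeasure lborel (\<Union>i\<in>C. ball (fst i) (snd i))"
    by (rule emeasure_UN_countable[OF _ C(1) dis, symmetric]) auto
  also have "\<dots> = emeasure lborel B"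
    by (rule eq[symmetric, OF sub C(4) B]) auto
  finally show ?thesis .
qed

lemma lborel_reflection:
  "distr lborel borel (hyperplane_reflection v) = lborel" for v :: "'a::euclidean_space"
proof (rule lborel_eqI[symmetric])
  fix l u :: 'a assume lu: "\<And>b. b \<in> Basis \<Longrightarrow> l \<bullet> b \<le> u \<bullet> b"
  have "emeasure (distr lborel borel (hyperplane_reflection v)) (box l u)
      = emeasure lborel (hyperplane_reflection v ` box l u)"
    using reflection_measurable[of v] by (simp add: emeasure_distr reflection_vimage)
  also have "\<dots> = emeasure lborel (box l u)"
    by (intro lborel_reflection_open open_box)
  also have "\<dots> = (\<Prod>b\<in>Basis. (u - l) \<bullet> b)" using lu by simp
  finally show "emeasure (distr lborel borel (hyperplane_reflection v)) (box l u) = (\<Prod>b\<in>Basis. (u - l) \<bullet> b)" .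
qed simp

lemma reflection_lebesgue:
  fixes v :: "'a::euclidean_space"
  assumes A: "A \<in> sets lebesgue"
  shows "hyperplane_reflection v ` A \<in> sets lebesgue"
    and "emeasure lebesgue (hyperplane_reflection v ` A) = emeasure lebesgue A"
proof -
  let ?\<sigma> = "hyperplane_reflection v"
  have borel: "?\<sigma> ` S \<in> sets borel" "emeasure lborel (?\<sigma> ` S) = emeasure lborel S" if "S \<in> sets borel" for S
  proof -
    show "?\<sigma> ` S \<in> sets borel"
      using measurable_sets[OF reflection_measurable that, of v] by (simp add: reflection_vimage)
    have "emeasure lborel S = emeasure (distr lborel borel ?\<sigma>) S" by (simp add: lborel_reflection)
    also have "\<dots> = emeasure lborel (?\<sigma> ` S)"
      using that reflection_measurable[of v] by (simp add: emeasure_distr reflection_vimage)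
    finally show "emeasure lborel (?\<sigma> ` S) = emeasure lborel S" by simp
  qed
  obtain S N N' where S: "A = S \<union> N" "N \<subseteq> N'" "N' \<in> null_sets lborel" "S \<in> sets lborel"
    using A by (rule sets_completionE)
  have N': "?\<sigma> ` N' \<in> null_sets lborel"
    using S(3) borel[of N'] by (auto simp: null_sets_def)
  have N'': "N' \<in> null_sets lebesgue" "?\<sigma> ` N' \<in> null_sets lebesgue"
    using S(3) N' by (auto intro: null_sets_completionI)
  have N: "N \<in> null_sets lebesgue" "?\<sigma> ` N \<in> null_sets lebesgue"
    by (rule null_sets_completion_subset[OF S(2) N''(1)])
       (rule null_sets_completion_subset[OF image_mono[OF S(2)] N''(2)])
  have S': "S \<in> sets lebesgue" "?\<sigma> ` S \<in> sets lebesgue"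
    using S(4) borel(1)[of S] by auto
  show "?\<sigma> ` A \<in> sets lebesgue" unfolding S(1) image_Un using S' N by auto
  have "emeasure lebesgue (?\<sigma> ` A) = emeasure lebesgue (?\<sigma> ` S)"
    unfolding S(1) image_Un using S' N by (intro emeasure_Un_null_set)
  also have "\<dots> = emeasure lebesgue S" using S(4) borel[of S] by simp
  also have "\<dots> = emeasure lebesgue A"
    unfolding S(1) using S' N by (intro emeasure_Un_null_set[symmetric])
  finally show "emeasure lebesgue (?\<sigma> ` A) = emeasure lebesgue A" .
qed

lemma reflection_measurable_on:
  fixes v :: "'a::euclidean_space"
  assumes U: "U \<in> sets lebesgue"
  shows "hyperplane_reflection v \<in> lebesgue_on U \<rightarrow>\<^sub>M lebesgue_on (hyperplane_reflection v ` U)"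
proof (rule measurableI)
  fix A assume A: "A \<in> sets (lebesgue_on (hyperplane_reflection v ` U))"
  then have "A \<in> sets lebesgue"
    using reflection_lebesgue(1)[OF U] by (simp add: sets_restrict_space_iff)
  then show "hyperplane_reflection v -` A \<inter> space (lebesgue_on U) \<in> sets (lebesgue_on U)"
    using U reflection_lebesgue(1)[of A v] by (simp add: sets_restrict_space_iff reflection_vimage sets.Int)
qed simp

lemma lebesgue_on_reflection:
  fixes v :: "'a::euclidean_space"
  assumes U: "U \<in> sets lebesgue"
  shows "lebesgue_on (hyperplane_reflection v ` U)
    = distr (lebesgue_on U) (lebesgue_on (hyperplane_reflection v ` U)) (hyperplane_reflection v)"
    (is "?M = distr ?N ?M ?\<sigma>")
proof (rule measure_eqI)
  fix A assume A: "A \<in> sets ?M"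
  have A': "A \<in> sets lebesgue" "A \<subseteq> ?\<sigma> ` U"
    using A reflection_lebesgue(1)[OF U] by (auto simp: sets_restrict_space_iff)
  have sub: "?\<sigma> -` A \<subseteq> U"
  proof
    fix x assume "x \<in> ?\<sigma> -` A"
    then obtain y where y: "y \<in> U" "?\<sigma> x = ?\<sigma> y" using A'(2) by auto
    have "x = y" using arg_cong[OF y(2), of ?\<sigma>] by (simp only: reflection_involution)
    then show "x \<in> U" using y(1) by simp
  qed
  have "emeasure (distr ?N ?M ?\<sigma>) A = emeasure ?N (?\<sigma> -` A \<inter> space ?N)"
    by (rule emeasure_distr[OF reflection_measurable_on[OF U] A])
  also have "\<dots> = emeasure ?N (?\<sigma> ` A)"
    using sub by (simp add: Int_absorb2 reflection_vimage)
  also have "\<dots> = emeasure lebesgue (?\<sigma> ` A)"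
    using sub U by (intro emeasure_restrict_space) (auto simp: reflection_vimage)
  also have "\<dots> = emeasure ?M A"
    using A' reflection_lebesgue(1)[OF U] reflection_lebesgue(2)[OF A'(1)]
    by (subst emeasure_restrict_space) auto
  finally show "emeasure ?M A = emeasure (distr ?N ?M ?\<sigma>) A" by simp
qed simp

lemma reflection_integral:
  fixes v :: "'a::euclidean_space" and f :: "'a \<Rightarrow> 'b::{banach, second_countable_topology}"
  assumes U: "U \<in> sets lebesgue" and f: "f \<in> borel_measurable (lebesgue_on (hyperplane_reflection v ` U))"
  shows "(\<lambda>x. f (hyperplane_reflection v x)) \<in> borel_measurable (lebesgue_on U)"
    and "integrable (lebesgue_on U) (\<lambda>x. f (hyperplane_reflection v x))
          \<longleftrightarrow> integrable (lebesgue_on (hyperplane_reflection v ` U)) f"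
    and "(LINT x|lebesgue_on U. f (hyperplane_reflection v x))
          = (LINT x|lebesgue_on (hyperplane_reflection v ` U). f x)"
proof -
  note m = reflection_measurable_on[OF U, of v]
  show "(\<lambda>x. f (hyperplane_reflection v x)) \<in> borel_measurable (lebesgue_on U)"
    by (rule measurable_compose[OF m f])
  show "integrable (lebesgue_on U) (\<lambda>x. f (hyperplane_reflection v x))
          \<longleftrightarrow> integrable (lebesgue_on (hyperplane_reflection v ` U)) f"
    by (subst lebesgue_on_reflection[OF U]) (rule integrable_distr_eq[OF m f, symmetric])
  show "(LINT x|lebesgue_on U. f (hyperplane_reflection v x))
          = (LINT x|lebesgue_on (hyperplane_reflection v ` U). f x)"
    by (subst lebesgue_on_reflection[OF U]) (rule integral_distr[OF m f, symmetric])
qed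

lemma reflection_AE:
  fixes v :: "'a::euclidean_space"
  assumes U: "U \<in> sets lebesgue" and ae: "AE x in lebesgue_on (hyperplane_reflection v ` U). P x"
  shows "AE x in lebesgue_on U. P (hyperplane_reflection v x)"
  using ae unfolding lebesgue_on_reflection[OF U, of v, THEN arg_cong[where f = ae_filter]]
  by (rule AE_distrD[OF reflection_measurable_on[OF U]])

lemma reflection_L2:
  fixes v :: "'a::euclidean_space"
  assumes U: "U \<in> sets lebesgue" and f: "f \<in> L2 (hyperplane_reflection v ` U)"
  shows "(\<lambda>x. f (hyperplane_reflection v x)) \<in> L2 U"
  using reflection_integral(1)[OF U L2_measurable[OF f]]
    reflection_integral(2)[OF U borel_measurable_integrable[OF L2_integrable_square[OF f]]]
    L2_integrable_square[OF f]
  by (simp add: L2_def)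

lemma test_functions_reflection:
  fixes v :: "'a::euclidean_space" and \<phi> :: "'a \<Rightarrow> complex"
  assumes \<phi>: "\<phi> \<in> test_functions U"
  shows "(\<lambda>x. \<phi> (hyperplane_reflection v x)) \<in> test_functions (hyperplane_reflection v ` U)"
proof -
  obtain K where K: "compact K" "K \<subseteq> U" "\<And>x. x \<notin> K \<Longrightarrow> \<phi> x = 0"
    by (rule test_functionsE[OF \<phi>]) blast
  show ?thesis
  proof (rule test_functionsI[of _ "hyperplane_reflection v ` K"])
    show "smooth_on UNIV (\<lambda>x. \<phi> (hyperplane_reflection v x))"
      using smooth_affine[OF reflection_bounded_linear test_functions_smooth[OF \<phi>], of v 0] by simp
    show "compact (hyperplane_reflection v ` K)"
      by (intro compact_continuous_image K bounded_linear.continuous_on[OF reflection_bounded_linear] continuous_on_id)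
    show "\<phi> (hyperplane_reflection v x) = 0" if "x \<notin> hyperplane_reflection v ` K" for x
      using K(3)[of "hyperplane_reflection v x"] that by (simp flip: reflection_vimage)
  qed (use K(2) in blast)
qed

lemma derivative_reflection:
  fixes v :: "'a::euclidean_space" and \<phi> :: "'a \<Rightarrow> complex"
  assumes "smooth_on UNIV \<phi>"
  shows "frechet_derivative (\<lambda>x. \<phi> (hyperplane_reflection v x)) (at x) w
      = frechet_derivative \<phi> (at (hyperplane_reflection v x)) (hyperplane_reflection v w)"
  by (rule frechet_derivative_eq[OF has_derivative_compose[OF
        bounded_linear_imp_has_derivative[OF reflection_bounded_linear] smooth_has_derivative[OF assms]]])

text \<open>
  By the chain rule this is the gradient of \<open>f \<circ> \<sigma>\<close> when \<open>G\<close> is the gradient of \<open>f\<close>.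
\<close>

definition reflected_gradient ::
    "'a::euclidean_space \<Rightarrow> ('a \<Rightarrow> 'a \<Rightarrow> complex) \<Rightarrow> 'a \<Rightarrow> 'a \<Rightarrow> complex" where
  "reflected_gradient v G b x = along (hyperplane_reflection v b) G (hyperplane_reflection v x)"

lemma weak_gradient_reflection:
  fixes v :: "'a::euclidean_space"
  assumes U: "U \<in> sets lebesgue" and G: "weak_gradient (hyperplane_reflection v ` U) f G"
  shows "weak_gradient U (\<lambda>x. f (hyperplane_reflection v x)) (reflected_gradient v G)"
  unfolding weak_gradient_def
proof (intro conjI ballI)
  let ?\<sigma> = "hyperplane_reflection v"
  let ?V = "?\<sigma> ` U"
  have V: "?V \<in> sets lebesgue" by (rule reflection_lebesgue[OF U])
  show "(\<lambda>x. f (?\<sigma> x)) \<in> L2 U" by (rule reflection_L2[OF U weak_gradientD(1)[OF G]])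
  fix b :: 'a assume b: "b \<in> Basis"
  have along: "along (?\<sigma> b) G \<in> L2 ?V" by (intro along_L2 weak_gradientD(2)[OF G])
  show "reflected_gradient v G b \<in> L2 U"
    unfolding reflected_gradient_def[abs_def] by (rule reflection_L2[OF U along])
  show "is_weak_deriv U b (\<lambda>x. f (?\<sigma> x)) (reflected_gradient v G b)"
    unfolding is_weak_deriv_def
  proof
    fix \<phi> :: "'a \<Rightarrow> complex" assume \<phi>: "\<phi> \<in> test_functions U"
    let ?\<phi> = "\<lambda>x. \<phi> (?\<sigma> x)"
    have \<phi>': "?\<phi> \<in> test_functions ?V" by (rule test_functions_reflection[OF \<phi>])
    have D: "frechet_derivative ?\<phi> (at (?\<sigma> x)) (?\<sigma> b) = frechet_derivative \<phi> (at x) b" for x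
      by (simp add: derivative_reflection[OF test_functions_smooth[OF \<phi>]] reflection_involution)
    have "(LINT x|lebesgue_on U. f (?\<sigma> x) * frechet_derivative \<phi> (at x) b)
        = (LINT x|lebesgue_on ?V. f x * frechet_derivative ?\<phi> (at x) (?\<sigma> b))"
      unfolding D[symmetric]
      by (rule reflection_integral(3)[OF U, of "\<lambda>x. f x * frechet_derivative ?\<phi> (at x) (?\<sigma> b)"])
         (intro borel_measurable_times L2_measurable weak_gradientD(1)[OF G]
           test_functions_measurable[OF test_functions_derivative[OF \<phi>']])
    also have "\<dots> = - (LINT x|lebesgue_on ?V. along (?\<sigma> b) G x * ?\<phi> x)"
      using weak_deriv_along[OF V G, of "?\<sigma> b"] \<phi>' by (simp add: is_weak_deriv_def)
    also have "(LINT x|lebesgue_on ?V. along (?\<sigma> b) G x * ?\<phi> x)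
        = (LINT x|lebesgue_on U. reflected_gradient v G b x * \<phi> x)"
      using reflection_integral(3)[OF U, of "\<lambda>x. along (?\<sigma> b) G x * ?\<phi> x" v]
        along test_functions_measurable[OF \<phi>']
      by (simp add: reflected_gradient_def reflection_involution borel_measurable_times L2_measurable)
    finally show "(LINT x|lebesgue_on U. f (?\<sigma> x) * frechet_derivative \<phi> (at x) b)
        = - (LINT x|lebesgue_on U. reflected_gradient v G b x * \<phi> x)" .
  qed
qed

text \<open>
  The matrix of the reflection is symmetric.
\<close>

lemma sum_reflection_swap:
  fixes v :: "'a::euclidean_space"
  shows "(\<Sum>b\<in>Basis. along (hyperplane_reflection v b) H y * cnj (G b x))
       = (\<Sum>b\<in>Basis. H b y * cnj (along (hyperplane_reflection v b) G x))"
proof -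
  have "(\<Sum>b\<in>Basis. along (hyperplane_reflection v b) H y * cnj (G b x))
      = (\<Sum>b\<in>Basis. \<Sum>c\<in>Basis. of_real (hyperplane_reflection v b \<bullet> c) * H c y * cnj (G b x))"
    by (simp add: along_def sum_distrib_right)
  also have "\<dots> = (\<Sum>c\<in>Basis. \<Sum>b\<in>Basis. of_real (hyperplane_reflection v b \<bullet> c) * H c y * cnj (G b x))"
    by (rule sum.swap)
  also have "\<dots> = (\<Sum>c\<in>Basis. H c y * cnj (along (hyperplane_reflection v c) G x))"
    unfolding along_def cnj_sum sum_distrib_left
  proof (intro sum.cong refl)
    fix b c :: 'a
    have "hyperplane_reflection v b \<bullet> c = hyperplane_reflection v c \<bullet> b"
      unfolding reflection_symmetric[of v b c] by (rule inner_commute)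
    then show "of_real (hyperplane_reflection v b \<bullet> c) * H c y * cnj (G b x)
        = H c y * cnj (of_real (hyperplane_reflection v c \<bullet> b) * G b x)"
      by simp
  qed
  finally show ?thesis .
qed

lemma L2_lim_reflection:
  fixes v :: "'a::euclidean_space"
  assumes U: "U \<in> sets lebesgue" and X: "L2_lim (hyperplane_reflection v ` U) X f"
  shows "L2_lim U (\<lambda>n x. X n (hyperplane_reflection v x)) (\<lambda>x. f (hyperplane_reflection v x))"
proof (rule L2_lim_bounded_map[OF X])
  fix n
  have d: "(\<lambda>x. f x - X n x) \<in> L2 (hyperplane_reflection v ` U)"
    using X by (intro L2_diff) (auto simp: L2_lim_def)
  show "(L2_norm U (\<lambda>x. f (hyperplane_reflection v x) - X n (hyperplane_reflection v x)))\<^sup>2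
      \<le> (L2_norm (hyperplane_reflection v ` U) (\<lambda>x. f x - X n x))\<^sup>2"
    unfolding L2_norm_square
    using reflection_integral(3)[OF U borel_measurable_integrable[OF L2_integrable_square[OF d]]] by simp
qed (rule reflection_L2[OF U])

section \<open>Cutting off at the hyperplane\<close>

text \<open>
  This vanishes for \<open>x \<bullet> v \<le> 1 / n\<close> and tends to one on the open half-space. Its gradient is of order \<open>n\<close>
  near the hyperplane, but the product with \<open>x \<bullet> v\<close> is bounded and tends to zero.
\<close>

definition cutoff :: "'a::euclidean_space \<Rightarrow> nat \<Rightarrow> 'a \<Rightarrow> complex" where
  "cutoff v n x = complex_of_real (flat_exp 0 (real n * (x \<bullet> v) - 1))"

lemma cutoff_smooth: "smooth_on UNIV (cutoff v n)"
proof -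
  have lin: "bounded_linear (\<lambda>x. real n * (x \<bullet> v))"
    by (intro bounded_linear_const_mult bounded_linear_inner_left)
  show ?thesis
    using smooth_bounded_linear[OF bounded_linear_of_real smooth_affine[OF lin smooth_flat_exp, of 0 "-1"]]
    by (simp add: cutoff_def[abs_def])
qed

lemma cutoff_derivative:
  "frechet_derivative (cutoff v n) (at x) w
    = complex_of_real (real n * (w \<bullet> v) * flat_exp 2 (real n * (x \<bullet> v) - 1))"
proof (rule frechet_derivative_eq)
  have A: "((\<lambda>x. real n * (x \<bullet> v) - 1) has_derivative (\<lambda>w. real n * (w \<bullet> v))) (at x)"
    by (auto intro!: derivative_eq_intros)
  have B: "(flat_exp 0 has_derivative (\<lambda>h. flat_exp 2 y * h)) (at y)" for y
    using has_field_derivative_imp_has_derivative[OF flat_exp_has_derivative[of 0 y]]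
    by (simp add: numeral_2_eq_2)
  have "(cutoff v n has_derivative (\<lambda>w. complex_of_real (flat_exp 2 (real n * (x \<bullet> v) - 1) * (real n * (w \<bullet> v))))) (at x)"
    unfolding cutoff_def[abs_def]
    by (rule bounded_linear.has_derivative[OF bounded_linear_of_real has_derivative_compose[OF A B]])
  then show "(cutoff v n has_derivative (\<lambda>w. complex_of_real (real n * (w \<bullet> v) * flat_exp 2 (real n * (x \<bullet> v) - 1)))) (at x)"
    by (simp add: mult_ac)
qed

text \<open>
  For \<open>y = n (x \<bullet> v) - 1\<close> the left-hand side is \<open>x \<bullet> v\<close> times the slope of the cutoff; the bound \<open>3 = 1! + 2!\<close>
  and the limit below are read off from the right-hand side.
\<close>

lemma flat_exp_shift: "(y + 1) * flat_exp 2 y = flat_exp 1 y + flat_exp 2 y"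
  by (simp add: flat_exp_def field_simps power2_eq_square)

lemma cutoff_slope_le: "(real n * (x \<bullet> v)) * flat_exp 2 (real n * (x \<bullet> v) - 1) \<le> 3"
  using flat_exp_shift[of "real n * (x \<bullet> v) - 1"]
    flat_exp_le[of 1 "real n * (x \<bullet> v) - 1"] flat_exp_le[of 2 "real n * (x \<bullet> v) - 1"]
  by (simp add: fact_numeral)

lemma cutoff_slope_tendsto:
  assumes "x \<bullet> v > 0"
  shows "(\<lambda>n. (real n * (x \<bullet> v)) * flat_exp 2 (real n * (x \<bullet> v) - 1)) \<longlonglongrightarrow> 0"
proof -
  have lim: "(\<lambda>n. flat_exp (Suc m) (real n * (x \<bullet> v) - 1)) \<longlonglongrightarrow> 0" for m
    by (rule filterlim_compose[OF flat_exp_Suc_tendsto filterlim_linear_at_top[OF assms]])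
  have "(\<lambda>n. flat_exp 1 (real n * (x \<bullet> v) - 1) + flat_exp 2 (real n * (x \<bullet> v) - 1)) \<longlonglongrightarrow> 0"
    using lim[of 0] lim[of 1] by (intro tendsto_add_zero) (simp_all add: numeral_2_eq_2)
  moreover have "(real n * (x \<bullet> v)) * flat_exp 2 (real n * (x \<bullet> v) - 1)
      = flat_exp 1 (real n * (x \<bullet> v) - 1) + flat_exp 2 (real n * (x \<bullet> v) - 1)" for n
    using flat_exp_shift[of "real n * (x \<bullet> v) - 1"] by simp
  ultimately show ?thesis by (simp only:)
qed

section \<open>Symmetric domains\<close>

locale symmetric_domain =
  fixes v :: "'a::euclidean_space" and \<Omega> :: "'a set"
  assumes v: "v \<noteq> 0" and open_domain: "open \<Omega>" and symmetric: "hyperplane_reflection v ` \<Omega> = \<Omega>"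
begin

abbreviation "\<sigma> \<equiv> hyperplane_reflection v"

definition upper :: "'a set" where "upper = {x \<in> \<Omega>. x \<bullet> v > 0}"

definition lower :: "'a set" where "lower = {x \<in> \<Omega>. x \<bullet> v < 0}"

lemma reflection_inner_normal: "\<sigma> x \<bullet> v = - (x \<bullet> v)"
  using v by (simp add: hyperplane_reflection_def inner_diff_left inner_diff_right dot_square_norm inner_commute)

lemma reflection_on_hyperplane: "x \<bullet> v = 0 \<Longrightarrow> \<sigma> x = x"
  by (simp add: hyperplane_reflection_def inner_commute)

lemma reflection_mem: "\<sigma> x \<in> \<Omega> \<longleftrightarrow> x \<in> \<Omega>"
  using symmetric reflection_vimage[of v \<Omega>] by blast

lemma reflection_upper: "\<sigma> ` upper = lower"
proof -
  have "\<sigma> -` upper = lower" by (auto simp: upper_def lower_def reflection_inner_normal reflection_mem)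
  then show ?thesis by (simp add: reflection_vimage)
qed

lemma reflection_lower: "\<sigma> ` lower = upper"
proof -
  have "\<sigma> -` lower = upper" by (auto simp: upper_def lower_def reflection_inner_normal reflection_mem)
  then show ?thesis by (simp add: reflection_vimage)
qed

lemma upper_subset: "upper \<subseteq> \<Omega>" and lower_subset: "lower \<subseteq> \<Omega>"
  by (auto simp: upper_def lower_def)

lemma upper_open: "open upper" and lower_open: "open lower"
proof -
  have "upper = \<Omega> \<inter> {x. 0 < x \<bullet> v}" "lower = \<Omega> \<inter> {x. x \<bullet> v < 0}" by (auto simp: upper_def lower_def)
  then show "open upper" "open lower"
    using open_domain by (auto intro!: open_Int open_Collect_less continuous_intros)
qed

lemma measurable_domains [simp]:
  "\<Omega> \<in> sets lebesgue" "upper \<in> sets lebesgue" "lower \<in> sets lebesgue"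
  using open_domain upper_open lower_open by simp_all

text \<open>
  Up to a null set, \<open>\<Omega>\<close> is the disjoint union of its upper part and the mirror image of that part.
\<close>

lemma integral_fold:
  fixes f :: "'a \<Rightarrow> complex"
  assumes f: "integrable (lebesgue_on \<Omega>) f"
  shows "integrable (lebesgue_on upper) f" "integrable (lebesgue_on upper) (\<lambda>x. f (\<sigma> x))"
    and "(LINT x|lebesgue_on \<Omega>. f x) = (LINT x|lebesgue_on upper. f x + f (\<sigma> x))"
proof -
  have s: "\<Omega> \<inter> space lebesgue \<in> sets lebesgue" "upper \<inter> space lebesgue \<in> sets lebesgue"
    "lower \<inter> space lebesgue \<in> sets lebesgue"
    by simp_all
  have f0: "integrable lebesgue (\<lambda>x. indicator \<Omega> x *\<^sub>R f x)"
    using f by (simp only: integrable_restrict_space[OF s(1)])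
  have part: "integrable lebesgue (\<lambda>x. indicator V x *\<^sub>R f x)" if "V \<subseteq> \<Omega>" "V \<in> sets lebesgue" for V
    by (rule Bochner_Integration.integrable_cong[THEN iffD1, OF refl _ integrable_mult_indicator[OF that(2) f0]])
       (use that(1) in \<open>auto simp: indicator_def\<close>)
  have up: "integrable lebesgue (\<lambda>x. indicator upper x *\<^sub>R f x)"
    and lo: "integrable lebesgue (\<lambda>x. indicator lower x *\<^sub>R f x)"
    by (rule part[OF upper_subset] part[OF lower_subset]; simp)+
  show int_up: "integrable (lebesgue_on upper) f"
    using up by (simp only: integrable_restrict_space[OF s(2)])
  have int_lo: "integrable (lebesgue_on lower) f"
    using lo by (simp only: integrable_restrict_space[OF s(3)])
  have fm: "f \<in> borel_measurable (lebesgue_on (\<sigma> ` upper))"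
    unfolding reflection_upper using int_lo by (rule borel_measurable_integrable)
  show int_refl: "integrable (lebesgue_on upper) (\<lambda>x. f (\<sigma> x))"
    using reflection_integral(2)[OF measurable_domains(2) fm] int_lo by (simp add: reflection_upper)
  have "{x. v \<bullet> x = 0} \<in> null_sets lebesgue"
    using negligible_hyperplane[of v 0] v by (simp add: negligible_iff_null_sets)
  then have "AE x in lebesgue. x \<notin> {x. v \<bullet> x = 0}" by (rule AE_not_in)
  then have ae: "AE x in lebesgue. indicator \<Omega> x *\<^sub>R f x = indicator upper x *\<^sub>R f x + indicator lower x *\<^sub>R f x"
  proof eventually_elim
    case (elim x)
    then show ?case by (auto simp: indicator_def upper_def lower_def inner_commute)
  qed
  have "(LINT x|lebesgue_on \<Omega>. f x) = (LINT x|lebesgue. indicator \<Omega> x *\<^sub>R f x)"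
    by (rule integral_restrict_space[OF s(1)])
  also have "\<dots> = (LINT x|lebesgue. indicator upper x *\<^sub>R f x + indicator lower x *\<^sub>R f x)"
    by (rule integral_cong_AE[OF _ _ ae])
       (intro borel_measurable_integrable f0 Bochner_Integration.integrable_add up lo)+
  also have "\<dots> = (LINT x|lebesgue_on upper. f x) + (LINT x|lebesgue_on lower. f x)"
    using up lo by (simp only: Bochner_Integration.integral_add integral_restrict_space[OF s(2)] integral_restrict_space[OF s(3)])
  also have "(LINT x|lebesgue_on lower. f x) = (LINT x|lebesgue_on upper. f (\<sigma> x))"
    using reflection_integral(3)[OF measurable_domains(2) fm] by (simp add: reflection_upper)
  finally show "(LINT x|lebesgue_on \<Omega>. f x) = (LINT x|lebesgue_on upper. f x + f (\<sigma> x))"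
    using int_up int_refl by simp
qed

text \<open>
  The value on the hyperplane is immaterial; zero makes \<open>glue\<close> the exact sum of its two pieces.
\<close>

definition glue :: "('a \<Rightarrow> complex) \<Rightarrow> ('a \<Rightarrow> complex) \<Rightarrow> 'a \<Rightarrow> complex" where
  "glue a c x = (if x \<bullet> v > 0 then a x else if x \<bullet> v < 0 then c x else 0)"

lemma glue_L2:
  assumes a: "a \<in> L2 upper" and c: "c \<in> L2 lower"
  shows "glue a c \<in> L2 \<Omega>"
    and "(L2_norm \<Omega> (glue a c))\<^sup>2 = (L2_norm upper a)\<^sup>2 + (L2_norm lower c)\<^sup>2"
proof -
  have s: "\<Omega> \<inter> space lebesgue \<in> sets lebesgue" "upper \<inter> space lebesgue \<in> sets lebesgue"
    "lower \<inter> space lebesgue \<in> sets lebesgue"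
    by simp_all
  have eq: "(\<lambda>x. indicator \<Omega> x *\<^sub>R glue a c x) = (\<lambda>x. indicator upper x *\<^sub>R a x + indicator lower x *\<^sub>R c x)"
    by (auto simp: glue_def indicator_def upper_def lower_def fun_eq_iff)
  have eq2: "(\<lambda>x. indicator \<Omega> x *\<^sub>R (norm (glue a c x))\<^sup>2)
      = (\<lambda>x. indicator upper x *\<^sub>R (norm (a x))\<^sup>2 + indicator lower x *\<^sub>R (norm (c x))\<^sup>2)"
    by (auto simp: glue_def indicator_def upper_def lower_def fun_eq_iff)
  have m: "glue a c \<in> borel_measurable (lebesgue_on \<Omega>)"
    unfolding borel_measurable_restrict_space_iff[OF s(1)] eq
    using L2_measurable[OF a] L2_measurable[OF c]
    by (intro borel_measurable_add) (simp_all only: borel_measurable_restrict_space_iff[OF s(2)] borel_measurable_restrict_space_iff[OF s(3)])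
  have ia: "integrable lebesgue (\<lambda>x. indicator upper x *\<^sub>R (norm (a x))\<^sup>2)"
    using L2_integrable_square[OF a] by (simp only: integrable_restrict_space[OF s(2)])
  have ic: "integrable lebesgue (\<lambda>x. indicator lower x *\<^sub>R (norm (c x))\<^sup>2)"
    using L2_integrable_square[OF c] by (simp only: integrable_restrict_space[OF s(3)])
  have "integrable (lebesgue_on \<Omega>) (\<lambda>x. (norm (glue a c x))\<^sup>2)"
    unfolding integrable_restrict_space[OF s(1)] eq2 by (intro Bochner_Integration.integrable_add ia ic)
  with m show "glue a c \<in> L2 \<Omega>" by (simp add: L2_def)
  show "(L2_norm \<Omega> (glue a c))\<^sup>2 = (L2_norm upper a)\<^sup>2 + (L2_norm lower c)\<^sup>2"
    unfolding L2_norm_square integral_restrict_space[OF s(1)] eq2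
      integral_restrict_space[OF s(2)] integral_restrict_space[OF s(3)]
    by (rule Bochner_Integration.integral_add[OF ia ic])
qed

lemma L2_lim_glue:
  assumes X: "L2_lim upper X a" and Y: "L2_lim lower Y c"
  shows "L2_lim \<Omega> (\<lambda>n. glue (X n) (Y n)) (glue a c)"
proof -
  have L2: "X n \<in> L2 upper" "a \<in> L2 upper" "Y n \<in> L2 lower" "c \<in> L2 lower" for n
    using X Y by (auto simp: L2_lim_def)
  have "(\<lambda>x. glue a c x - glue (X n) (Y n) x) = glue (\<lambda>x. a x - X n x) (\<lambda>x. c x - Y n x)" for n
    by (auto simp: glue_def)
  then have "(L2_norm \<Omega> (\<lambda>x. glue a c x - glue (X n) (Y n) x))\<^sup>2
      = (L2_norm upper (\<lambda>x. a x - X n x))\<^sup>2 + (L2_norm lower (\<lambda>x. c x - Y n x))\<^sup>2" for n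
    by (simp add: glue_L2(2) L2_diff L2)
  then show ?thesis
    using X Y by (auto simp: L2_lim_def glue_L2(1) intro!: tendsto_add_zero)
qed

lemma reflected_L2_lower: "f \<in> L2 upper \<Longrightarrow> (\<lambda>x. f (\<sigma> x)) \<in> L2 lower"
  using reflection_L2[of lower f v] by (simp add: reflection_lower)

text \<open>
  The operator and its adjoint, the extension from the upper part to \<open>\<Omega>\<close>: even for \<open>s = 1\<close>, odd for
  \<open>s = -1\<close>. The gradients that go with them follow from the chain rule.
\<close>

definition fold_across :: "complex \<Rightarrow> ('a \<Rightarrow> complex) \<Rightarrow> 'a \<Rightarrow> complex" where
  "fold_across s h x = h x + s * h (\<sigma> x)"

definition extend :: "complex \<Rightarrow> ('a \<Rightarrow> complex) \<Rightarrow> 'a \<Rightarrow> complex" where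
  "extend s g = glue g (\<lambda>x. s * g (\<sigma> x))"

definition fold_gradient :: "complex \<Rightarrow> ('a \<Rightarrow> 'a \<Rightarrow> complex) \<Rightarrow> 'a \<Rightarrow> 'a \<Rightarrow> complex" where
  "fold_gradient s H b x = H b x + s * reflected_gradient v H b x"

definition extend_gradient :: "complex \<Rightarrow> ('a \<Rightarrow> 'a \<Rightarrow> complex) \<Rightarrow> 'a \<Rightarrow> 'a \<Rightarrow> complex" where
  "extend_gradient s G b = glue (G b) (\<lambda>x. s * reflected_gradient v G b x)"

lemma L2_upper: "h \<in> L2 \<Omega> \<Longrightarrow> h \<in> L2 upper"
  by (rule L2_mono[OF upper_subset]) simp_all

lemma L2_reflected: "h \<in> L2 \<Omega> \<Longrightarrow> (\<lambda>x. h (\<sigma> x)) \<in> L2 \<Omega>"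
  using reflection_L2[of \<Omega> h v] by (simp add: symmetric)

lemma fold_L2: "h \<in> L2 \<Omega> \<Longrightarrow> fold_across s h \<in> L2 upper"
  unfolding fold_across_def[abs_def] by (intro L2_add L2_scale L2_upper L2_reflected)

lemma extend_L2: "g \<in> L2 upper \<Longrightarrow> extend s g \<in> L2 \<Omega>"
  unfolding extend_def by (intro glue_L2(1) L2_scale reflected_L2_lower)

lemma glue_inner:
  assumes h: "h \<in> L2 \<Omega>" and a: "a \<in> L2 upper" and c: "c \<in> L2 lower"
  shows "L2_inner \<Omega> h (glue a c) = L2_inner upper h a + L2_inner upper (\<lambda>x. h (\<sigma> x)) (\<lambda>x. c (\<sigma> x))"
proof -
  have c': "(\<lambda>x. c (\<sigma> x)) \<in> L2 upper"
    using reflection_L2[of upper c v] c by (simp add: reflection_upper)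
  have "L2_inner \<Omega> h (glue a c)
      = (LINT x|lebesgue_on upper. h x * cnj (glue a c x) + h (\<sigma> x) * cnj (glue a c (\<sigma> x)))"
    unfolding L2_inner_def
    by (rule integral_fold(3)[OF L2_integrable_inner[OF h glue_L2(1)[OF a c]]])
  also have "\<dots> = (LINT x|lebesgue_on upper. h x * cnj (a x) + h (\<sigma> x) * cnj (c (\<sigma> x)))"
    by (rule Bochner_Integration.integral_cong)
       (auto simp: glue_def upper_def reflection_inner_normal space_restrict_space)
  also have "\<dots> = L2_inner upper h a + L2_inner upper (\<lambda>x. h (\<sigma> x)) (\<lambda>x. c (\<sigma> x))"
    unfolding L2_inner_def
    by (intro Bochner_Integration.integral_add L2_integrable_inner L2_upper h a c' L2_reflected)
  finally show ?thesis .
qed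

lemma fold_extend_adjoint:
  assumes h: "h \<in> L2 \<Omega>" and g: "g \<in> L2 upper" and s: "cnj s = s"
  shows "L2_inner upper (fold_across s h) g = L2_inner \<Omega> h (extend s g)"
proof -
  have "L2_inner upper (fold_across s h) g = L2_inner upper h g + s * L2_inner upper (\<lambda>x. h (\<sigma> x)) g"
    unfolding fold_across_def[abs_def]
    by (simp add: L2_inner_add_left L2_inner_scale_left L2_upper L2_reflected L2_scale h g)
  also have "\<dots> = L2_inner \<Omega> h (extend s g)"
    unfolding extend_def
    by (simp add: glue_inner h g L2_scale reflected_L2_lower reflection_involution L2_inner_scale_right s)
  finally show ?thesis .
qed

lemma fold_weak_gradient:
  assumes H: "weak_gradient \<Omega> h H"
  shows "weak_gradient upper (fold_across s h) (fold_gradient s H)"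
proof -
  have H': "weak_gradient \<Omega> (\<lambda>x. h (\<sigma> x)) (reflected_gradient v H)"
    by (rule weak_gradient_reflection) (simp_all add: symmetric H)
  show ?thesis
    unfolding fold_across_def[abs_def] fold_gradient_def[abs_def]
    by (rule weak_gradient_mono[OF weak_gradient_combine[OF _ H H'] upper_subset]) simp_all
qed

text \<open>
  The adjointness of folding and extension, on the level of gradients. On the reflected part the two sides
  agree because the matrix of the reflection is symmetric.
\<close>

lemma gradient_fold_extend:
  assumes H: "weak_gradient \<Omega> h H" and G: "weak_gradient upper g G" and s: "cnj s = s"
  shows "(\<Sum>b\<in>Basis. L2_inner upper (fold_gradient s H b) (G b))
       = (\<Sum>b\<in>Basis. L2_inner \<Omega> (H b) (extend_gradient s G b))"
proof -
  have H': "weak_gradient \<Omega> (\<lambda>x. h (\<sigma> x)) (reflected_gradient v H)"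
    by (rule weak_gradient_reflection) (simp_all add: symmetric H)
  have G': "weak_gradient lower (\<lambda>x. g (\<sigma> x)) (reflected_gradient v G)"
    by (rule weak_gradient_reflection) (simp_all add: reflection_lower G)
  note HL = weak_gradientD(2)[OF H] and RHL = weak_gradientD(2)[OF H'] and GL = weak_gradientD(2)[OF G]
    and RGL = weak_gradientD(2)[OF G']
  have aL: "along w G \<in> L2 upper" for w by (intro along_L2 GL)
  have swap: "(\<Sum>b\<in>Basis. L2_inner upper (reflected_gradient v H b) (G b))
      = (\<Sum>b\<in>Basis. L2_inner upper (\<lambda>x. H b (\<sigma> x)) (along (\<sigma> b) G))"
  proof -
    have "(\<Sum>b\<in>Basis. L2_inner upper (reflected_gradient v H b) (G b))
        = (LINT x|lebesgue_on upper. (\<Sum>b\<in>Basis. along (\<sigma> b) H (\<sigma> x) * cnj (G b x)))"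
      unfolding L2_inner_def reflected_gradient_def[symmetric]
      by (rule Bochner_Integration.integral_sum[symmetric]) (intro L2_integrable_inner L2_upper RHL GL)
    also have "\<dots> = (LINT x|lebesgue_on upper. (\<Sum>b\<in>Basis. H b (\<sigma> x) * cnj (along (\<sigma> b) G x)))"
      by (simp only: sum_reflection_swap)
    also have "\<dots> = (\<Sum>b\<in>Basis. L2_inner upper (\<lambda>x. H b (\<sigma> x)) (along (\<sigma> b) G))"
      unfolding L2_inner_def
      by (rule Bochner_Integration.integral_sum) (intro L2_integrable_inner L2_upper L2_reflected HL aL)
    finally show ?thesis .
  qed
  have "(\<Sum>b\<in>Basis. L2_inner upper (fold_gradient s H b) (G b))
      = (\<Sum>b\<in>Basis. L2_inner upper (H b) (G b)) + s * (\<Sum>b\<in>Basis. L2_inner upper (reflected_gradient v H b) (G b))"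
    unfolding fold_gradient_def[abs_def]
    by (simp add: L2_inner_add_left L2_inner_scale_left L2_upper L2_scale HL RHL GL sum.distrib sum_distrib_left)
  also have "\<dots> = (\<Sum>b\<in>Basis. L2_inner \<Omega> (H b) (extend_gradient s G b))"
  proof -
    have "L2_inner \<Omega> (H b) (extend_gradient s G b)
        = L2_inner upper (H b) (G b) + s * L2_inner upper (\<lambda>x. H b (\<sigma> x)) (along (\<sigma> b) G)"
      if b: "b \<in> Basis" for b
      using glue_inner[OF HL[OF b] GL[OF b] L2_scale[OF RGL[OF b]], of s]
      by (simp add: extend_gradient_def reflected_gradient_def reflection_involution L2_inner_scale_right s)
    then show ?thesis unfolding swap by (simp add: sum.distrib sum_distrib_left)
  qed
  finally show ?thesis .
qed

end

section \<open>Reflection and the form domains\<close>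

lemma LIMSEQ_unique_minus:
  fixes X Y :: "nat \<Rightarrow> complex"
  assumes "X \<longlonglongrightarrow> a" "Y \<longlonglongrightarrow> b" "\<And>n. X n = - Y n"
  shows "a = - b"
proof (rule LIMSEQ_unique[OF assms(1)])
  show "X \<longlonglongrightarrow> - b" unfolding assms(3)[THEN ext] by (rule tendsto_minus[OF assms(2)])
qed

context symmetric_domain
begin

text \<open>
  The point \<open>x\<close> lies at distance \<open>|x \<bullet> v| / |v|\<close> from the hyperplane.
\<close>

lemma vanishing_on_hyperplane_le:
  assumes \<psi>: "\<psi> \<in> test_functions U" and zero: "\<And>x. x \<bullet> v = 0 \<Longrightarrow> \<psi> x = 0"
  obtains L where "L \<ge> 0" "\<And>x. norm (\<psi> x) \<le> L * \<bar>x \<bullet> v\<bar>"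
proof -
  obtain C where C: "C \<ge> 0" "\<And>x t. norm (\<psi> (x + t *\<^sub>R v) - \<psi> x) \<le> C * \<bar>t\<bar>"
    by (rule test_function_increment[OF \<psi>, of v]) blast
  have "norm (\<psi> x) \<le> C / (norm v)\<^sup>2 * \<bar>x \<bullet> v\<bar>" for x
  proof -
    define t where "t = (x \<bullet> v) / (norm v)\<^sup>2"
    have "(x - t *\<^sub>R v) \<bullet> v = 0" using v by (simp add: t_def inner_diff_left dot_square_norm)
    then have "\<psi> (x - t *\<^sub>R v) = 0" by (rule zero)
    then show ?thesis using C(2)[of "x - t *\<^sub>R v" t] by (simp add: t_def abs_mult)
  qed
  then show ?thesis using that[of "C / (norm v)\<^sup>2"] C(1) by simp
qed

lemma cutoff_test_function:
  assumes \<psi>: "\<psi> \<in> test_functions \<Omega>"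
  shows "(\<lambda>x. cutoff v n x * \<psi> x) \<in> test_functions upper"
proof -
  obtain K where K: "compact K" "K \<subseteq> \<Omega>" "\<And>x. x \<notin> K \<Longrightarrow> \<psi> x = 0"
    by (rule test_functionsE[OF \<psi>]) blast
  let ?H = "{x. 1 \<le> real n * (x \<bullet> v)}"
  have H: "closed ?H" by (intro closed_Collect_le continuous_intros)
  show ?thesis
  proof (rule test_functionsI)
    show "smooth_on UNIV (\<lambda>x. cutoff v n x * \<psi> x)"
      by (rule smooth_mult[OF cutoff_smooth test_functions_smooth[OF \<psi>]])
    show "compact (K \<inter> ?H)" by (rule compact_Int_closed[OF K(1) H])
    have "x \<bullet> v > 0" if "1 \<le> real n * (x \<bullet> v)" for x
      using that by (metis less_le_trans mult_nonneg_nonpos not_le of_nat_0_le_iff zero_less_one)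
    then show "K \<inter> ?H \<subseteq> upper" using K(2) by (auto simp: upper_def)
    show "cutoff v n x * \<psi> x = 0" if "x \<notin> K \<inter> ?H" for x
      using that K(3)[of x] by (cases "x \<in> K") (auto simp: cutoff_def flat_exp_def)
  qed
qed

lemma cutoff_tendsto: "x \<bullet> v > 0 \<Longrightarrow> (\<lambda>n. cutoff v n x) \<longlonglongrightarrow> 1"
  using tendsto_of_real[OF filterlim_compose[OF flat_exp_0_tendsto filterlim_linear_at_top], where 'a = complex]
  by (simp add: cutoff_def)

lemma cutoff_norm_le: "norm (cutoff v n x) \<le> 1"
  using flat_exp_0_le_1 flat_exp_nonneg by (simp add: cutoff_def)

lemma cutoff_L2_lim:
  assumes \<psi>: "\<psi> \<in> test_functions \<Omega>"
  shows "L2_lim upper (\<lambda>n x. cutoff v n x * \<psi> x) \<psi>"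
proof (rule L2_lim_dominated)
  show "(\<lambda>x. cutoff v n x * \<psi> x) \<in> borel_measurable (lebesgue_on upper)" for n
    by (rule test_functions_measurable[OF cutoff_test_function[OF \<psi>]])
  show "\<psi> \<in> borel_measurable (lebesgue_on upper)" by (rule test_functions_measurable[OF \<psi>])
  show "\<psi> \<in> L2 upper" by (rule test_functions_L2[OF \<psi>]) simp
  show "norm (cutoff v n x * \<psi> x) \<le> norm (\<psi> x)" for n x
    using mult_right_mono[OF cutoff_norm_le[of n x], of "norm (\<psi> x)"] by (simp add: norm_mult)
  show "(\<lambda>n. cutoff v n x * \<psi> x) \<longlonglongrightarrow> \<psi> x" if "x \<in> upper" for x
    using tendsto_mult_right[OF cutoff_tendsto, of x "\<psi> x"] that by (simp add: upper_def)
qed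

text \<open>
  The derivative of the product has the extra term \<open>n (w \<bullet> v) flat_exp 2 (n (x \<bullet> v) - 1) \<psi> x\<close>. It is absent for
  tangential \<open>w\<close>; otherwise \<open>|\<psi> x| \<le> L |x \<bullet> v|\<close> absorbs the factor \<open>n\<close>, and the term is bounded and tends to
  zero.
\<close>

lemma cutoff_derivative_L2_lim:
  assumes \<psi>: "\<psi> \<in> test_functions \<Omega>" and w: "w \<bullet> v = 0 \<or> (\<forall>x. x \<bullet> v = 0 \<longrightarrow> \<psi> x = 0)"
  shows "L2_lim upper (\<lambda>n x. frechet_derivative (\<lambda>x. cutoff v n x * \<psi> x) (at x) w)
          (\<lambda>x. frechet_derivative \<psi> (at x) w)"
proof -
  let ?D = "\<lambda>x. frechet_derivative \<psi> (at x) w"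
  obtain L where L: "L \<ge> 0" "\<And>x. \<bar>w \<bullet> v\<bar> * norm (\<psi> x) \<le> L * \<bar>x \<bullet> v\<bar>"
  proof (cases "w \<bullet> v = 0")
    case True
    then show ?thesis using that[of 0] by simp
  next
    case False
    then obtain L where L: "L \<ge> 0" "\<And>x. norm (\<psi> x) \<le> L * \<bar>x \<bullet> v\<bar>"
      using vanishing_on_hyperplane_le[OF \<psi>] w by blast
    show ?thesis
      using L by (intro that[of "\<bar>w \<bullet> v\<bar> * L"]) (simp_all add: mult.assoc mult_left_mono)
  qed
  obtain K where K: "compact K" "\<And>x. x \<notin> K \<Longrightarrow> \<psi> x = 0" "\<And>x w. x \<notin> K \<Longrightarrow> frechet_derivative \<psi> (at x) w = 0"
    by (rule test_functionsE[OF \<psi>]) blast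
  obtain C where C: "C \<ge> 0" "\<And>x. norm (?D x) \<le> C"
    by (rule test_functions_bounded[OF test_functions_derivative[OF \<psi>, of w]]) blast
  define slope where "slope n x = (real n * (x \<bullet> v)) * flat_exp 2 (real n * (x \<bullet> v) - 1)" for n x
  have D: "frechet_derivative (\<lambda>x. cutoff v n x * \<psi> x) (at x) w
      = cutoff v n x * ?D x + complex_of_real (real n * (w \<bullet> v) * flat_exp 2 (real n * (x \<bullet> v) - 1)) * \<psi> x" for n x
    by (simp only: smooth_derivative_mult[OF cutoff_smooth test_functions_smooth[OF \<psi>]] cutoff_derivative)
  have second: "norm (complex_of_real (real n * (w \<bullet> v) * flat_exp 2 (real n * (x \<bullet> v) - 1)) * \<psi> x)
      \<le> L * slope n x" if x: "x \<in> upper" for n x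
  proof -
    have pos: "x \<bullet> v > 0" using x by (simp add: upper_def)
    have "norm (complex_of_real (real n * (w \<bullet> v) * flat_exp 2 (real n * (x \<bullet> v) - 1)) * \<psi> x)
        = (real n * flat_exp 2 (real n * (x \<bullet> v) - 1)) * (\<bar>w \<bullet> v\<bar> * norm (\<psi> x))"
      using flat_exp_nonneg by (simp add: norm_mult abs_mult)
    also have "\<dots> \<le> (real n * flat_exp 2 (real n * (x \<bullet> v) - 1)) * (L * \<bar>x \<bullet> v\<bar>)"
      using flat_exp_nonneg by (intro mult_left_mono L) simp
    also have "\<dots> = L * slope n x" using pos by (simp add: slope_def)
    finally show ?thesis .
  qed
  show ?thesis
  proof (rule L2_lim_dominated)
    show "(\<lambda>x. frechet_derivative (\<lambda>x. cutoff v n x * \<psi> x) (at x) w) \<in> borel_measurable (lebesgue_on upper)" for n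
      by (rule test_functions_measurable[OF test_functions_derivative[OF cutoff_test_function[OF \<psi>]]])
    show "?D \<in> borel_measurable (lebesgue_on upper)"
      by (rule test_functions_measurable[OF test_functions_derivative[OF \<psi>]])
    show "(\<lambda>x. complex_of_real ((C + 3 * L) * indicator K x)) \<in> L2 upper"
      by (rule indicator_L2[OF K(1)]) simp
  next
    fix n x assume x: "x \<in> upper"
    show "norm (frechet_derivative (\<lambda>x. cutoff v n x * \<psi> x) (at x) w) \<le> norm (complex_of_real ((C + 3 * L) * indicator K x))"
    proof (cases "x \<in> K")
      case True
      have "norm (cutoff v n x * ?D x) \<le> 1 * C"
        unfolding norm_mult by (intro mult_mono cutoff_norm_le C) auto
      moreover have "L * slope n x \<le> L * 3"
        unfolding slope_def by (intro mult_left_mono cutoff_slope_le L)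
      ultimately have "norm (frechet_derivative (\<lambda>x. cutoff v n x * \<psi> x) (at x) w) \<le> C + 3 * L"
        unfolding D using second[OF x, of n]
          norm_triangle_ineq[of "cutoff v n x * ?D x" "complex_of_real (real n * (w \<bullet> v) * flat_exp 2 (real n * (x \<bullet> v) - 1)) * \<psi> x"]
        by linarith
      moreover have "norm (complex_of_real ((C + 3 * L) * indicator K x)) = C + 3 * L"
        unfolding norm_of_real using True C(1) L(1) by simp
      ultimately show ?thesis by simp
    next
      case False
      then show ?thesis unfolding D using K(2,3) by simp
    qed
  next
    fix x assume x: "x \<in> upper"
    then have pos: "x \<bullet> v > 0" by (simp add: upper_def)
    have "(\<lambda>n. complex_of_real (real n * (w \<bullet> v) * flat_exp 2 (real n * (x \<bullet> v) - 1)) * \<psi> x) \<longlonglongrightarrow> 0"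
    proof (rule Lim_null_comparison)
      show "(\<lambda>n. L * slope n x) \<longlonglongrightarrow> 0"
        unfolding slope_def by (rule tendsto_mult_right_zero[OF cutoff_slope_tendsto[OF pos]])
    qed (use second[OF x] in \<open>auto intro!: always_eventually\<close>)
    then have "(\<lambda>n. cutoff v n x * ?D x + complex_of_real (real n * (w \<bullet> v) * flat_exp 2 (real n * (x \<bullet> v) - 1)) * \<psi> x)
        \<longlonglongrightarrow> 1 * ?D x + 0"
      by (intro tendsto_add tendsto_mult tendsto_const cutoff_tendsto pos)
    then show "(\<lambda>n. frechet_derivative (\<lambda>x. cutoff v n x * \<psi> x) (at x) w) \<longlonglongrightarrow> ?D x"
      unfolding D by simp
  qed
qed

lemma integral_as_inner: "(LINT x|lebesgue_on U. g x * f x) = L2_inner U f (\<lambda>x. cnj (g x))"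
  by (simp add: L2_inner_def mult.commute)

text \<open>
  There is no boundary term on the hyperplane, although \<open>\<psi>\<close> need not be supported in the upper part: it is
  the limit of the cut-off functions, for which the definition of a weak derivative applies.
\<close>

lemma boundary_integration_by_parts:
  assumes G: "weak_gradient upper g G" and \<psi>: "\<psi> \<in> test_functions \<Omega>"
    and w: "w \<bullet> v = 0 \<or> (\<forall>x. x \<bullet> v = 0 \<longrightarrow> \<psi> x = 0)"
  shows "(LINT x|lebesgue_on upper. g x * frechet_derivative \<psi> (at x) w)
       = - (LINT x|lebesgue_on upper. along w G x * \<psi> x)"
proof -
  let ?\<psi> = "\<lambda>n x. cutoff v n x * \<psi> x"
  have aL: "along w G \<in> L2 upper" by (intro along_L2 weak_gradientD(2)[OF G])
  have "(\<lambda>n. L2_inner upper (\<lambda>x. frechet_derivative (?\<psi> n) (at x) w) (\<lambda>x. cnj (g x)))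
      \<longlonglongrightarrow> L2_inner upper (\<lambda>x. frechet_derivative \<psi> (at x) w) (\<lambda>x. cnj (g x))"
    by (rule L2_lim_inner[OF cutoff_derivative_L2_lim[OF \<psi> w] L2_cnj[OF weak_gradientD(1)[OF G]]])
  moreover have "(\<lambda>n. L2_inner upper (?\<psi> n) (\<lambda>x. cnj (along w G x)))
      \<longlonglongrightarrow> L2_inner upper \<psi> (\<lambda>x. cnj (along w G x))"
    by (rule L2_lim_inner[OF cutoff_L2_lim[OF \<psi>] L2_cnj[OF aL]])
  moreover have "(LINT x|lebesgue_on upper. g x * frechet_derivative (?\<psi> n) (at x) w)
      = - (LINT x|lebesgue_on upper. along w G x * ?\<psi> n x)" for n
    using weak_deriv_along[OF measurable_domains(2) G, of w] cutoff_test_function[OF \<psi>, of n]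
    by (simp only: is_weak_deriv_def)
  ultimately show ?thesis
    unfolding integral_as_inner by (rule LIMSEQ_unique_minus)
qed

text \<open>
  The identity holds for test functions \<open>g\<close>, and both sides depend continuously on \<open>g\<close>.
\<close>

lemma H10_integration_by_parts:
  assumes g: "g \<in> H10 upper" and G: "weak_gradient upper g G" and \<psi>: "\<psi> \<in> test_functions \<Omega>"
  shows "(LINT x|lebesgue_on upper. g x * frechet_derivative \<psi> (at x) w)
       = - (LINT x|lebesgue_on upper. along w G x * \<psi> x)"
proof -
  obtain \<phi> where \<phi>: "\<And>n. \<phi> n \<in> test_functions upper" "L2_lim upper \<phi> g"
    "\<And>b. b \<in> Basis \<Longrightarrow> L2_lim upper (\<lambda>n x. frechet_derivative (\<phi> n) (at x) b) (G b)"
    by (rule H10_sequence[OF upper_open g G]) blast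
  let ?D = "\<lambda>x. frechet_derivative \<psi> (at x) w"
  have DL: "?D \<in> L2 upper" by (rule test_functions_L2[OF test_functions_derivative[OF \<psi>]]) simp
  have PL: "\<psi> \<in> L2 upper" by (rule test_functions_L2[OF \<psi>]) simp
  have lim: "L2_lim upper (\<lambda>n. along w (\<lambda>b x. frechet_derivative (\<phi> n) (at x) b)) (along w G)"
    by (rule L2_lim_along[OF \<phi>(3)])
  have "(\<lambda>n. L2_inner upper (\<phi> n) (\<lambda>x. cnj (?D x))) \<longlonglongrightarrow> L2_inner upper g (\<lambda>x. cnj (?D x))"
    by (rule L2_lim_inner[OF \<phi>(2) L2_cnj[OF DL]])
  moreover have "(\<lambda>n. L2_inner upper (along w (\<lambda>b x. frechet_derivative (\<phi> n) (at x) b)) (\<lambda>x. cnj (\<psi> x)))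
      \<longlonglongrightarrow> L2_inner upper (along w G) (\<lambda>x. cnj (\<psi> x))"
    by (rule L2_lim_inner[OF lim L2_cnj[OF PL]])
  moreover have "L2_inner upper (\<phi> n) (\<lambda>x. cnj (?D x))
      = - L2_inner upper (along w (\<lambda>b x. frechet_derivative (\<phi> n) (at x) b)) (\<lambda>x. cnj (\<psi> x))" for n
  proof -
    have "along w (\<lambda>b x. frechet_derivative (\<phi> n) (at x) b) x = frechet_derivative (\<phi> n) (at x) w" for x
      by (rule smooth_along[OF test_functions_smooth[OF \<phi>(1)]])
    moreover have "is_weak_deriv upper w \<psi> ?D" by (rule smooth_weak_deriv[OF \<psi>]) simp
    ultimately show ?thesis
      using \<phi>(1)[of n] by (simp add: is_weak_deriv_def L2_inner_def mult.commute)
  qed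
  ultimately have "L2_inner upper g (\<lambda>x. cnj (?D x)) = - L2_inner upper (along w G) (\<lambda>x. cnj (\<psi> x))"
    by (rule LIMSEQ_unique_minus)
  then show ?thesis by (simp add: L2_inner_def)
qed

text \<open>
  A reflection fixes the tangential part of a direction and changes the sign of the normal part. Hence, after
  folding the integrals onto the upper part, tangential derivatives act on \<open>\<phi> + s (\<phi> \<circ> \<sigma>)\<close> only and the normal
  derivative on \<open>\<phi> - s (\<phi> \<circ> \<sigma>)\<close> only. For \<open>s = 1\<close> the latter vanishes on the hyperplane.
\<close>

lemma extend_weak_gradient:
  assumes G: "weak_gradient upper g G" and s: "s * s = 1"
    and parts: "\<And>\<phi> w. \<phi> \<in> test_functions \<Omega> \<Longrightarrow> w \<bullet> v = 0 \<Longrightarrow>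
        (LINT x|lebesgue_on upper. g x * frechet_derivative (\<lambda>x. \<phi> x + s * \<phi> (\<sigma> x)) (at x) w)
        = - (LINT x|lebesgue_on upper. along w G x * (\<phi> x + s * \<phi> (\<sigma> x)))"
    and normal: "\<And>\<phi>. \<phi> \<in> test_functions \<Omega> \<Longrightarrow>
        (LINT x|lebesgue_on upper. g x * frechet_derivative (\<lambda>x. \<phi> x + (- s) * \<phi> (\<sigma> x)) (at x) v)
        = - (LINT x|lebesgue_on upper. along v G x * (\<phi> x + (- s) * \<phi> (\<sigma> x)))"
  shows "weak_gradient \<Omega> (extend s g) (extend_gradient s G)"
  unfolding weak_gradient_def
proof (intro conjI ballI)
  show "extend s g \<in> L2 \<Omega>" by (rule extend_L2[OF weak_gradientD(1)[OF G]])
  fix b :: 'a assume b: "b \<in> Basis"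
  have G': "weak_gradient lower (\<lambda>x. g (\<sigma> x)) (reflected_gradient v G)"
    by (rule weak_gradient_reflection) (simp_all add: reflection_lower G)
  have EL: "extend_gradient s G b \<in> L2 \<Omega>"
    unfolding extend_gradient_def
    by (intro glue_L2(1) L2_scale weak_gradientD(2)[OF G b] weak_gradientD(2)[OF G' b])
  then show "extend_gradient s G b \<in> L2 \<Omega>" .
  show "is_weak_deriv \<Omega> b (extend s g) (extend_gradient s G b)"
    unfolding is_weak_deriv_def
  proof
    fix \<phi> :: "'a \<Rightarrow> complex" assume \<phi>: "\<phi> \<in> test_functions \<Omega>"
    define \<rho> where "\<rho> x = \<phi> (\<sigma> x)" for x
    have \<rho>: "\<rho> \<in> test_functions \<Omega>"
      using test_functions_reflection[OF \<phi>, of v] by (simp add: symmetric \<rho>_def[abs_def])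
    note sm = test_functions_smooth[OF \<phi>] test_functions_smooth[OF \<rho>]
    define \<alpha> where "\<alpha> = (b \<bullet> v) / (norm v)\<^sup>2"
    define t where "t = b - \<alpha> *\<^sub>R v"
    have t: "t \<bullet> v = 0" using v by (simp add: t_def \<alpha>_def inner_diff_left dot_square_norm)
    have b_eq: "b = t + \<alpha> *\<^sub>R v" by (simp add: t_def)
    have "2 * (v \<bullet> b) / (norm v)\<^sup>2 = \<alpha> + \<alpha>" by (simp add: \<alpha>_def inner_commute)
    then have \<sigma>b_eq: "\<sigma> b = t + (- \<alpha>) *\<^sub>R v"
      unfolding hyperplane_reflection_def by (simp only: t_def scaleR_add_left) simp
    let ?p = "\<lambda>x. \<phi> x + s * \<rho> x" and ?m = "\<lambda>x. \<phi> x + (- s) * \<rho> x"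
    have p: "?p \<in> test_functions \<Omega>" and m: "?m \<in> test_functions \<Omega>"
      by (intro test_functions_add test_functions_scale \<phi> \<rho>)+
    have gL: "g \<in> L2 upper" by (rule weak_gradientD(1)[OF G])
    have aL: "along w G \<in> L2 upper" for w by (intro along_L2 weak_gradientD(2)[OF G])
    have TL: "\<psi> \<in> L2 upper" "\<psi> \<in> L2 \<Omega>" if "\<psi> \<in> test_functions \<Omega>" for \<psi>
      by (rule test_functions_L2[OF that]; simp)+
    have DL: "(\<lambda>x. frechet_derivative \<psi> (at x) w) \<in> test_functions \<Omega>" if "\<psi> \<in> test_functions \<Omega>" for \<psi> w
      by (rule test_functions_derivative[OF that])
    have D\<rho>: "frechet_derivative \<phi> (at (\<sigma> x)) b = frechet_derivative \<rho> (at x) (\<sigma> b)" for x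
      unfolding \<rho>_def[abs_def] by (simp add: derivative_reflection[OF sm(1)] reflection_involution)
    have Dpm: "frechet_derivative ?p (at x) w = frechet_derivative \<phi> (at x) w + s * frechet_derivative \<rho> (at x) w"
      "frechet_derivative ?m (at x) w = frechet_derivative \<phi> (at x) w + (- s) * frechet_derivative \<rho> (at x) w" for x w
      by (simp_all only: smooth_derivative_add[OF sm(1) smooth_mult[OF smooth_const sm(2)]] smooth_derivative_scale[OF sm(2)])
    have lin: "frechet_derivative \<psi> (at x) (t + r *\<^sub>R v) = frechet_derivative \<psi> (at x) t + of_real r * frechet_derivative \<psi> (at x) v"
      if "smooth_on UNIV \<psi>" for \<psi> :: "'a \<Rightarrow> complex" and x r
      using linear_add[OF smooth_derivative_linear[OF that]] linear_scale[OF smooth_derivative_linear[OF that]]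
      by (simp add: scaleR_conv_of_real)
    have "(LINT x|lebesgue_on \<Omega>. extend s g x * frechet_derivative \<phi> (at x) b)
        = (LINT x|lebesgue_on upper. extend s g x * frechet_derivative \<phi> (at x) b
            + extend s g (\<sigma> x) * frechet_derivative \<phi> (at (\<sigma> x)) b)"
      by (rule integral_fold(3)[OF L2_integrable_mult[OF extend_L2[OF gL] TL(2)[OF DL[OF \<phi>]]]])
    also have "\<dots> = (LINT x|lebesgue_on upper. g x * frechet_derivative ?p (at x) t
            + of_real \<alpha> * (g x * frechet_derivative ?m (at x) v))"
    proof (rule Bochner_Integration.integral_cong[OF refl])
      fix x assume "x \<in> space (lebesgue_on upper)"
      then have x: "x \<bullet> v > 0" by (simp add: upper_def space_restrict_space)
      have D_sum: "frechet_derivative \<phi> (at x) b + s * frechet_derivative \<rho> (at x) (\<sigma> b)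
          = frechet_derivative ?p (at x) t + of_real \<alpha> * frechet_derivative ?m (at x) v"
      proof -
        have Db: "frechet_derivative \<phi> (at x) b = frechet_derivative \<phi> (at x) t + of_real \<alpha> * frechet_derivative \<phi> (at x) v"
          by (subst b_eq) (rule lin[OF sm(1)])
        have Dr: "frechet_derivative \<rho> (at x) (\<sigma> b)
            = frechet_derivative \<rho> (at x) t + of_real (- \<alpha>) * frechet_derivative \<rho> (at x) v"
          unfolding \<sigma>b_eq by (rule lin[OF sm(2)])
        show ?thesis unfolding Dpm Db Dr by (simp add: algebra_simps)
      qed
      have ext: "extend s g x = g x" "extend s g (\<sigma> x) = s * g x"
        using x by (simp_all add: extend_def glue_def reflection_inner_normal reflection_involution)
      have "extend s g x * frechet_derivative \<phi> (at x) b + extend s g (\<sigma> x) * frechet_derivative \<phi> (at (\<sigma> x)) b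
          = g x * (frechet_derivative \<phi> (at x) b + s * frechet_derivative \<rho> (at x) (\<sigma> b))"
        unfolding ext D\<rho> by (simp add: algebra_simps)
      also have "\<dots> = g x * frechet_derivative ?p (at x) t + of_real \<alpha> * (g x * frechet_derivative ?m (at x) v)"
        unfolding D_sum by (simp only: distrib_left mult.left_commute)
      finally show "extend s g x * frechet_derivative \<phi> (at x) b + extend s g (\<sigma> x) * frechet_derivative \<phi> (at (\<sigma> x)) b
          = g x * frechet_derivative ?p (at x) t + of_real \<alpha> * (g x * frechet_derivative ?m (at x) v)" .
    qed
    also have "\<dots> = (LINT x|lebesgue_on upper. g x * frechet_derivative ?p (at x) t)
            + of_real \<alpha> * (LINT x|lebesgue_on upper. g x * frechet_derivative ?m (at x) v)"
      by (simp only: Bochner_Integration.integral_add[OF L2_integrable_mult[OF gL TL(1)[OF DL[OF p]]]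
            integrable_mult_right[OF L2_integrable_mult[OF gL TL(1)[OF DL[OF m]]]]] integral_mult_right_zero)
    also have "\<dots> = - (LINT x|lebesgue_on upper. along t G x * ?p x)
            + of_real \<alpha> * - (LINT x|lebesgue_on upper. along v G x * ?m x)"
      using parts[OF \<phi> t] normal[OF \<phi>] by (simp only: \<rho>_def)
    also have "\<dots> = - (LINT x|lebesgue_on upper. along t G x * ?p x + of_real \<alpha> * (along v G x * ?m x))"
      by (simp only: Bochner_Integration.integral_add[OF L2_integrable_mult[OF aL TL(1)[OF p]]
            integrable_mult_right[OF L2_integrable_mult[OF aL TL(1)[OF m]]]] integral_mult_right_zero) simp
    also have "(LINT x|lebesgue_on upper. along t G x * ?p x + of_real \<alpha> * (along v G x * ?m x))
        = (LINT x|lebesgue_on upper. extend_gradient s G b x * \<phi> x + extend_gradient s G b (\<sigma> x) * \<phi> (\<sigma> x))"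
    proof (rule Bochner_Integration.integral_cong[OF refl])
      fix x assume "x \<in> space (lebesgue_on upper)"
      then have x: "x \<bullet> v > 0" by (simp add: upper_def space_restrict_space)
      have eg: "extend_gradient s G b x = along b G x" "extend_gradient s G b (\<sigma> x) = s * along (\<sigma> b) G x"
        using x by (simp_all add: extend_gradient_def glue_def reflection_inner_normal reflection_involution
            reflected_gradient_def along_Basis b)
      have ab: "along b G x = along t G x + of_real \<alpha> * along v G x"
        by (subst b_eq) (simp add: along_add along_scale)
      have asb: "along (\<sigma> b) G x = along t G x - of_real \<alpha> * along v G x"
        unfolding \<sigma>b_eq along_add along_scale by simp
      show "along t G x * ?p x + of_real \<alpha> * (along v G x * ?m x)
          = extend_gradient s G b x * \<phi> x + extend_gradient s G b (\<sigma> x) * \<phi> (\<sigma> x)"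
        unfolding eg ab asb \<rho>_def by (simp add: algebra_simps)
    qed
    also have "\<dots> = (LINT x|lebesgue_on \<Omega>. extend_gradient s G b x * \<phi> x)"
      by (rule integral_fold(3)[OF L2_integrable_mult[OF EL TL(2)[OF \<phi>]], symmetric])
    finally show "(LINT x|lebesgue_on \<Omega>. extend s g x * frechet_derivative \<phi> (at x) b)
        = - (LINT x|lebesgue_on \<Omega>. extend_gradient s G b x * \<phi> x)" .
  qed
qed

lemma reflected_test_function: "\<phi> \<in> test_functions \<Omega> \<Longrightarrow> (\<lambda>x. \<phi> x + c * \<phi> (\<sigma> x)) \<in> test_functions \<Omega>"
  using test_functions_reflection[of \<phi> \<Omega> v]
  by (intro test_functions_add test_functions_scale) (simp_all add: symmetric)

lemma even_extension_weak_gradient: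
  assumes G: "weak_gradient upper g G"
  shows "weak_gradient \<Omega> (extend 1 g) (extend_gradient 1 G)"
proof (rule extend_weak_gradient[OF G])
  fix \<phi> :: "'a \<Rightarrow> complex" and w assume \<phi>: "\<phi> \<in> test_functions \<Omega>" and w: "w \<bullet> v = 0"
  show "(LINT x|lebesgue_on upper. g x * frechet_derivative (\<lambda>x. \<phi> x + 1 * \<phi> (\<sigma> x)) (at x) w)
      = - (LINT x|lebesgue_on upper. along w G x * (\<phi> x + 1 * \<phi> (\<sigma> x)))"
    using w by (intro boundary_integration_by_parts[OF G reflected_test_function[OF \<phi>]]) simp
next
  fix \<phi> :: "'a \<Rightarrow> complex" assume \<phi>: "\<phi> \<in> test_functions \<Omega>"
  show "(LINT x|lebesgue_on upper. g x * frechet_derivative (\<lambda>x. \<phi> x + - 1 * \<phi> (\<sigma> x)) (at x) v)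
      = - (LINT x|lebesgue_on upper. along v G x * (\<phi> x + - 1 * \<phi> (\<sigma> x)))"
    by (intro boundary_integration_by_parts[OF G reflected_test_function[OF \<phi>]])
       (simp add: reflection_on_hyperplane)
qed simp

lemma odd_extension_weak_gradient:
  assumes g: "g \<in> H10 upper" and G: "weak_gradient upper g G"
  shows "weak_gradient \<Omega> (extend (- 1) g) (extend_gradient (- 1) G)"
  by (rule extend_weak_gradient[OF G])
     (simp, (rule H10_integration_by_parts[OF g G reflected_test_function], assumption)+)

text \<open>
  An odd function vanishes on the hyperplane, so its cut-offs converge to it in \<open>H\<^sup>1\<close>.
\<close>

lemma odd_test_function_H10:
  assumes \<phi>: "\<phi> \<in> test_functions \<Omega>"
  shows "fold_across (- 1) \<phi> \<in> H10 upper"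
proof (rule H10_closed[OF upper_open])
  let ?\<psi> = "fold_across (- 1) \<phi>"
  have \<psi>: "?\<psi> \<in> test_functions \<Omega>"
    unfolding fold_across_def[abs_def] by (rule reflected_test_function[OF \<phi>])
  show "weak_gradient upper ?\<psi> (\<lambda>b x. frechet_derivative ?\<psi> (at x) b)"
    by (rule weak_gradient_test_function[OF \<psi>]) simp
  show "(\<lambda>x. cutoff v n x * ?\<psi> x) \<in> H10 upper" for n
    by (rule test_functions_H10[OF upper_open cutoff_test_function[OF \<psi>]])
  show "weak_gradient upper (\<lambda>x. cutoff v n x * ?\<psi> x) (\<lambda>b x. frechet_derivative (\<lambda>x. cutoff v n x * ?\<psi> x) (at x) b)" for n
    by (rule weak_gradient_test_function[OF cutoff_test_function[OF \<psi>]]) simp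
  show "L2_lim upper (\<lambda>n x. cutoff v n x * ?\<psi> x) ?\<psi>" by (rule cutoff_L2_lim[OF \<psi>])
  show "L2_lim upper (\<lambda>n x. frechet_derivative (\<lambda>x. cutoff v n x * ?\<psi> x) (at x) b) (\<lambda>x. frechet_derivative ?\<psi> (at x) b)" for b
    by (rule cutoff_derivative_L2_lim[OF \<psi>]) (simp add: fold_across_def reflection_on_hyperplane)
qed

lemma L2_lim_reflected_gradient:
  assumes "\<sigma> ` U = V" "U \<in> sets lebesgue" "\<And>b. b \<in> Basis \<Longrightarrow> L2_lim V (\<lambda>n. X n b) (H b)"
  shows "L2_lim U (\<lambda>n. reflected_gradient v (X n) b) (reflected_gradient v H b)"
  unfolding reflected_gradient_def[abs_def]
  by (rule L2_lim_reflection[OF assms(2)]) (use L2_lim_along[OF assms(3)] assms(1) in simp)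

lemma fold_H10:
  assumes h: "h \<in> H10 \<Omega>"
  shows "fold_across (- 1) h \<in> H10 upper"
proof -
  define H where "H b = weak_deriv \<Omega> b h" for b
  have H: "weak_gradient \<Omega> h H" unfolding H_def[abs_def] by (rule H1_weak_gradient[OF H10_D[OF h]])
  obtain \<phi> where \<phi>: "\<And>n. \<phi> n \<in> test_functions \<Omega>" "L2_lim \<Omega> \<phi> h"
    "\<And>b. b \<in> Basis \<Longrightarrow> L2_lim \<Omega> (\<lambda>n x. frechet_derivative (\<phi> n) (at x) b) (H b)"
    by (rule H10_sequence[OF open_domain h H]) blast
  let ?D = "\<lambda>n b x. frechet_derivative (\<phi> n) (at x) b"
  have D: "weak_gradient \<Omega> (\<phi> n) (?D n)" for n by (rule weak_gradient_test_function[OF \<phi>(1)]) simp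
  have mono: "L2_lim upper X f" if "L2_lim \<Omega> X f" for X f
    by (rule L2_lim_mono[OF upper_subset _ _ that]) simp_all
  show ?thesis
  proof (rule H10_closed[OF upper_open fold_weak_gradient[OF H]])
    show "fold_across (- 1) (\<phi> n) \<in> H10 upper" for n by (rule odd_test_function_H10[OF \<phi>(1)])
    show "weak_gradient upper (fold_across (- 1) (\<phi> n)) (fold_gradient (- 1) (?D n))" for n
      by (rule fold_weak_gradient[OF D])
    show "L2_lim upper (\<lambda>n. fold_across (- 1) (\<phi> n)) (fold_across (- 1) h)"
      unfolding fold_across_def[abs_def]
      by (intro L2_lim_combine mono \<phi>(2) L2_lim_reflection) (simp_all add: symmetric \<phi>(2))
    show "L2_lim upper (\<lambda>n. fold_gradient (- 1) (?D n) b) (fold_gradient (- 1) H b)" if "b \<in> Basis" for b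
      unfolding fold_gradient_def[abs_def]
      by (intro L2_lim_combine mono \<phi>(3)[OF that] L2_lim_reflected_gradient[OF symmetric _ \<phi>(3)]) simp_all
  qed
qed

lemma extend_H10:
  assumes g: "g \<in> H10 upper"
  shows "extend (- 1) g \<in> H10 \<Omega>"
proof -
  define G where "G b = weak_deriv upper b g" for b
  have G: "weak_gradient upper g G" unfolding G_def[abs_def] by (rule H1_weak_gradient[OF H10_D[OF g]])
  obtain \<phi> where \<phi>: "\<And>n. \<phi> n \<in> test_functions upper" "L2_lim upper \<phi> g"
    "\<And>b. b \<in> Basis \<Longrightarrow> L2_lim upper (\<lambda>n x. frechet_derivative (\<phi> n) (at x) b) (G b)"
    by (rule H10_sequence[OF upper_open g G]) blast
  let ?D = "\<lambda>n b x. frechet_derivative (\<phi> n) (at x) b"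
  have D: "weak_gradient upper (\<phi> n) (?D n)" for n by (rule weak_gradient_test_function[OF \<phi>(1)]) simp
  have ext: "extend (- 1) (\<phi> n) = (\<lambda>x. \<phi> n x + (- 1) * \<phi> n (\<sigma> x))" for n
  proof
    fix x
    obtain K where K: "K \<subseteq> upper" "\<And>x. x \<notin> K \<Longrightarrow> \<phi> n x = 0"
      by (rule test_functionsE[OF \<phi>(1)]) blast
    have "\<phi> n y = 0" if "\<not> 0 < y \<bullet> v" for y using that K by (auto simp: upper_def)
    then show "extend (- 1) (\<phi> n) x = \<phi> n x + (- 1) * \<phi> n (\<sigma> x)"
      by (auto simp: extend_def glue_def reflection_inner_normal)
  qed
  have lower: "L2_lim lower (\<lambda>n x. X n (\<sigma> x)) (\<lambda>x. f (\<sigma> x))" if "L2_lim upper X f" for X f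
    using L2_lim_reflection[of lower v X f] that by (simp add: reflection_lower)
  have scale: "L2_lim U (\<lambda>n x. c * X n x) (\<lambda>x. c * f x)" if "L2_lim U X f" for U X f c
    using L2_lim_combine[OF L2_lim_const[OF L2_zero] that, of c] by simp
  show ?thesis
  proof (rule H10_closed[OF open_domain odd_extension_weak_gradient[OF g G]])
    show "extend (- 1) (\<phi> n) \<in> H10 \<Omega>" for n
      unfolding ext
      by (rule test_functions_H10[OF open_domain reflected_test_function[OF test_functions_mono[OF upper_subset \<phi>(1)]]])
    show "weak_gradient \<Omega> (extend (- 1) (\<phi> n)) (extend_gradient (- 1) (?D n))" for n
      by (rule odd_extension_weak_gradient[OF test_functions_H10[OF upper_open \<phi>(1)] D])
    show "L2_lim \<Omega> (\<lambda>n. extend (- 1) (\<phi> n)) (extend (- 1) g)"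
      unfolding extend_def by (intro L2_lim_glue \<phi>(2) scale lower)
    show "L2_lim \<Omega> (\<lambda>n. extend_gradient (- 1) (?D n) b) (extend_gradient (- 1) G b)" if "b \<in> Basis" for b
      unfolding extend_gradient_def
      by (intro L2_lim_glue \<phi>(3)[OF that] scale L2_lim_reflected_gradient[OF reflection_lower _ \<phi>(3)]) simp_all
  qed
qed

text \<open>
  For \<open>g\<close> in the form domain on the upper part,
  \<open>t\<^sub>+[R h, g] = t[h, S g] = \<langle>u, S g\<rangle> = \<langle>R u, g\<rangle>\<close>, where \<open>R\<close> folds and \<open>S\<close> extends.
\<close>

lemma fold_form_operator:
  assumes s: "cnj s = s"
    and dom: "D \<subseteq> H1 \<Omega>" "D' \<subseteq> H1 upper"
    and fold_across: "\<And>h. h \<in> D \<Longrightarrow> fold_across s h \<in> D'" and extend: "\<And>g. g \<in> D' \<Longrightarrow> extend s g \<in> D"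
    and grad: "\<And>g G. g \<in> D' \<Longrightarrow> weak_gradient upper g G \<Longrightarrow> weak_gradient \<Omega> (extend s g) (extend_gradient s G)"
    and hu: "(h, u) \<in> form_operator \<Omega> D (gradient_form \<Omega>)"
  shows "(fold_across s h, fold_across s u) \<in> form_operator upper D' (gradient_form upper)"
proof -
  have h: "h \<in> D" and u: "u \<in> L2 \<Omega>" and form: "\<And>h'. h' \<in> D \<Longrightarrow> gradient_form \<Omega> h h' = L2_inner \<Omega> u h'"
    using hu by (auto simp: form_operator_def)
  have H: "weak_gradient \<Omega> h (\<lambda>b. weak_deriv \<Omega> b h)"
    using h dom by (intro H1_weak_gradient) blast
  have "gradient_form upper (fold_across s h) g = L2_inner upper (fold_across s u) g" if g: "g \<in> D'" for g
  proof -
    have G: "weak_gradient upper g (\<lambda>b. weak_deriv upper b g)"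
      using g dom by (intro H1_weak_gradient) blast
    have "gradient_form upper (fold_across s h) g = gradient_form \<Omega> h (extend s g)"
      by (simp only: gradient_form_eq[OF upper_open fold_weak_gradient[OF H] G]
          gradient_form_eq[OF open_domain H grad[OF g G]] gradient_fold_extend[OF H G s])
    also have "\<dots> = L2_inner \<Omega> u (extend s g)" by (rule form[OF extend[OF g]])
    also have "\<dots> = L2_inner upper (fold_across s u) g"
      by (rule fold_extend_adjoint[OF u weak_gradientD(1)[OF G] s, symmetric])
    finally show ?thesis .
  qed
  then show ?thesis using fold_across[OF h] fold_L2[OF u] by (simp add: form_operator_def)
qed

end

section \<open>Heat kernels\<close>

lemma gradient_form_hermitian: "cnj (gradient_form U f g) = gradient_form U g f"
  unfolding gradient_form_def
  by (subst Bochner_Integration.integral_cnj[symmetric]) (simp add: mult.commute)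

lemma form_operator_symmetric:
  assumes "(h, u) \<in> form_operator U D (gradient_form U)" "(h', u') \<in> form_operator U D (gradient_form U)"
  shows "L2_inner U u h' = L2_inner U h u'"
proof -
  have "L2_inner U u h' = gradient_form U h h'" "L2_inner U u' h = gradient_form U h' h"
    using assms by (auto simp: form_operator_def)
  then show ?thesis by (metis L2_inner_cnj gradient_form_hermitian)
qed

lemma heat_kernel_continuous:
  assumes "is_heat_kernel U A p" "t > 0"
  shows "continuous_on (U \<times> U) (\<lambda>(x, y). p t x y)"
proof -
  have "continuous_on ({0<..} \<times> U \<times> U) (\<lambda>(t, x, y). p t x y)"
    using assms(1) unfolding is_heat_kernel_def smooth_on_def by (metis Ck_on.simps(1))
  then have "continuous_on (U \<times> U) (\<lambda>z. (\<lambda>(t, x, y). p t x y) (t, z))"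
    by (rule continuous_on_compose2) (use assms(2) in \<open>auto intro!: continuous_intros\<close>)
  then show ?thesis by (simp add: case_prod_unfold)
qed

text \<open>
  If \<open>K x y\<close> is not zero, then \<open>K\<close> keeps its sign near \<open>(x, y)\<close>. The exceptional null set in the first
  variable may depend on the ball, so one ball is chosen that works for all nearby points.
\<close>

lemma continuous_kernel_zero:
  fixes K :: "'a::euclidean_space \<Rightarrow> 'a \<Rightarrow> real"
  assumes U: "open U" and cont: "continuous_on (U \<times> U) (\<lambda>(x, y). K x y)"
    and zero: "\<And>y r. cball y r \<subseteq> U \<Longrightarrow> AE x in lebesgue_on U.
        integrable (lebesgue_on U) (\<lambda>z. K x z * indicator (cball y r) z)
        \<and> (LINT z|lebesgue_on U. K x z * indicator (cball y r) z) = 0"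
    and xy: "x \<in> U" "y \<in> U"
  shows "K x y = 0"
proof (rule ccontr)
  define \<kappa> where "\<kappa> = K x y"
  assume "K x y \<noteq> 0"
  then have \<kappa>: "\<kappa> \<noteq> 0" by (simp add: \<kappa>_def)
  have Um: "U \<in> sets lebesgue" using U by simp
  have "\<exists>d>0. \<forall>z\<in>U \<times> U. dist z (x, y) < d \<longrightarrow> dist ((\<lambda>(x, y). K x y) z) ((\<lambda>(x, y). K x y) (x, y)) < \<bar>\<kappa>\<bar> / 2"
  proof -
    have "(x, y) \<in> U \<times> U" "\<bar>\<kappa>\<bar> / 2 > 0" using xy \<kappa> by auto
    then show ?thesis using cont unfolding continuous_on_iff by blast
  qed
  then obtain d where d: "d > 0" "\<And>a b. a \<in> U \<Longrightarrow> b \<in> U \<Longrightarrow> dist (a, b) (x, y) < d \<Longrightarrow> \<bar>K a b - \<kappa>\<bar> < \<bar>\<kappa>\<bar> / 2"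
    by (auto simp: dist_real_def \<kappa>_def)
  obtain r1 where r1: "r1 > 0" "cball x r1 \<subseteq> U" using open_contains_cball U xy(1) by blast
  obtain r2 where r2: "r2 > 0" "cball y r2 \<subseteq> U" using open_contains_cball U xy(2) by blast
  \<comment> \<open>The distance of two pairs is at most the sum of the distances of their components.\<close>
  define r where "r = min (d / 3) (min r1 r2)"
  have r: "r > 0" "cball x r \<subseteq> U" "cball y r \<subseteq> U"
    using d(1) r1 r2 by (auto simp: r_def)
  have near: "K a b / \<kappa> \<ge> 1 / 2" if "a \<in> cball x r" "b \<in> cball y r" for a b
  proof -
    have "dist (a, b) (x, y) \<le> dist a x + dist b y"
      unfolding dist_Pair_Pair by (rule sqrt_sum_squares_le_sum) auto
    also have "\<dots> < d" using that d(1) by (auto simp: r_def dist_commute)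
    finally have "\<bar>K a b - \<kappa>\<bar> < \<bar>\<kappa>\<bar> / 2" using that r by (intro d(2)) auto
    then have "\<bar>(K a b - \<kappa>) / \<kappa>\<bar> < 1 / 2" using \<kappa> by (simp add: abs_divide divide_simps)
    moreover have "(K a b - \<kappa>) / \<kappa> = K a b / \<kappa> - 1" using \<kappa> by (simp add: diff_divide_distrib)
    ultimately show ?thesis by linarith
  qed
  have "AE a in lebesgue. a \<in> U \<longrightarrow> integrable (lebesgue_on U) (\<lambda>z. K a z * indicator (cball y r) z)
        \<and> (LINT z|lebesgue_on U. K a z * indicator (cball y r) z) = 0"
    using zero[OF r(3)] Um by (subst (asm) AE_restrict_space_iff) auto
  then obtain N where N: "N \<in> null_sets lebesgue"
    "\<And>a. a \<in> U \<Longrightarrow> a \<notin> N \<Longrightarrow> integrable (lebesgue_on U) (\<lambda>z. K a z * indicator (cball y r) z)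
        \<and> (LINT z|lebesgue_on U. K a z * indicator (cball y r) z) = 0"
    by (auto elim!: AE_E3)
  have "\<not> ball x r \<subseteq> N"
  proof
    assume "ball x r \<subseteq> N"
    then have "negligible (ball x r)"
      using N(1) negligible_subset by (auto simp: negligible_iff_null_sets)
    then show False using open_not_negligible[of "ball x r"] r(1) by simp
  qed
  then obtain a where a: "a \<in> ball x r" "a \<notin> N" by blast
  then have aU: "a \<in> U" and ac: "a \<in> cball x r" using r(2) by auto
  have int: "integrable (lebesgue_on U) (\<lambda>z. K a z * indicator (cball y r) z)"
    "(LINT z|lebesgue_on U. K a z * indicator (cball y r) z) = 0"
    using N(2)[OF aU a(2)] by auto
  have ci: "integrable (lebesgue_on U) (\<lambda>z. indicator (cball y r) z :: real)"
    by (rule compact_indicator_integrable[OF compact_cball Um])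
  have "(LINT z|lebesgue_on U. 1 / 2 * indicator (cball y r) z) \<le> (LINT z|lebesgue_on U. 1 / \<kappa> * (K a z * indicator (cball y r) z))"
    using near[OF ac] by (intro integral_mono integrable_mult_right ci int(1)) (auto simp: indicator_def)
  also have "\<dots> = 0" using int(2) by simp
  finally have "(LINT z|lebesgue_on U. indicator (cball y r) z :: real) \<le> 0" by simp
  moreover have "(LINT z|lebesgue_on U. indicator (cball y r) z :: real) = measure lebesgue (cball y r)"
  proof -
    have "(\<lambda>z. indicator U z *\<^sub>R (indicator (cball y r) z :: real)) = indicator (cball y r)"
      using r(3) by (auto simp: indicator_def fun_eq_iff)
    moreover have "U \<inter> space lebesgue \<in> sets lebesgue" using Um by simp
    ultimately have "(LINT z|lebesgue_on U. indicator (cball y r) z :: real) = (LINT z|lebesgue. indicator (cball y r) z)"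
      by (simp only: integral_restrict_space)
    then show ?thesis by simp
  qed
  moreover have "measure lebesgue (cball y r) > 0"
    using content_cball_pos[OF r(1), of y] by simp
  ultimately show False by linarith
qed

context symmetric_domain
begin

lemma AE_upper: "AE x in lebesgue_on \<Omega>. P x \<Longrightarrow> AE x in lebesgue_on upper. P x"
  by (subst (asm) AE_restrict_space_iff, simp, subst AE_restrict_space_iff, simp)
     (auto elim!: eventually_mono dest: subsetD[OF upper_subset])

text \<open>
  The semigroups are compared on the indicator of a ball \<open>B\<close> in the upper part. Folding does not change it
  there, because the mirror image of the upper part does not meet \<open>B\<close>.
\<close>

theorem heat_kernel_folding:
  fixes r :: real
  assumes p: "is_heat_kernel \<Omega> A p" and q: "is_heat_kernel upper A' q"
    and intertwines: "\<And>h u. (h, u) \<in> A \<Longrightarrow> (fold_across (of_real r) h, fold_across (of_real r) u) \<in> A'"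
    and symmetric': "\<And>h u h' u'. (h, u) \<in> A' \<Longrightarrow> (h', u') \<in> A' \<Longrightarrow> L2_inner upper u h' = L2_inner upper h u'"
    and t: "t > 0" and xy: "x \<in> upper" "y \<in> upper"
  shows "q t x y = p t x y + r * p t (\<sigma> x) y"
proof -
  let ?s = "complex_of_real r"
  obtain E where E: "is_spectral_resolution \<Omega> A E"
    "\<And>f. f \<in> L2 \<Omega> \<Longrightarrow> \<exists>u. (f, u) \<in> spectral_integral \<Omega> E (\<lambda>s. exp (- t * s)) \<and>
           (AE x in lebesgue_on \<Omega>. integrable (lebesgue_on \<Omega>) (\<lambda>y. complex_of_real (p t x y) * f y) \<and>
              u x = (LINT y|lebesgue_on \<Omega>. complex_of_real (p t x y) * f y))"
    using p t unfolding is_heat_kernel_def by blast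
  obtain E' where E': "is_spectral_resolution upper A' E'"
    "\<And>f. f \<in> L2 upper \<Longrightarrow> \<exists>u. (f, u) \<in> spectral_integral upper E' (\<lambda>s. exp (- t * s)) \<and>
           (AE x in lebesgue_on upper. integrable (lebesgue_on upper) (\<lambda>y. complex_of_real (q t x y) * f y) \<and>
              u x = (LINT y|lebesgue_on upper. complex_of_real (q t x y) * f y))"
    using q t unfolding is_heat_kernel_def by blast
  define K where "K x y = q t x y - p t x y - r * p t (\<sigma> x) y" for x y
  have "K x y = 0"
  proof (rule continuous_kernel_zero[OF upper_open _ _ xy])
    have cp: "continuous_on (\<Omega> \<times> \<Omega>) (\<lambda>(x, y). p t x y)" by (rule heat_kernel_continuous[OF p t])
    have c1: "continuous_on (upper \<times> upper) (\<lambda>z. (\<lambda>(x, y). p t x y) z)"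
      using upper_subset by (intro continuous_on_subset[OF cp]) auto
    have c2: "continuous_on (upper \<times> upper) (\<lambda>z. (\<lambda>(x, y). p t x y) (\<sigma> (fst z), snd z))"
      using upper_subset
      by (intro continuous_on_compose2[OF cp])
         (auto intro!: continuous_intros bounded_linear.continuous_on[OF reflection_bounded_linear] simp: reflection_mem)
    have "continuous_on (upper \<times> upper) (\<lambda>z. (\<lambda>(x, y). q t x y) z - (\<lambda>(x, y). p t x y) z
        - r * (\<lambda>(x, y). p t x y) (\<sigma> (fst z), snd z))"
      by (intro continuous_intros heat_kernel_continuous[OF q t] c1 c2)
    then show "continuous_on (upper \<times> upper) (\<lambda>(x, y). K x y)"
      by (simp add: K_def case_prod_unfold)
  next
    fix y \<rho> assume B: "cball y \<rho> \<subseteq> upper"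
    let ?B = "cball y \<rho>"
    define f where "f x = complex_of_real (1 * indicator ?B x)" for x
    have fL2: "f \<in> L2 \<Omega>" unfolding f_def[abs_def] by (rule indicator_L2) simp_all
    obtain u where u: "(f, u) \<in> spectral_integral \<Omega> E (\<lambda>s. exp (- t * s))"
      "AE x in lebesgue_on \<Omega>. integrable (lebesgue_on \<Omega>) (\<lambda>y. complex_of_real (p t x y) * f y) \<and>
              u x = (LINT y|lebesgue_on \<Omega>. complex_of_real (p t x y) * f y)"
      using E(2)[OF fL2] by blast
    obtain w where w: "(fold_across ?s f, w) \<in> spectral_integral upper E' (\<lambda>s. exp (- t * s))"
      "AE x in lebesgue_on upper. integrable (lebesgue_on upper) (\<lambda>y. complex_of_real (q t x y) * fold_across ?s f y) \<and>
              w x = (LINT y|lebesgue_on upper. complex_of_real (q t x y) * fold_across ?s f y)"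
      using E'(2)[OF fold_L2[OF fL2]] by blast
    have "ae_eq upper (fold_across ?s u) w"
    proof (rule semigroup_intertwining[where R = "fold_across ?s" and S = "extend ?s", OF E(1) E'(1) fold_L2 extend_L2 _ intertwines symmetric' _ _ fL2 u(1) w(1)])
      show "L2_inner upper (fold_across ?s h) g = L2_inner \<Omega> h (extend ?s g)" if "h \<in> L2 \<Omega>" "g \<in> L2 upper" for h g
        using that by (rule fold_extend_adjoint) simp
    qed (use E(2) E'(2) in blast)+
    then have ae: "AE x in lebesgue_on upper. u x + ?s * u (\<sigma> x) = w x"
      by (simp add: ae_eq_def fold_across_def)
    have f_upper: "fold_across ?s f z = f z" if "z \<in> upper" for z
    proof -
      have "\<sigma> z \<notin> upper" using that by (simp add: upper_def reflection_inner_normal)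
      then have "\<sigma> z \<notin> ?B" using B by blast
      then show ?thesis by (simp add: fold_across_def f_def)
    qed
    have q_int: "integrable (lebesgue_on upper) (\<lambda>y. complex_of_real (q t x y) * fold_across ?s f y)
        \<longleftrightarrow> integrable (lebesgue_on upper) (\<lambda>y. complex_of_real (q t x y) * f y)"
      "(LINT y|lebesgue_on upper. complex_of_real (q t x y) * fold_across ?s f y)
        = (LINT y|lebesgue_on upper. complex_of_real (q t x y) * f y)" for x
      by (auto intro!: Bochner_Integration.integrable_cong Bochner_Integration.integral_cong
          simp: f_upper space_restrict_space)
    have p_int: "(LINT y|lebesgue_on \<Omega>. complex_of_real (p t x y) * f y)
        = (LINT y|lebesgue_on upper. complex_of_real (p t x y) * f y)" for x
      using B upper_subset by (intro integral_lebesgue_on_support) (auto simp: indicator_def f_def)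
    have u_refl: "AE x in lebesgue_on \<Omega>. integrable (lebesgue_on \<Omega>) (\<lambda>y. complex_of_real (p t (\<sigma> x) y) * f y) \<and>
              u (\<sigma> x) = (LINT y|lebesgue_on \<Omega>. complex_of_real (p t (\<sigma> x) y) * f y)"
      by (rule reflection_AE) (use u(2) in \<open>simp_all only: symmetric measurable_domains\<close>)
    show "AE x in lebesgue_on upper.
        integrable (lebesgue_on upper) (\<lambda>z. K x z * indicator ?B z)
        \<and> (LINT z|lebesgue_on upper. K x z * indicator ?B z) = 0"
      using ae w(2) AE_upper[OF u(2)] AE_upper[OF u_refl]
    proof eventually_elim
      case (elim x)
      have i1: "integrable (lebesgue_on upper) (\<lambda>y. complex_of_real (q t x y) * f y)"
        using elim(2) q_int by simp
      have i2: "integrable (lebesgue_on upper) (\<lambda>y. complex_of_real (p t x y) * f y)"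
        using elim(3) by (intro integral_fold(1)) blast
      have i3: "integrable (lebesgue_on upper) (\<lambda>y. complex_of_real (p t (\<sigma> x) y) * f y)"
        using elim(4) by (intro integral_fold(1)) blast
      have K: "complex_of_real (K x z * indicator ?B z) = complex_of_real (q t x z) * f z
          - complex_of_real (p t x z) * f z - ?s * (complex_of_real (p t (\<sigma> x) z) * f z)" for z
        by (simp add: K_def f_def algebra_simps)
      have "integrable (lebesgue_on upper) (\<lambda>z. complex_of_real (K x z * indicator ?B z))"
        unfolding K by (intro Bochner_Integration.integrable_diff integrable_mult_right i1 i2 i3)
      then have int: "integrable (lebesgue_on upper) (\<lambda>z. K x z * indicator ?B z)"
        by (simp only: complex_of_real_integrable_eq)
      have "complex_of_real (LINT z|lebesgue_on upper. K x z * indicator ?B z)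
          = (LINT z|lebesgue_on upper. complex_of_real (K x z * indicator ?B z))"
        by (rule integral_complex_of_real[symmetric])
      also have "\<dots> = w x - u x - ?s * u (\<sigma> x)"
        unfolding K
        using elim(2-4) q_int p_int
        by (simp only: Bochner_Integration.integral_diff[OF Bochner_Integration.integrable_diff[OF i1 i2] integrable_mult_right[OF i3]]
            Bochner_Integration.integral_diff[OF i1 i2] integral_mult_right_zero)
      also have "\<dots> = 0" using elim(1) by (simp flip: elim(1))
      finally show ?case using int by simp
    qed
  qed
  then show ?thesis by (simp add: K_def)
qed

lemma neumann_folding:
  assumes "(h, u) \<in> neumann_laplacian \<Omega>"
  shows "(fold_across 1 h, fold_across 1 u) \<in> neumann_laplacian upper"
  unfolding neumann_laplacian_def
proof (rule fold_form_operator[OF _ order_refl order_refl _ _ _ assms[unfolded neumann_laplacian_def]])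
  show "fold_across 1 f \<in> H1 upper" if "f \<in> H1 \<Omega>" for f
    by (rule weak_gradient_H1[OF fold_weak_gradient[OF H1_weak_gradient[OF that]]])
  show "extend 1 g \<in> H1 \<Omega>" if "g \<in> H1 upper" for g
    by (rule weak_gradient_H1[OF even_extension_weak_gradient[OF H1_weak_gradient[OF that]]])
qed (simp, rule even_extension_weak_gradient)

lemma dirichlet_folding:
  assumes "(h, u) \<in> dirichlet_laplacian \<Omega>"
  shows "(fold_across (- 1) h, fold_across (- 1) u) \<in> dirichlet_laplacian upper"
  unfolding dirichlet_laplacian_def
proof (rule fold_form_operator[OF _ _ _ _ _ _ assms[unfolded dirichlet_laplacian_def]])
  show "H10 \<Omega> \<subseteq> H1 \<Omega>" "H10 upper \<subseteq> H1 upper" by (auto dest: H10_D)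
qed (simp, (rule fold_H10 extend_H10 odd_extension_weak_gradient, assumption+)+)

theorem neumann_heat_kernel_folding:
  assumes p: "neumann_heat_kernel \<Omega> p" and q: "neumann_heat_kernel upper q"
    and txy: "t > 0" "x \<in> upper" "y \<in> upper"
  shows "q t x y = p t x y + p t (\<sigma> x) y"
proof -
  have "q t x y = p t x y + 1 * p t (\<sigma> x) y"
  proof (rule heat_kernel_folding[OF p[unfolded neumann_heat_kernel_def] q[unfolded neumann_heat_kernel_def] _ _ txy])
    show "(fold_across (of_real 1) h, fold_across (of_real 1) u) \<in> neumann_laplacian upper"
      if "(h, u) \<in> neumann_laplacian \<Omega>" for h u
      unfolding of_real_1 by (rule neumann_folding[OF that])
  qed (unfold neumann_laplacian_def, rule form_operator_symmetric)
  then show ?thesis by simp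
qed

theorem dirichlet_heat_kernel_folding:
  assumes p: "dirichlet_heat_kernel \<Omega> p" and q: "dirichlet_heat_kernel upper q"
    and txy: "t > 0" "x \<in> upper" "y \<in> upper"
  shows "q t x y = p t x y - p t (\<sigma> x) y"
proof -
  have "q t x y = p t x y + (- 1) * p t (\<sigma> x) y"
  proof (rule heat_kernel_folding[OF p[unfolded dirichlet_heat_kernel_def] q[unfolded dirichlet_heat_kernel_def] _ _ txy])
    show "(fold_across (of_real (- 1)) h, fold_across (of_real (- 1)) u) \<in> dirichlet_laplacian upper"
      if "(h, u) \<in> dirichlet_laplacian \<Omega>" for h u
      unfolding of_real_minus of_real_1 by (rule dirichlet_folding[OF that])
  qed (unfold dirichlet_laplacian_def, rule form_operator_symmetric)
  then show ?thesis by simp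
qed

end

theorem corollary1p2:
  fixes v :: "real ^ 'n"
    and \<Omega> \<Omega>_plus :: "(real ^ 'n) set"
    and pN pD pN_plus pD_plus :: "real \<Rightarrow> real ^ 'n \<Rightarrow> real ^ 'n \<Rightarrow> real"
  assumes "v \<noteq> 0"
    and "open \<Omega>" and "\<Omega> \<noteq> {}"
    and "hyperplane_reflection v ` \<Omega> = \<Omega>"
    and "\<Omega>_plus = {\<omega> \<in> \<Omega>. \<omega> \<bullet> v > 0}"
    and "neumann_heat_kernel \<Omega>_plus pN_plus"
    and "dirichlet_heat_kernel \<Omega>_plus pD_plus"
    and "neumann_heat_kernel \<Omega> pN"
    and "dirichlet_heat_kernel \<Omega> pD"
  shows "(\<forall>t>0. \<forall>x\<in>\<Omega>_plus. \<forall>y\<in>\<Omega>_plus.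
            pN_plus t x y = pN t x y + pN t (hyperplane_reflection v x) y) \<and>
         (\<forall>t>0. \<forall>x\<in>\<Omega>_plus. \<forall>y\<in>\<Omega>_plus.
            pD_plus t x y = pD t x y - pD t (hyperplane_reflection v x) y)"
proof -
  interpret symmetric_domain v \<Omega> by unfold_locales (fact assms)+
  have upper: "\<Omega>_plus = upper" by (simp add: assms(5) upper_def)
  show ?thesis
    using neumann_heat_kernel_folding[OF assms(8) assms(6)[unfolded upper]]
      dirichlet_heat_kernel_folding[OF assms(9) assms(7)[unfolded upper]]
    unfolding upper by blast
qed

end
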